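(* Let $g(W):=(1+W)\log(1+W)$. Let $W\in C([-\tau_0,\tau_1],H^s(\mathbb{R}))$ be a solution of the log--KdV equation $$2W_\tau+\frac{1}{12}W_{\xi\xi\xi}+(g(W))_\xi=0$$ for some integer $s\geq6$ and some $\tau_0,\tau_1\geq0$, where $W=W(\xi,\tau)$. Assume that there exists $r_W>-1$ such that $W\geq r_W$. Define $$P_\epsilon:=-W+\frac{\epsilon}{2}W_\xi-\frac{\epsilon^2}{8}W_{\xi\xi}-\frac{\epsilon^2}{2}g(W)+\frac{\epsilon^3}{48}W_{\xi\xi\xi}+\frac{\epsilon^3}{4}(g(W))_\xi.$$ Then there exist positive constants $\epsilon_0$ and $C_0$ such that, for all $\epsilon\in(0,\epsilon_0)$, when initial data $(w_{{\rm ini},\epsilon},p_{{\rm ini},\epsilon})\in l^2(\mathbb{Z})\times l^2(\mathbb{Z})$ are given such that $$\|w_{{\rm ini},\epsilon}-W(\epsilon\,\cdot,0)\|_{l^2}+\|p_{{\rm ini},\epsilon}-P_\epsilon(\epsilon\,\cdot,0)\|_{l^2}\leq\epsilon^{3/2},$$ the unique solution $(w_\epsilon,p_\epsilon)$ of the lattice equations $$\dot w_n=p_{n+1}-p_n,\qquad \dot p_n=\tilde V_\epsilon'(w_n)-\tilde V_\epsilon'(w_{n-1}),\qquad n\in\mathbb{Z},$$ with initial data $(w_{{\rm ini},\epsilon},p_{{\rm ini},\epsilon})$ at $t=0$ belongs to $C^1([-\tau_0\epsilon^{-3},\tau_1\epsilon^{-3}],l^2(\mathbb{Z}))$ (each component)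 and satisfies $$\|w_\epsilon(t)-W(\epsilon(\cdot-t),\epsilon^3t)\|_{l^2}+\|p_\epsilon(t)-P_\epsilon(\epsilon(\cdot-t),\epsilon^3t)\|_{l^2}\leq C_0\,\epsilon^{3/2},\qquad t\in[-\tau_0\epsilon^{-3},\tau_1\epsilon^{-3}].$$
   Context: For $\epsilon>0$ and $w>-1$, $$\tilde V_\epsilon(w):=\frac{1}{2+\epsilon^2}\left[(1+w)^{2+\epsilon^2}-1\right]-w,\qquad \tilde V_\epsilon'(w)=(1+w)^{1+\epsilon^2}-1.$$ The dot is the derivative in time $t$; solutions of the lattice equations have all components $w_n>-1$. Subscripts $\xi,\tau$ denote partial derivatives. For a function $F$ of $(\xi,\tau)$, $F(\epsilon\,\cdot,0)$ denotes the sequence $(F(\epsilon n,0))_{n\in\mathbb{Z}}$ and $F(\epsilon(\cdot-t),\epsilon^3t)$ denotes the sequence $(F(\epsilon(n-t),\epsilon^3t))_{n\in\mathbb{Z}}$. *)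

theory Defs
  imports "HOL-Analysis.Analysis"
begin

subsection \<open>Sobolev spaces on the real line\<close>

definition square_integrable :: "(real \<Rightarrow> real) \<Rightarrow> bool" where
  "square_integrable f \<longleftrightarrow>
     f \<in> borel_measurable lborel \<and> integrable lborel (\<lambda>x. (f x)\<^sup>2)"

definition test_function :: "(real \<Rightarrow> real) \<Rightarrow> bool" where
  "test_function \<phi> \<longleftrightarrow>
     (\<forall>k x. (deriv ^^ k) \<phi> differentiable (at x)) \<and> compact (closure {x. \<phi> x \<noteq> 0})"

definition has_weak_deriv :: "nat \<Rightarrow> (real \<Rightarrow> real) \<Rightarrow> (real \<Rightarrow> real) \<Rightarrow> bool" where
  "has_weak_deriv k f h \<longleftrightarrow>
     (\<forall>\<phi>. test_function \<phi> \<longrightarrow>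
        (LINT x|lborel. f x * (deriv ^^ k) \<phi> x) = (-1) ^ k * (LINT x|lborel. h x * \<phi> x))"

definition sobolev_space :: "nat \<Rightarrow> (real \<Rightarrow> real) set" where
  "sobolev_space s =
     {f. square_integrable f \<and> (\<forall>k\<le>s. \<exists>h. square_integrable h \<and> has_weak_deriv k f h)}"

text \<open>Weak derivatives are determined only up to null sets; the choice below does not
  affect the norm.\<close>

definition weak_deriv :: "nat \<Rightarrow> (real \<Rightarrow> real) \<Rightarrow> (real \<Rightarrow> real)" where
  "weak_deriv k f = (SOME h. square_integrable h \<and> has_weak_deriv k f h)"

definition sobolev_norm :: "nat \<Rightarrow> (real \<Rightarrow> real) \<Rightarrow> real" where
  "sobolev_norm s f = sqrt (\<Sum>k\<le>s. LINT x|lborel. (weak_deriv k f x)\<^sup>2)"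

text \<open>\<open>W \<in> C(I, H\<^sup>s)\<close> for a function \<open>W\<close> of \<open>(\<xi>, \<tau>)\<close>. An element of \<open>H\<^sup>s\<close> is a class of
  functions modulo null sets; since point values of \<open>W\<close> are used, each \<open>W(\<cdot>, \<tau>)\<close> is required
  to be the continuous representative (which exists for \<open>s \<ge> 1\<close>).\<close>

definition continuous_into_sobolev ::
    "nat \<Rightarrow> real set \<Rightarrow> (real \<Rightarrow> real \<Rightarrow> real) \<Rightarrow> bool" where
  "continuous_into_sobolev s I W \<longleftrightarrow>
     (\<forall>\<tau>\<in>I. (\<lambda>\<xi>. W \<xi> \<tau>) \<in> sobolev_space s \<and> continuous_on UNIV (\<lambda>\<xi>. W \<xi> \<tau>)) \<and>
     (\<forall>\<tau>\<in>I. ((\<lambda>\<sigma>. sobolev_norm s (\<lambda>\<xi>. W \<xi> \<sigma> - W \<xi> \<tau>)) \<longlongrightarrow> 0) (at \<tau> within I))"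


subsection \<open>The log-KdV equation\<close>

definition g :: "real \<Rightarrow> real" where
  "g w = (1 + w) * ln (1 + w)"

text \<open>For \<open>s \<ge> 6\<close>, all derivatives below of a solution in \<open>C(I, H\<^sup>s)\<close> bounded away from \<open>-1\<close>
  are classical: \<open>W(\<cdot>, \<tau>)\<close> is five times continuously differentiable, and the equation puts
  \<open>W\<^sub>\<tau>\<close> in \<open>C(I, H\<^bsup>s-3\<^esup>)\<close>. At endpoints of \<open>I\<close> the derivative in \<open>\<tau>\<close> is one-sided.\<close>

definition log_KdV_solution :: "real set \<Rightarrow> (real \<Rightarrow> real \<Rightarrow> real) \<Rightarrow> bool" where
  "log_KdV_solution I W \<longleftrightarrow>
     (\<forall>\<tau>\<in>I. \<forall>\<xi>. \<exists>W\<tau>. ((\<lambda>\<sigma>. W \<xi> \<sigma>) has_real_derivative W\<tau>) (at \<tau> within I) \<and>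
        2 * W\<tau> + 1 / 12 * (deriv ^^ 3) (\<lambda>x. W x \<tau>) \<xi> + deriv (\<lambda>x. g (W x \<tau>)) \<xi> = 0)"

definition P :: "(real \<Rightarrow> real \<Rightarrow> real) \<Rightarrow> real \<Rightarrow> real \<Rightarrow> real \<Rightarrow> real" where
  "P W \<epsilon> \<xi> \<tau> =
     - W \<xi> \<tau>
     + \<epsilon> / 2 * deriv (\<lambda>x. W x \<tau>) \<xi>
     - \<epsilon>^2 / 8 * (deriv ^^ 2) (\<lambda>x. W x \<tau>) \<xi>
     - \<epsilon>^2 / 2 * g (W \<xi> \<tau>)
     + \<epsilon>^3 / 48 * (deriv ^^ 3) (\<lambda>x. W x \<tau>) \<xi>
     + \<epsilon>^3 / 4 * deriv (\<lambda>x. g (W x \<tau>)) \<xi>"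


subsection \<open>Square-summable sequences\<close>

definition l2 :: "(int \<Rightarrow> real) set" where
  "l2 = {a. (\<lambda>n. (a n)\<^sup>2) summable_on UNIV}"

definition l2_norm :: "(int \<Rightarrow> real) \<Rightarrow> real" where
  "l2_norm a = sqrt (\<Sum>\<^sub>\<infinity>n. (a n)\<^sup>2)"

definition C1_into_l2 :: "real set \<Rightarrow> (real \<Rightarrow> int \<Rightarrow> real) \<Rightarrow> bool" where
  "C1_into_l2 I u \<longleftrightarrow>
     (\<forall>t\<in>I. u t \<in> l2) \<and>
     (\<exists>u'. (\<forall>t\<in>I. u' t \<in> l2) \<and>
        (\<forall>t\<in>I. ((\<lambda>r. l2_norm (\<lambda>n. (u r n - u t n) / (r - t) - u' t n)) \<longlongrightarrow> 0) (at t within I)) \<and>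
        (\<forall>t\<in>I. ((\<lambda>r. l2_norm (\<lambda>n. u' r n - u' t n)) \<longlongrightarrow> 0) (at t within I)))"


subsection \<open>The lattice equations\<close>

definition V :: "real \<Rightarrow> real \<Rightarrow> real" where
  "V \<epsilon> w = 1 / (2 + \<epsilon>^2) * ((1 + w) powr (2 + \<epsilon>^2) - 1) - w"

definition V' :: "real \<Rightarrow> real \<Rightarrow> real" where
  "V' \<epsilon> w = (1 + w) powr (1 + \<epsilon>^2) - 1"

lemma V_has_real_derivative:
  assumes "w > -1"
  shows "(V \<epsilon> has_real_derivative V' \<epsilon> w) (at w)"
proof -
  have pos: "2 + \<epsilon>^2 > 0"
    by (simp add: add_pos_nonneg)
  have "((\<lambda>w. 1 / (2 + \<epsilon>^2) * ((1 + w) powr (2 + \<epsilon>^2) - 1) - w) has_real_derivative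
      1 / (2 + \<epsilon>^2) * ((2 + \<epsilon>^2) * (1 + w) powr (2 + \<epsilon>^2 - 1)) - 1) (at w)"
    using assms by (auto intro!: derivative_eq_intros)
  moreover have "1 / (2 + \<epsilon>^2) * ((2 + \<epsilon>^2) * (1 + w) powr (2 + \<epsilon>^2 - 1)) - 1 = V' \<epsilon> w"
    using pos by (simp add: V'_def)
  ultimately show ?thesis
    unfolding V_def[abs_def] by simp
qed

definition solves_lattice_ivp ::
    "real \<Rightarrow> real set \<Rightarrow> (int \<Rightarrow> real) \<Rightarrow> (int \<Rightarrow> real) \<Rightarrow>
     (real \<Rightarrow> int \<Rightarrow> real) \<Rightarrow> (real \<Rightarrow> int \<Rightarrow> real) \<Rightarrow> bool" where
  "solves_lattice_ivp \<epsilon> I w0 p0 w p \<longleftrightarrow>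
     w 0 = w0 \<and> p 0 = p0 \<and>
     (\<forall>t\<in>I. \<forall>n. w t n > -1 \<and>
        ((\<lambda>r. w r n) has_real_derivative p t (n + 1) - p t n) (at t within I) \<and>
        ((\<lambda>r. p r n) has_real_derivative V' \<epsilon> (w t n) - V' \<epsilon> (w t (n - 1))) (at t within I))"

text \<open>Uniqueness refers to solutions whose components are \<open>C\<^sup>1\<close> with values in \<open>l\<^sup>2\<close>, the phase
  space of the initial value problem. It is stated on every compact interval \<open>{a..b} \<subseteq> I\<close> containing \<open>0\<close>: a local solution is a restriction of
  the given one.\<close>

definition unique_l2_solution ::
    "real \<Rightarrow> real set \<Rightarrow> (int \<Rightarrow> real) \<Rightarrow> (int \<Rightarrow> real) \<Rightarrow>
     (real \<Rightarrow> int \<Rightarrow> real) \<Rightarrow> (real \<Rightarrow> int \<Rightarrow> real) \<Rightarrow> bool" where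
  "unique_l2_solution \<epsilon> I w0 p0 w p \<longleftrightarrow>
     (\<forall>a b v q. a \<le> 0 \<and> 0 \<le> b \<and> {a..b} \<subseteq> I \<and>
        solves_lattice_ivp \<epsilon> {a..b} w0 p0 v q \<and>
        C1_into_l2 {a..b} v \<and> C1_into_l2 {a..b} q \<longrightarrow>
        (\<forall>t\<in>{a..b}. v t = w t \<and> q t = p t))"

end

theory Submission
  imports Defs "HOL-Computational_Algebra.Polynomial"
begin

text \<open>
  Why the log-KdV equation governs long waves of the lattice: put \<open>h = \<epsilon> / 2\<close> and
  \<open>Q w = w + \<epsilon>\<^sup>2 / 2 * g w\<close>. The polynomial \<open>P\<^sub>\<epsilon>\<close> is, to the order that matters, the Taylor
  expansion of \<open>- Q (W (\<xi> - h))\<close>, because \<open>1 - x / 2 + x\<^sup>2 / 8 - x\<^sup>3 / 48\<close> starts the series of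
  \<open>exp (- x / 2)\<close>. The proof therefore compares the lattice solution with the half-shifted pair
  \<open>(W (\<xi>), - Q (W (\<xi> - h)))\<close>, \<open>\<xi> = \<epsilon> (n - t)\<close>, and replaces \<open>- Q (W (\<xi> - h))\<close> by \<open>P\<^sub>\<epsilon>\<close> only at the
  very end, where an error of order \<open>\<epsilon>\<^sup>2\<close> is harmless: sampling at spacing \<open>\<epsilon>\<close> costs a factor
  \<open>\<epsilon>\<close> to the power \<open>-1/2\<close> and leaves \<open>\<epsilon>\<close> to the power \<open>3/2\<close>.

  With this pair both lattice equations become centred differences. Even orders in \<open>\<epsilon>\<close> cancel by
  symmetry, the order \<open>\<epsilon>\<close> cancels because the frame moves with unit speed, and the order \<open>\<epsilon>\<^sup>3\<close> is the
  log-KdV equation. What is left are a fifth-order Taylor remainder of \<open>W\<close>, a third-order remainder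
  of \<open>g W\<close> multiplied by \<open>\<epsilon>\<^sup>2\<close>, and the part of \<open>V'\<close> beyond \<open>w + \<epsilon>\<^sup>2 g w\<close>, which is of order
  \<open>\<epsilon>\<^sup>4\<close> (\<open>residual1_bound\<close>, \<open>residual2_bound\<close>). Their squares are bounded by \<open>\<epsilon>\<^sup>9\<close> times integrals of
  squared derivatives up to the fifth over disjoint cells of length \<open>\<epsilon>\<close>, so the residual is of
  \<open>l\<^sup>2\<close> size \<open>\<epsilon>\<close> to the power \<open>9/2\<close>. The half shift is what keeps the count of derivatives low:
  no third derivative of \<open>W\<close> has to be differentiated in \<open>\<tau>\<close>, which would require point values of
  the sixth derivative in \<open>\<xi>\<close>.

  The error is controlled by the energy
  \<open>\<Sum>\<^sub>n q\<^sub>n\<^sup>2 / 2 + \<Phi> (w\<^sub>n) - \<Phi> (X\<^sub>n) - \<phi> (X\<^sub>n) (w\<^sub>n - X\<^sub>n)\<close>, a convexity defect of the potential.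
  Its leading terms telescope, and the remaining drift is \<open>O(\<epsilon>\<^sup>3)\<close> times the energy, because the
  third derivative of the potential is \<open>O(\<epsilon>\<^sup>2)\<close> and the wave changes at a rate \<open>O(\<epsilon>)\<close> in time.
  Gronwall's lemma on an interval of length \<open>O(\<epsilon>\<^sup>-\<^sup>3)\<close> then gives the bound
  (\<open>lattice_energy_estimate\<close>).

  No continuation argument is needed. The force \<open>V'\<close> is first replaced, outside a compact interval
  around the range of \<open>W\<close>, by its linear extrapolation (\<open>force_extension\<close>). The modified lattice is a
  globally Lipschitz differential equation in the Hilbert space \<open>l\<^sup>2 \<times> l\<^sup>2\<close> and has a global solution
  (\<open>lattice_global_solution\<close>); the energy estimate holds for it without any smallness assumption, and
  shows afterwards that the solution never leaves the interval on which the force was not changed.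

  Two pieces of background are developed on the way: the space \<open>l\<^sup>2\<close> as a Hilbert space together with
  Lipschitz differential equations in Banach spaces, and the fact that a continuous function in
  \<open>H\<^sup>s(\<real>)\<close> has \<open>s - 1\<close> continuous derivatives, which agree with the weak ones almost everywhere
  (\<open>sobolev_classical_derivatives\<close>).
\<close>

section \<open>Square-summable sequences as a Hilbert space\<close>

text \<open>
  Bounds on finite partial sums are the interface to \<open>l\<^sup>2\<close> throughout: the lattice estimates below
  are proved for finite sets of sites.
\<close>

lemma l2_iff_bounded: "a \<in> l2 \<longleftrightarrow> (\<exists>C. \<forall>F. finite F \<longrightarrow> (\<Sum>n\<in>F. (a n)\<^sup>2) \<le> C)"
proof
  assume "a \<in> l2"
  then have "(\<lambda>n. (a n)\<^sup>2) summable_on UNIV" by (simp add: l2_def)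
  then have "\<forall>F. finite F \<longrightarrow> (\<Sum>n\<in>F. (a n)\<^sup>2) \<le> (\<Sum>\<^sub>\<infinity>n. (a n)\<^sup>2)"
    by (auto intro!: finite_sum_le_infsum)
  then show "\<exists>C. \<forall>F. finite F \<longrightarrow> (\<Sum>n\<in>F. (a n)\<^sup>2) \<le> C" by blast
next
  assume "\<exists>C. \<forall>F. finite F \<longrightarrow> (\<Sum>n\<in>F. (a n)\<^sup>2) \<le> C"
  then obtain C where "\<forall>F. finite F \<longrightarrow> (\<Sum>n\<in>F. (a n)\<^sup>2) \<le> C" by blast
  then show "a \<in> l2"
    unfolding l2_def mem_Collect_eq
    by (intro nonneg_bdd_above_summable_on) (auto intro!: bdd_aboveI[where M = C])
qed

lemma l2_bound:
  assumes "\<And>F. finite F \<Longrightarrow> (\<Sum>n\<in>F. (a n)\<^sup>2) \<le> C\<^sup>2" "0 \<le> C"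
  shows "a \<in> l2" "l2_norm a \<le> C"
proof -
  show a: "a \<in> l2" using assms by (auto simp: l2_iff_bounded)
  then have "(\<Sum>\<^sub>\<infinity>n. (a n)\<^sup>2) \<le> C\<^sup>2"
    using assms by (intro infsum_le_finite_sums) (auto simp: l2_def)
  then show "l2_norm a \<le> C"
    unfolding l2_norm_def using assms(2) by (simp add: real_le_lsqrt infsum_nonneg)
qed

lemma sum_le_l2_norm:
  assumes "a \<in> l2" "finite F"
  shows "(\<Sum>n\<in>F. (a n)\<^sup>2) \<le> (l2_norm a)\<^sup>2"
proof -
  have "(\<Sum>n\<in>F. (a n)\<^sup>2) \<le> (\<Sum>\<^sub>\<infinity>n. (a n)\<^sup>2)"
    using assms by (intro finite_sum_le_infsum) (auto simp: l2_def)
  also have "\<dots> = (l2_norm a)\<^sup>2"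
    unfolding l2_norm_def by (simp add: infsum_nonneg)
  finally show ?thesis .
qed

lemma l2_norm_nonneg: "0 \<le> l2_norm a"
  by (simp add: l2_norm_def infsum_nonneg)

lemma abs_le_l2_norm:
  assumes "a \<in> l2" shows "\<bar>a n\<bar> \<le> l2_norm a"
proof -
  have "(a n)\<^sup>2 \<le> (l2_norm a)\<^sup>2" using sum_le_l2_norm[OF assms, of "{n}"] by simp
  then show ?thesis using abs_le_square_iff[of "a n" "l2_norm a"] l2_norm_nonneg[of a] by simp
qed

lemma l2_add_scale:
  assumes "a \<in> l2" "b \<in> l2"
  shows "(\<lambda>n. a n + c * b n) \<in> l2"
proof -
  have "(\<lambda>n. (a n + c * b n)\<^sup>2) summable_on UNIV"
  proof (rule summable_on_comparison_test)
    show "(\<lambda>n. 2 * (a n)\<^sup>2 + 2 * c\<^sup>2 * (b n)\<^sup>2) summable_on UNIV"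
      using assms unfolding l2_def by (auto intro!: summable_on_add summable_on_cmult_right)
    show "(a n + c * b n)\<^sup>2 \<le> 2 * (a n)\<^sup>2 + 2 * c\<^sup>2 * (b n)\<^sup>2" for n
      using sum_squares_bound[of "a n" "c * b n"] by (simp add: power2_sum power_mult_distrib)
  qed simp
  then show ?thesis by (simp add: l2_def)
qed

lemma l2_dominated:
  assumes "b \<in> l2" "\<And>n. \<bar>a n\<bar> \<le> c * \<bar>b n\<bar>" "0 \<le> c"
  shows "a \<in> l2" "l2_norm a \<le> c * l2_norm b"
proof -
  have "(\<Sum>n\<in>F. (a n)\<^sup>2) \<le> (c * l2_norm b)\<^sup>2" if "finite F" for F
  proof -
    have "(a n)\<^sup>2 \<le> c\<^sup>2 * (b n)\<^sup>2" for n
      using power_mono[OF assms(2)[of n] abs_ge_zero, of 2] by (simp add: power_mult_distrib)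
    then have "(\<Sum>n\<in>F. (a n)\<^sup>2) \<le> c\<^sup>2 * (\<Sum>n\<in>F. (b n)\<^sup>2)"
      by (simp add: sum_distrib_left sum_mono)
    also have "\<dots> \<le> c\<^sup>2 * (l2_norm b)\<^sup>2"
      using sum_le_l2_norm[OF assms(1) that] by (simp add: mult_left_mono)
    finally show ?thesis by (simp add: power_mult_distrib)
  qed
  from l2_bound[OF this] show "a \<in> l2" "l2_norm a \<le> c * l2_norm b"
    using assms l2_norm_nonneg by auto
qed

lemma l2_shift:
  assumes "a \<in> l2"
  shows "(\<lambda>n. a (n + k)) \<in> l2" "l2_norm (\<lambda>n. a (n + k)) \<le> l2_norm a"
proof -
  have "(\<Sum>n\<in>F. (a (n + k))\<^sup>2) \<le> (l2_norm a)\<^sup>2" if "finite F" for F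
  proof -
    have "(\<Sum>n\<in>F. (a (n + k))\<^sup>2) = (\<Sum>n\<in>(\<lambda>n. n + k) ` F. (a n)\<^sup>2)"
      by (subst sum.reindex) (auto simp: inj_on_def)
    also have "\<dots> \<le> (l2_norm a)\<^sup>2"
      using sum_le_l2_norm[OF assms, of "(\<lambda>n. n + k) ` F"] that by simp
    finally show ?thesis .
  qed
  from l2_bound[OF this l2_norm_nonneg]
  show "(\<lambda>n. a (n + k)) \<in> l2" "l2_norm (\<lambda>n. a (n + k)) \<le> l2_norm a" by auto
qed

text \<open>
  Making \<open>l\<^sup>2\<close> a type gives access to vector-valued derivatives, inner products and the contraction
  principle. An instance of \<open>real_inner\<close> needs no separate proof of the triangle inequality.
\<close>

typedef ell2 = l2
  morphisms seq Ell2
  by (rule exI[of _ "\<lambda>_. 0"]) (simp add: l2_def)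

lemma seq_l2: "seq x \<in> l2" by (rule seq)

lemma prod_summable_on:
  assumes "a \<in> l2" "b \<in> l2"
  shows "(\<lambda>n. a n * b n) summable_on UNIV"
proof (rule abs_summable_summable, rule Infinite_Sum.abs_summable_on_comparison_test')
  show "(\<lambda>n. (a n)\<^sup>2 + (b n)\<^sup>2) summable_on UNIV"
    using assms unfolding l2_def by (auto intro!: summable_on_add)
  show "norm (a n * b n) \<le> (a n)\<^sup>2 + (b n)\<^sup>2" for n
  proof -
    have "2 * (\<bar>a n\<bar> * \<bar>b n\<bar>) \<le> (a n)\<^sup>2 + (b n)\<^sup>2"
      using sum_squares_bound[of "\<bar>a n\<bar>" "\<bar>b n\<bar>"] by (simp add: mult.assoc)
    moreover have "0 \<le> \<bar>a n\<bar> * \<bar>b n\<bar>" by simp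
    ultimately show ?thesis unfolding real_norm_def abs_mult by linarith
  qed
qed

instantiation ell2 :: real_inner
begin

definition "0 = Ell2 (\<lambda>_. 0)"
definition "x + y = Ell2 (\<lambda>n. seq x n + seq y n)"
definition "x - y = Ell2 (\<lambda>n. seq x n - seq y n)"
definition "- x = Ell2 (\<lambda>n. - seq x n)"
definition "c *\<^sub>R x = Ell2 (\<lambda>n. c * seq x n)"
definition "inner x y = (\<Sum>\<^sub>\<infinity>n. seq x n * seq y n)"
definition "norm (x::ell2) = sqrt (inner x x)"
definition "dist (x::ell2) y = norm (x - y)"
definition "sgn (x::ell2) = inverse (norm x) *\<^sub>R x"
definition "(uniformity :: (ell2 \<times> ell2) filter) = (INF e\<in>{0<..}. principal {(x, y). dist x y < e})"
definition "open (U :: ell2 set) = (\<forall>x\<in>U. \<forall>\<^sub>F (x', y) in uniformity. x' = x \<longrightarrow> y \<in> U)"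

lemma seq_zero: "seq 0 = (\<lambda>_. 0)"
  unfolding zero_ell2_def by (subst Ell2_inverse) (simp_all add: l2_def)

lemma seq_add: "seq (x + y) = (\<lambda>n. seq x n + seq y n)"
  unfolding plus_ell2_def using l2_add_scale[OF seq_l2 seq_l2, of x 1 y]
  by (subst Ell2_inverse) simp_all

lemma seq_diff: "seq (x - y) = (\<lambda>n. seq x n - seq y n)"
  unfolding minus_ell2_def using l2_add_scale[OF seq_l2 seq_l2, of x "-1" y]
  by (subst Ell2_inverse) simp_all

lemma seq_scale: "seq (c *\<^sub>R x) = (\<lambda>n. c * seq x n)"
  unfolding scaleR_ell2_def using l2_dominated(1)[OF seq_l2, of "\<lambda>n. c * seq x n" "\<bar>c\<bar>" x]
  by (subst Ell2_inverse) (simp_all add: abs_mult)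

lemma seq_minus: "seq (- x) = (\<lambda>n. - seq x n)"
  unfolding uminus_ell2_def using l2_dominated(1)[OF seq_l2, of "\<lambda>n. - seq x n" 1 x]
  by (subst Ell2_inverse) simp_all

lemmas seq_simps = seq_zero seq_add seq_diff seq_scale seq_minus

instance
proof
  fix x y z :: ell2 and c d :: real
  have eqI: "u = v" if "seq u = seq v" for u v using that by (simp add: seq_inject)
  show "x + y + z = x + (y + z)" "x + y = y + x" "0 + x = x" "- x + x = 0" "x - y = x + - y"
    "c *\<^sub>R (x + y) = c *\<^sub>R x + c *\<^sub>R y" "(c + d) *\<^sub>R x = c *\<^sub>R x + d *\<^sub>R x"
    "c *\<^sub>R d *\<^sub>R x = (c * d) *\<^sub>R x" "1 *\<^sub>R x = x"
    by (rule eqI, simp add: seq_simps algebra_simps)+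
  show "inner x y = inner y x" by (simp add: inner_ell2_def mult.commute)
  show "inner (x + y) z = inner x z + inner y z"
    unfolding inner_ell2_def seq_simps distrib_right
    by (intro infsum_add prod_summable_on seq_l2)
  show "inner (c *\<^sub>R x) y = c * inner x y"
    unfolding inner_ell2_def seq_simps mult.assoc
    by (intro infsum_cmult_right prod_summable_on seq_l2)
  show "0 \<le> inner x x" unfolding inner_ell2_def by (intro infsum_nonneg) simp
  show "(inner x x = 0) = (x = 0)"
  proof
    assume *: "inner x x = 0"
    have "seq x n = 0" for n
      using * abs_le_l2_norm[OF seq_l2, of x n]
      by (simp add: inner_ell2_def l2_norm_def power2_eq_square)
    then show "x = 0" by (intro eqI) (simp add: seq_zero fun_eq_iff)
  qed (simp add: inner_ell2_def seq_zero)
qed (simp_all add: norm_ell2_def dist_ell2_def sgn_ell2_def uniformity_ell2_def open_ell2_def)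

end

lemma norm_ell2: "norm x = l2_norm (seq x)"
  by (simp add: norm_ell2_def inner_ell2_def l2_norm_def power2_eq_square)

lemma seq_le_norm: "\<bar>seq x n\<bar> \<le> norm x"
  unfolding norm_ell2 by (rule abs_le_l2_norm[OF seq_l2])

lemma bounded_linear_seq: "bounded_linear (\<lambda>x. seq x n)"
  by (rule bounded_linear_intro[where K = 1]) (auto simp: seq_simps seq_le_norm)

text \<open>
  A Cauchy sequence converges in each component; the bound on finite partial sums of the differences passes to the
  componentwise limit.
\<close>

instance ell2 :: complete_space
proof
  fix X :: "nat \<Rightarrow> ell2"
  assume X: "Cauchy X"
  have "Cauchy (\<lambda>k. seq (X k) n)" for n
    using bounded_linear.Cauchy[OF bounded_linear_seq X] .
  then have "\<exists>L. (\<lambda>k. seq (X k) n) \<longlonglongrightarrow> L" for n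
    by (simp add: Cauchy_convergent_iff convergent_def)
  then obtain L where L: "\<And>n. (\<lambda>k. seq (X k) n) \<longlonglongrightarrow> L n" by metis
  have close: "\<exists>N. \<forall>k\<ge>N. (\<lambda>n. seq (X k) n - L n) \<in> l2 \<and> l2_norm (\<lambda>n. seq (X k) n - L n) \<le> e"
    if "e > 0" for e
  proof -
    obtain N where N: "\<And>j k. j \<ge> N \<Longrightarrow> k \<ge> N \<Longrightarrow> dist (X k) (X j) < e"
      using X \<open>e > 0\<close> unfolding Cauchy_def by metis
    have "(\<Sum>n\<in>F. (seq (X k) n - L n)\<^sup>2) \<le> e\<^sup>2" if "finite F" "k \<ge> N" for F k
    proof (rule LIMSEQ_le_const2)
      show "(\<lambda>j. \<Sum>n\<in>F. (seq (X k) n - seq (X j) n)\<^sup>2) \<longlonglongrightarrow> (\<Sum>n\<in>F. (seq (X k) n - L n)\<^sup>2)"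
        by (intro tendsto_intros L)
      have "(\<Sum>n\<in>F. (seq (X k) n - seq (X j) n)\<^sup>2) \<le> e\<^sup>2" if "j \<ge> N" for j
      proof -
        have "(\<Sum>n\<in>F. (seq (X k) n - seq (X j) n)\<^sup>2) \<le> (norm (X k - X j))\<^sup>2"
          using sum_le_l2_norm[OF seq_l2 \<open>finite F\<close>, of "X k - X j"] by (simp add: norm_ell2 seq_diff)
        also have "\<dots> \<le> e\<^sup>2"
          using N[OF \<open>j \<ge> N\<close> \<open>k \<ge> N\<close>] by (intro power_mono) (auto simp: dist_norm)
        finally show ?thesis .
      qed
      then show "\<exists>M. \<forall>j\<ge>M. (\<Sum>n\<in>F. (seq (X k) n - seq (X j) n)\<^sup>2) \<le> e\<^sup>2" by blast
    qed
    then show ?thesis using l2_bound[of _ e] \<open>e > 0\<close> by (metis less_imp_le)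
  qed
  from close[of 1] obtain N where "(\<lambda>n. seq (X N) n - L n) \<in> l2" by auto
  from l2_add_scale[OF seq_l2[of "X N"] this, of "-1"] have "L \<in> l2" by simp
  then have seqL: "seq (Ell2 L) = L" by (rule Ell2_inverse)
  have "X \<longlonglongrightarrow> Ell2 L"
  proof (rule metric_LIMSEQ_I)
    fix r :: real assume "0 < r"
    then obtain N where "\<forall>k\<ge>N. l2_norm (\<lambda>n. seq (X k) n - L n) \<le> r / 2"
      using close[of "r / 2"] by auto
    then have "\<forall>k\<ge>N. dist (X k) (Ell2 L) \<le> r / 2"
      by (simp add: dist_norm norm_ell2 seq_diff seqL)
    then have "\<forall>k\<ge>N. dist (X k) (Ell2 L) < r" using \<open>0 < r\<close> by fastforce
    then show "\<exists>N. \<forall>k\<ge>N. dist (X k) (Ell2 L) < r" ..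
  qed
  then show "convergent X" by (auto simp: convergent_def)
qed

instance ell2 :: banach ..

section \<open>Lipschitz differential equations in Banach spaces\<close>

text \<open>
  The signed integral from \<open>0\<close>, written with two unsigned integrals one of which is over an empty or
  degenerate interval. It serves as the integral operator of Picard iteration and also provides scalar antiderivatives.
\<close>

lemma antiderivative_banach:
  fixes f :: "real \<Rightarrow> 'a::banach"
  assumes "continuous_on UNIV f"
  shows "\<exists>G. G 0 = 0 \<and> (\<forall>t. (G has_vector_derivative f t) (at t))"
proof -
  have int: "f integrable_on {a..b}" for a b
    by (rule integrable_continuous_real) (rule continuous_on_subset[OF assms], simp)
  define G where "G t = integral {0..t} f - integral {t..0} f" for t
  have G_eq: "G t = integral {-b..t} f - integral {-b..0} f" if "t \<in> {-b..b}" for t b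
  proof (cases "t \<ge> 0")
    case True
    then show ?thesis
      using Henstock_Kurzweil_Integration.integral_combine[of "-b" 0 t f] that int
      by (cases "t = 0") (auto simp: G_def algebra_simps)
  next
    case False
    then show ?thesis
      using Henstock_Kurzweil_Integration.integral_combine[of "-b" t 0 f] that int
      by (auto simp: G_def algebra_simps)
  qed
  have "(G has_vector_derivative f t) (at t)" for t
  proof -
    define b where "b = \<bar>t\<bar> + 1"
    have tb: "t \<in> {-b<..<b}" by (auto simp: b_def)
    have "((\<lambda>u. integral {-b..u} f) has_vector_derivative f t) (at t within {-b..b})"
      using tb by (intro integral_has_vector_derivative continuous_on_subset[OF assms]) auto
    then have "((\<lambda>u. integral {-b..u} f - integral {-b..0} f) has_vector_derivative f t) (at t within {-b..b})"
      using has_vector_derivative_diff[OF _ has_vector_derivative_const] by fastforce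
    then have "(G has_vector_derivative f t) (at t within {-b..b})"
      by (rule has_vector_derivative_transform[where f = "\<lambda>u. integral {-b..u} f - integral {-b..0} f", rotated 2])
        (use tb G_eq[of _ b] in auto)
    then show ?thesis
      using tb at_within_interior[of t "{-b..b}"] by simp
  qed
  moreover have "G 0 = 0" by (simp add: G_def)
  ultimately show ?thesis by blast
qed

text \<open>
  Integrates an exponential bound on the derivative; the weight \<open>exp (K * \<bar>t\<bar>)\<close> is gained back
  with the factor \<open>1 / K\<close>, which is what makes Picard iteration contract.
\<close>

lemma norm_le_exp_growth_forward:
  fixes G :: "real \<Rightarrow> 'a::real_normed_vector"
  assumes G0: "G 0 = 0" and G': "\<And>t. (G has_vector_derivative dG t) (at t)"
    and dG: "\<And>t. norm (dG t) \<le> C * exp (K * \<bar>t\<bar>)" and "K > 0" "C \<ge> 0" "t > 0"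
  shows "norm (G t) \<le> C / K * exp (K * t)"
proof -
  have "norm (G t - G 0) \<le> C / K * exp (K * t) - C / K * exp (K * 0)"
  proof (rule differentiable_bound_general[where f' = dG and \<phi>' = "\<lambda>s. C * exp (K * s)"])
    show "0 < t" by fact
    show "continuous_on {0..t} G"
      by (intro continuous_at_imp_continuous_on ballI has_vector_derivative_continuous[OF G'])
    show "continuous_on {0..t} (\<lambda>s. C / K * exp (K * s))" by (intro continuous_intros)
    show "((\<lambda>s. C / K * exp (K * s)) has_vector_derivative C * exp (K * x)) (at x)" for x
      unfolding has_real_derivative_iff_has_vector_derivative[symmetric]
      using \<open>K > 0\<close> by (auto intro!: derivative_eq_intros)
    show "norm (dG x) \<le> C * exp (K * x)" if "0 < x" for x
      using dG[of x] that by simp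
    show "(G has_vector_derivative dG x) (at x)" for x by (rule G')
  qed
  moreover have "0 \<le> C / K" using \<open>K > 0\<close> \<open>C \<ge> 0\<close> by simp
  ultimately show ?thesis using G0 by simp
qed

lemma norm_le_exp_growth:
  fixes G :: "real \<Rightarrow> 'a::real_normed_vector"
  assumes G0: "G 0 = 0" and G': "\<And>t. (G has_vector_derivative dG t) (at t)"
    and dG: "\<And>t. norm (dG t) \<le> C * exp (K * \<bar>t\<bar>)" and K: "K > 0" and C: "C \<ge> 0"
  shows "norm (G t) \<le> C / K * exp (K * \<bar>t\<bar>)"
proof -
  consider "t > 0" | "t = 0" | "t < 0" by linarith
  then show ?thesis
  proof cases
    case 1
    from norm_le_exp_growth_forward[OF G0 G' dG K C 1] 1 show ?thesis by simp
  next
    case 2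
    then show ?thesis using G0 K C by simp
  next
    case 3
    have "((\<lambda>s. G (- s)) has_vector_derivative - dG (- s)) (at s)" for s
    proof -
      have "(uminus has_vector_derivative (-1 :: real)) (at s)"
        unfolding has_real_derivative_iff_has_vector_derivative[symmetric]
        by (auto intro!: derivative_eq_intros)
      from vector_diff_chain_at[OF this G'] show ?thesis by (simp add: o_def)
    qed
    moreover have "norm (- dG (- s)) \<le> C * exp (K * \<bar>s\<bar>)" for s
      using dG[of "- s"] by simp
    ultimately have "norm (G (- (- t))) \<le> C / K * exp (K * - t)"
      by (rule norm_le_exp_growth_forward[rotated 1, OF _ _ K C]) (use 3 G0 in auto)
    then show ?thesis by (simp only: abs_of_neg[OF 3] minus_minus)
  qed
qed

text \<open>
  Picard iteration contracts on the whole real line at once if the unknown is rescaled by \<open>exp (- K *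
  \<bar>t\<bar>)\<close> with \<open>K = 2 * L\<close> (Bielecki's norm). The rescaled unknown is a bounded continuous
  function, so no local solutions have to be glued together.
\<close>

theorem global_lipschitz_ode:
  fixes F :: "'a::banach \<Rightarrow> 'a"
  assumes lip: "\<And>x y. norm (F x - F y) \<le> L * norm (x - y)" and "L > 0"
  shows "\<exists>u. u 0 = u0 \<and> (\<forall>t. (u has_vector_derivative F (u t)) (at t))"
proof -
  define K where "K = 2 * L"
  have K: "K > 0" using \<open>L > 0\<close> by (simp add: K_def)
  have contF: "continuous_on UNIV F"
    by (rule lipschitz_on_continuous_on[of L], rule lipschitz_onI)
      (use lip \<open>L > 0\<close> in \<open>auto simp: dist_norm\<close>)
  define f where "f v t = F (exp (K * \<bar>t\<bar>) *\<^sub>R apply_bcontfun v t)" for v :: "real \<Rightarrow>\<^sub>C 'a" and t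
  have "continuous_on UNIV (f v)" for v
    unfolding f_def by (intro continuous_on_compose2[OF contF] continuous_intros) auto
  then have "\<exists>G. \<forall>v. G v 0 = 0 \<and> (\<forall>t. (G v has_vector_derivative f v t) (at t))"
    by (intro choice allI antiderivative_banach)
  then obtain G where G0: "\<And>v. G v 0 = 0"
    and G': "\<And>v t. (G v has_vector_derivative f v t) (at t)" by blast
  have contG: "continuous_on UNIV (G v)" for v
    by (intro continuous_at_imp_continuous_on ballI has_vector_derivative_continuous[OF G'])
  \<comment> \<open>Picard's map, conjugated with the exponential weight.\<close>
  define T where "T v t = exp (- (K * \<bar>t\<bar>)) *\<^sub>R (u0 + G v t)" for v t
  have one: "1 \<le> exp (K * \<bar>t\<bar>)" for t using K by simp
  have f_growth: "norm (f v t) \<le> (norm (F 0) + L * norm v) * exp (K * \<bar>t\<bar>)" for v t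
  proof -
    have "norm (f v t) \<le> norm (F 0) + norm (f v t - F 0)"
      using norm_triangle_ineq[of "F 0" "f v t - F 0"] by simp
    also have "norm (f v t - F 0) \<le> L * norm (exp (K * \<bar>t\<bar>) *\<^sub>R apply_bcontfun v t)"
      using lip[of "exp (K * \<bar>t\<bar>) *\<^sub>R apply_bcontfun v t" 0] unfolding f_def by simp
    also have "\<dots> \<le> L * (exp (K * \<bar>t\<bar>) * norm v)"
      using \<open>L > 0\<close> norm_bounded[of v t] by (simp add: mult_left_mono)
    also have "norm (F 0) \<le> norm (F 0) * exp (K * \<bar>t\<bar>)"
      using one[of t] by (simp add: mult_le_cancel_left1)
    finally show ?thesis by (simp add: algebra_simps)
  qed
  have T_in: "T v \<in> bcontfun" for v
  proof (rule bcontfun_normI)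
    show "continuous_on UNIV (T v)"
      unfolding T_def by (intro continuous_intros contG)
    fix t
    have "norm (G v t) \<le> (norm (F 0) + L * norm v) / K * exp (K * \<bar>t\<bar>)"
      using \<open>L > 0\<close> by (intro norm_le_exp_growth[OF G0 G' f_growth K]) auto
    then have "exp (- (K * \<bar>t\<bar>)) * norm (G v t) \<le> (norm (F 0) + L * norm v) / K"
      by (simp add: exp_minus field_simps)
    moreover have "exp (- (K * \<bar>t\<bar>)) * norm u0 \<le> norm u0"
      using K by (simp add: mult_left_le_one_le)
    moreover have "norm (T v t) \<le> exp (- (K * \<bar>t\<bar>)) * (norm u0 + norm (G v t))"
      unfolding T_def by (simp add: norm_triangle_ineq mult_left_mono)
    ultimately show "norm (T v t) \<le> norm u0 + (norm (F 0) + L * norm v) / K"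
      by (simp add: distrib_left)
  qed
  have contraction: "dist (Bcontfun (T v)) (Bcontfun (T w)) \<le> 1 / 2 * dist v w" for v w
  proof (rule dist_bound)
    fix t
    have "norm (G v t - G w t) \<le> (L * dist v w) / K * exp (K * \<bar>t\<bar>)"
    proof (rule norm_le_exp_growth[where dG = "\<lambda>t. f v t - f w t"])
      show "((\<lambda>t. G v t - G w t) has_vector_derivative f v t - f w t) (at t)" for t
        by (intro has_vector_derivative_diff G')
      show "norm (f v t - f w t) \<le> L * dist v w * exp (K * \<bar>t\<bar>)" for t
      proof -
        have "norm (f v t - f w t) \<le> L * norm (exp (K * \<bar>t\<bar>) *\<^sub>R (apply_bcontfun v t - apply_bcontfun w t))"
          unfolding f_def scaleR_diff_right by (rule lip)
        also have "\<dots> \<le> L * (exp (K * \<bar>t\<bar>) * dist v w)"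
          using \<open>L > 0\<close> dist_bounded[of v t w] by (simp add: mult_left_mono dist_norm)
        finally show ?thesis by (simp add: mult_ac)
      qed
    qed (use G0 K \<open>L > 0\<close> in auto)
    then have "exp (- (K * \<bar>t\<bar>)) * norm (G v t - G w t) \<le> 1 / 2 * dist v w"
      using \<open>L > 0\<close> by (simp add: exp_minus field_simps K_def)
    then show "dist (apply_bcontfun (Bcontfun (T v)) t) (apply_bcontfun (Bcontfun (T w)) t) \<le> 1 / 2 * dist v w"
      by (simp add: Bcontfun_inverse[OF T_in] dist_norm)
        (simp add: T_def scaleR_diff_right[symmetric])
  qed
  obtain v where v: "Bcontfun (T v) = v"
    using banach_fix_type[of "1/2" "\<lambda>v. Bcontfun (T v)"] contraction by auto
  then have "apply_bcontfun v = T v" by (metis Bcontfun_inverse T_in)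
  then have fv: "f v t = F (u0 + G v t)" for t
    by (simp add: f_def T_def exp_minus)
  have "((\<lambda>t. u0 + G v t) has_vector_derivative F (u0 + G v t)) (at t)" for t
    using has_vector_derivative_add[OF has_vector_derivative_const G'[of v t]] by (simp add: fv)
  then show ?thesis using G0[of v] by (intro exI[of _ "\<lambda>t. u0 + G v t"]) auto
qed

text \<open>
  The hypothesis bounds the absolute value of the derivative, so that the same statement serves forwards and backwards
  in time.
\<close>

lemma gronwall:
  fixes y :: "real \<Rightarrow> real"
  assumes y': "\<And>t. t \<in> {a..b} \<Longrightarrow> (y has_real_derivative y' t) (at t within {a..b})"
    and bound: "\<And>t. t \<in> {a..b} \<Longrightarrow> \<bar>y' t\<bar> \<le> K * (y t + A)"
    and "a \<le> 0" "0 \<le> b" "t \<in> {a..b}"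
  shows "y t + A \<le> (y 0 + A) * exp (K * \<bar>t\<bar>)"
proof -
  have fwd: "y t + A \<le> (y 0 + A) * exp (K * t)"
    if y': "\<And>s. s \<in> {0..t} \<Longrightarrow> (y has_real_derivative y' s) (at s within {0..t})"
      and bound: "\<And>s. s \<in> {0..t} \<Longrightarrow> y' s \<le> K * (y s + A)" and "0 < t" for t and y y' :: "real \<Rightarrow> real"
  proof -
    \<comment> \<open>The quotient by the expected bound is nonincreasing.\<close>
    define z where "z s = (y s + A) * exp (- (K * s))" for s
    have z': "(z has_real_derivative (y' s - K * (y s + A)) * exp (- (K * s))) (at s within {0..t})"
      if "s \<in> {0..t}" for s
      unfolding z_def
      by (rule derivative_eq_intros refl y'[OF that])+ (simp add: algebra_simps)
    have "\<exists>s\<in>{0..t}. z t - z 0 = (\<lambda>h. ((y' s - K * (y s + A)) * exp (- (K * s))) * h) (t - 0)"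
      using \<open>0 < t\<close> z' by (intro mvt_very_simple) (auto simp: has_field_derivative_def)
    then obtain s where s: "s \<in> {0..t}" "z t - z 0 = ((y' s - K * (y s + A)) * exp (- (K * s))) * t" by auto
    have "z t - z 0 \<le> 0"
      unfolding s(2) using bound[OF s(1)] \<open>0 < t\<close>
      by (intro mult_nonpos_nonneg) auto
    then have "z t * exp (K * t) \<le> z 0 * exp (K * t)"
      by (intro mult_right_mono) auto
    moreover have "exp (- (K * t)) * exp (K * t) = 1" by (simp add: exp_minus)
    then have "z t * exp (K * t) = y t + A" by (simp only: z_def mult.assoc mult_1_right)
    moreover have "z 0 = y 0 + A" by (simp add: z_def)
    ultimately show ?thesis by (simp only:)
  qed
  consider "t > 0" | "t = 0" | "t < 0" by linarith
  then show ?thesis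
  proof cases
    case 1
    have d: "(y has_real_derivative y' s) (at s within {0..t})" if "s \<in> {0..t}" for s
      by (rule DERIV_subset[OF y'[of s]]) (use that assms(3-5) in auto)
    have b: "y' s \<le> K * (y s + A)" if "s \<in> {0..t}" for s
    proof -
      have "s \<in> {a..b}" using that assms(3-5) by auto
      from bound[OF this] show ?thesis by linarith
    qed
    show ?thesis using fwd[OF d b 1] 1 by simp
  next
    case 2
    then show ?thesis by simp
  next
    case 3
    have d: "((\<lambda>s. y (- s)) has_real_derivative - y' (- s)) (at s within {0..-t})" if "s \<in> {0..-t}" for s
    proof -
      have "(y has_real_derivative y' (- s)) (at (- s) within uminus ` {0..-t})"
        by (rule DERIV_subset[OF y'[of "- s"]]) (use that assms(3-5) in auto)
      from DERIV_image_chain[OF this DERIV_minus[OF DERIV_ident]]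
      show ?thesis by (simp add: o_def)
    qed
    have b: "- y' (- s) \<le> K * (y (- s) + A)" if "s \<in> {0..-t}" for s
    proof -
      have "- s \<in> {a..b}" using that assms(3-5) by auto
      from bound[OF this] show ?thesis by linarith
    qed
    show ?thesis using fwd[OF d b] 3 by simp
  qed
qed

section \<open>Well-posedness of the lattice equations\<close>

lemma seq_Ell2: "a \<in> l2 \<Longrightarrow> seq (Ell2 a) = a"
  by (rule Ell2_inverse)

definition shift :: "int \<Rightarrow> ell2 \<Rightarrow> ell2" where
  "shift k x = Ell2 (\<lambda>n. seq x (n + k))"

lemma seq_shift: "seq (shift k x) = (\<lambda>n. seq x (n + k))"
  unfolding shift_def by (rule seq_Ell2) (rule l2_shift(1)[OF seq_l2])

lemma norm_shift_diff: "norm (shift k x - shift k y) \<le> norm (x - y)"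
  using l2_shift(2)[OF seq_l2, of "x - y" k] by (simp add: norm_ell2 seq_simps seq_shift)

text \<open>
  The right-hand side of the lattice equations on the phase space, for a general force \<open>\<phi>\<close>.
\<close>

definition lattice_field :: "(real \<Rightarrow> real) \<Rightarrow> ell2 \<times> ell2 \<Rightarrow> ell2 \<times> ell2" where
  "lattice_field \<phi> z =
     (shift 1 (snd z) - snd z,
      Ell2 (\<lambda>n. \<phi> (seq (fst z) n)) - shift (-1) (Ell2 (\<lambda>n. \<phi> (seq (fst z) n))))"

text \<open>
  Difference operators on \<open>l\<^sup>2\<close> have norm at most two. Here \<open>c\<close> stands for the
  difference of the forces of two states, which serves both the Lipschitz bound for the field and the uniqueness proof.
\<close>

lemma norm_lattice_difference_le:
  assumes lip: "\<And>n. \<bar>seq c n\<bar> \<le> L * \<bar>seq a n\<bar>" and "0 \<le> L"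
  shows "norm (shift 1 b - b, c - shift (-1) c) \<le> (2 + 2 * L) * norm (a, b)"
proof -
  have "norm c \<le> L * norm a"
    unfolding norm_ell2 by (intro l2_dominated(2) seq_l2 assms)
  moreover have "norm (shift 1 b - b) \<le> 2 * norm b" "norm (c - shift (-1) c) \<le> 2 * norm c"
    using norm_shift_diff[of 1 b 0] norm_shift_diff[of "-1" c 0]
      norm_triangle_ineq4[of "shift 1 b" b] norm_triangle_ineq4[of c "shift (-1) c"]
    by (simp_all add: shift_def seq_zero zero_ell2_def[symmetric])
  moreover have "norm a \<le> norm (a, b)" "norm b \<le> norm (a, b)"
    using norm_fst_le[of a b] norm_snd_le[of b a] by auto
  moreover have "L * norm a \<le> L * norm (a, b)"
    using \<open>0 \<le> L\<close> norm_fst_le[of a b] by (intro mult_left_mono) auto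
  moreover have "norm (shift 1 b - b, c - shift (-1) c) \<le> norm (shift 1 b - b) + norm (c - shift (-1) c)"
    by (rule norm_Pair_le)
  ultimately show ?thesis unfolding distrib_right by linarith
qed

lemma comp_l2:
  assumes "\<And>x y. \<bar>\<phi> x - \<phi> y\<bar> \<le> L * \<bar>x - y\<bar>" "\<phi> 0 = 0" "0 \<le> L"
  shows "(\<lambda>n. \<phi> (seq x n)) \<in> l2"
  using l2_dominated(1)[OF seq_l2[of x], where a = "\<lambda>n. \<phi> (seq x n)" and c = L] assms(1)[of _ 0] assms(2,3) by simp

lemma lattice_field_lipschitz:
  assumes lip: "\<And>x y. \<bar>\<phi> x - \<phi> y\<bar> \<le> L * \<bar>x - y\<bar>" and "\<phi> 0 = 0" and "0 \<le> L"
  shows "norm (lattice_field \<phi> y - lattice_field \<phi> z) \<le> (2 + 2 * L) * norm (y - z)"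
proof -
  define c where "c = Ell2 (\<lambda>n. \<phi> (seq (fst y) n)) - Ell2 (\<lambda>n. \<phi> (seq (fst z) n))"
  have "seq c n = \<phi> (seq (fst y) n) - \<phi> (seq (fst z) n)" for n
    unfolding c_def seq_diff using comp_l2[OF assms] by (simp add: seq_Ell2)
  then have "\<bar>seq c n\<bar> \<le> L * \<bar>seq (fst y - fst z) n\<bar>" for n
    using lip by (simp add: seq_diff)
  moreover have "shift k (u - v) = shift k u - shift k v" for k u v
    by (subst seq_inject[symmetric]) (simp add: seq_shift seq_diff)
  then have "lattice_field \<phi> y - lattice_field \<phi> z =
      (shift 1 (snd y - snd z) - (snd y - snd z), c - shift (-1) c)"
    by (simp add: lattice_field_def c_def minus_prod_def algebra_simps)
  moreover have "y - z = (fst y - fst z, snd y - snd z)" by (rule minus_prod_def)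
  ultimately show ?thesis
    using norm_lattice_difference_le[of c L "fst y - fst z" "snd y - snd z"] \<open>0 \<le> L\<close> by simp
qed

text \<open>
  Translates differentiability in the Hilbert space into the difference quotients by which \<open>C1_into_l2\<close> is
  defined.
\<close>

lemma C1_into_l2I:
  assumes d: "\<And>t. (u has_vector_derivative u' t) (at t)" and c: "continuous_on UNIV u'"
  shows "C1_into_l2 I (\<lambda>t. seq (u t))"
proof -
  have "((\<lambda>r. l2_norm (\<lambda>n. (seq (u r) n - seq (u t) n) / (r - t) - seq (u' t) n)) \<longlongrightarrow> 0) (at t within I)" for t
  proof -
    have lim: "((\<lambda>r. norm (u r - u t - (r - t) *\<^sub>R u' t) / norm (r - t)) \<longlongrightarrow> 0) (at t)"
      using d[of t] unfolding has_vector_derivative_def has_derivative_iff_norm by simp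
    have eq: "norm (u r - u t - (r - t) *\<^sub>R u' t) / norm (r - t)
        = l2_norm (\<lambda>n. (seq (u r) n - seq (u t) n) / (r - t) - seq (u' t) n)" if "r \<noteq> t" for r
    proof -
      have "norm (u r - u t - (r - t) *\<^sub>R u' t) / norm (r - t)
          = norm (inverse (r - t) *\<^sub>R (u r - u t - (r - t) *\<^sub>R u' t))"
        by (simp add: divide_inverse mult.commute)
      also have "inverse (r - t) *\<^sub>R (u r - u t - (r - t) *\<^sub>R u' t) = inverse (r - t) *\<^sub>R (u r - u t) - u' t"
        using that by (simp add: scaleR_diff_right)
      finally show ?thesis
        by (simp add: norm_ell2 seq_simps divide_inverse mult.commute)
    qed
    have "((\<lambda>r. l2_norm (\<lambda>n. (seq (u r) n - seq (u t) n) / (r - t) - seq (u' t) n)) \<longlongrightarrow> 0) (at t)"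
      by (rule Lim_transform_eventually[OF lim]) (use eq in \<open>auto simp: eventually_at_filter simp del: real_norm_def\<close>)
    then show ?thesis by (rule tendsto_within_subset) simp
  qed
  moreover have "((\<lambda>r. l2_norm (\<lambda>n. seq (u' r) n - seq (u' t) n)) \<longlongrightarrow> 0) (at t within I)" for t
  proof -
    have "(u' \<longlongrightarrow> u' t) (at t)" using c by (simp add: continuous_on_def)
    then have "((\<lambda>r. norm (u' r - u' t)) \<longlongrightarrow> 0) (at t)"
      by (rule tendsto_norm_zero[OF LIM_zero])
    then have "((\<lambda>r. norm (u' r - u' t)) \<longlongrightarrow> 0) (at t within I)"
      by (rule tendsto_within_subset) simp
    then show ?thesis by (simp add: norm_ell2 seq_diff)
  qed
  ultimately show ?thesis
    unfolding C1_into_l2_def by (intro conjI ballI exI[of _ "\<lambda>t. seq (u' t)"]) (auto simp: seq_l2)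
qed

lemma C1_into_l2D:
  assumes "C1_into_l2 I u"
  shows "\<exists>u'. \<forall>t\<in>I. ((\<lambda>t. Ell2 (u t)) has_vector_derivative u' t) (at t within I)"
proof -
  from assms obtain u' where u: "\<And>t. t \<in> I \<Longrightarrow> u t \<in> l2" and u': "\<And>t. t \<in> I \<Longrightarrow> u' t \<in> l2"
    and lim: "\<And>t. t \<in> I \<Longrightarrow> ((\<lambda>r. l2_norm (\<lambda>n. (u r n - u t n) / (r - t) - u' t n)) \<longlongrightarrow> 0) (at t within I)"
    unfolding C1_into_l2_def by blast
  have "((\<lambda>t. Ell2 (u t)) has_vector_derivative Ell2 (u' t)) (at t within I)" if "t \<in> I" for t
    unfolding has_vector_derivative_def has_derivative_iff_norm
  proof (intro conjI bounded_linear_scaleR_left, rule Lim_transform_eventually[OF lim[OF that]])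
    have "l2_norm (\<lambda>n. (u r n - u t n) / (r - t) - u' t n) =
        norm (Ell2 (u r) - Ell2 (u t) - (r - t) *\<^sub>R Ell2 (u' t)) / norm (r - t)" if "r \<noteq> t" "r \<in> I" for r
    proof -
      have "norm (Ell2 (u r) - Ell2 (u t) - (r - t) *\<^sub>R Ell2 (u' t)) / norm (r - t)
          = norm (inverse (r - t) *\<^sub>R (Ell2 (u r) - Ell2 (u t) - (r - t) *\<^sub>R Ell2 (u' t)))"
        by (simp add: divide_inverse mult.commute)
      also have "inverse (r - t) *\<^sub>R (Ell2 (u r) - Ell2 (u t) - (r - t) *\<^sub>R Ell2 (u' t))
          = inverse (r - t) *\<^sub>R (Ell2 (u r) - Ell2 (u t)) - Ell2 (u' t)"
        using that by (simp add: scaleR_diff_right)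
      finally show ?thesis
        using u u' that \<open>t \<in> I\<close> by (simp add: norm_ell2 seq_simps seq_Ell2 divide_inverse mult.commute)
    qed
    then show "\<forall>\<^sub>F r in at t within I. l2_norm (\<lambda>n. (u r n - u t n) / (r - t) - u' t n) =
        norm (Ell2 (u r) - Ell2 (u t) - (r - t) *\<^sub>R Ell2 (u' t)) / norm (r - t)"
      by (auto simp: eventually_at_filter)
  qed
  then show ?thesis by (intro exI[of _ "\<lambda>t. Ell2 (u' t)"] ballI)
qed

lemma C1_into_l2_bounded:
  assumes "C1_into_l2 {a..b} u"
  shows "\<exists>M. \<forall>t\<in>{a..b}. l2_norm (u t) \<le> M"
proof -
  obtain u' where u': "\<forall>t\<in>{a..b}. ((\<lambda>t. Ell2 (u t)) has_vector_derivative u' t) (at t within {a..b})"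
    using C1_into_l2D[OF assms] by blast
  have "continuous_on {a..b} (\<lambda>t. Ell2 (u t))"
    unfolding continuous_on_eq_continuous_within
    by (intro ballI has_vector_derivative_continuous[OF u'[rule_format]])
  then have "bounded ((\<lambda>t. Ell2 (u t)) ` {a..b})"
    by (intro compact_imp_bounded compact_continuous_image) auto
  then obtain M where "\<forall>t\<in>{a..b}. norm (Ell2 (u t)) \<le> M" by (auto simp: bounded_iff)
  then show ?thesis
    using assms by (intro exI[of _ M]) (simp add: norm_ell2 seq_Ell2 C1_into_l2_def)
qed

lemma C1_into_l2_subset:
  assumes "C1_into_l2 I u" "J \<subseteq> I"
  shows "C1_into_l2 J u"
proof -
  obtain u' where u: "\<forall>t\<in>I. u t \<in> l2" "\<forall>t\<in>I. u' t \<in> l2"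
    and d: "\<forall>t\<in>I. ((\<lambda>r. l2_norm (\<lambda>n. (u r n - u t n) / (r - t) - u' t n)) \<longlongrightarrow> 0) (at t within I)"
    and c: "\<forall>t\<in>I. ((\<lambda>r. l2_norm (\<lambda>n. u' r n - u' t n)) \<longlongrightarrow> 0) (at t within I)"
    using assms(1) unfolding C1_into_l2_def by blast
  show ?thesis
    unfolding C1_into_l2_def
    by (intro conjI exI[of _ u'] ballI tendsto_within_subset[OF d[rule_format] assms(2)]
        tendsto_within_subset[OF c[rule_format] assms(2)]) (use u assms(2) in auto)
qed

lemma solves_lattice_ivp_subset:
  assumes "solves_lattice_ivp \<epsilon> I w0 p0 w p" "J \<subseteq> I"
  shows "solves_lattice_ivp \<epsilon> J w0 p0 w p"
proof -
  have "w t n > -1 \<and>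
      ((\<lambda>r. w r n) has_real_derivative p t (n + 1) - p t n) (at t within J) \<and>
      ((\<lambda>r. p r n) has_real_derivative V' \<epsilon> (w t n) - V' \<epsilon> (w t (n - 1))) (at t within J)"
    if "t \<in> J" for t n
  proof -
    have "t \<in> I" using that assms(2) by auto
    then show ?thesis
      using assms(1) DERIV_subset[OF _ assms(2)] unfolding solves_lattice_ivp_def by simp
  qed
  then show ?thesis using assms(1) by (simp add: solves_lattice_ivp_def)
qed

text \<open>
  A force with a global Lipschitz bound that vanishes at \<open>0\<close> maps \<open>l\<^sup>2\<close> to itself, so
  the lattice is an ordinary differential equation with a Lipschitz right-hand side.
\<close>

theorem lattice_global_solution:
  assumes lip: "\<And>x y. \<bar>\<phi> x - \<phi> y\<bar> \<le> L * \<bar>x - y\<bar>" and "\<phi> 0 = 0" and "0 \<le> L"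
    and "w0 \<in> l2" "p0 \<in> l2"
  obtains w p where "w 0 = w0" "p 0 = p0" "\<And>I. C1_into_l2 I w" "\<And>I. C1_into_l2 I p"
    "\<And>t n. ((\<lambda>r. w r n) has_real_derivative p t (n + 1) - p t n) (at t)"
    "\<And>t n. ((\<lambda>r. p r n) has_real_derivative \<phi> (w t n) - \<phi> (w t (n - 1))) (at t)"
proof -
  note lipF = lattice_field_lipschitz[OF assms(1-3)]
  obtain u where u0: "u 0 = (Ell2 w0, Ell2 p0)"
    and u': "\<And>t. (u has_vector_derivative lattice_field \<phi> (u t)) (at t)"
    using global_lipschitz_ode[of "lattice_field \<phi>" "2 + 2 * L" "(Ell2 w0, Ell2 p0)", OF lipF] \<open>0 \<le> L\<close>
    by auto
  have contF: "continuous_on UNIV (lattice_field \<phi>)"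
    by (rule lipschitz_on_continuous_on[of "2 + 2 * L"], rule lipschitz_onI)
      (use lipF \<open>0 \<le> L\<close> in \<open>auto simp: dist_norm\<close>)
  have contu: "continuous_on UNIV u"
    by (intro continuous_at_imp_continuous_on ballI has_vector_derivative_continuous[OF u'])
  have contu': "continuous_on UNIV (\<lambda>t. lattice_field \<phi> (u t))"
    by (rule continuous_on_compose2[OF contF contu]) simp
  have dw: "((\<lambda>t. fst (u t)) has_vector_derivative fst (lattice_field \<phi> (u t))) (at t)" for t
    by (rule bounded_linear.has_vector_derivative[OF bounded_linear_fst u'])
  have dp: "((\<lambda>t. snd (u t)) has_vector_derivative snd (lattice_field \<phi> (u t))) (at t)" for t
    by (rule bounded_linear.has_vector_derivative[OF bounded_linear_snd u'])
  have comp: "seq (Ell2 (\<lambda>n. \<phi> (seq x n))) = (\<lambda>n. \<phi> (seq x n))" for x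
    by (rule seq_Ell2[OF comp_l2[OF assms(1-3)]])
  show thesis
  proof (rule that[of "\<lambda>t. seq (fst (u t))" "\<lambda>t. seq (snd (u t))"])
    show "seq (fst (u 0)) = w0" "seq (snd (u 0)) = p0"
      using u0 assms by (simp_all add: seq_Ell2)
    show "C1_into_l2 I (\<lambda>t. seq (fst (u t)))" "C1_into_l2 I (\<lambda>t. seq (snd (u t)))" for I
      by (intro C1_into_l2I[OF dw] C1_into_l2I[OF dp] continuous_intros contu')+
    show "((\<lambda>r. seq (fst (u r)) n) has_real_derivative seq (snd (u t)) (n + 1) - seq (snd (u t)) n) (at t)" for t n
      using bounded_linear.has_vector_derivative[OF bounded_linear_seq dw, of n t]
      by (simp add: has_real_derivative_iff_has_vector_derivative lattice_field_def seq_simps seq_shift)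
    show "((\<lambda>r. seq (snd (u r)) n) has_real_derivative
        \<phi> (seq (fst (u t)) n) - \<phi> (seq (fst (u t)) (n - 1))) (at t)" for t n
      using bounded_linear.has_vector_derivative[OF bounded_linear_seq dp, of n t]
      by (simp add: has_real_derivative_iff_has_vector_derivative lattice_field_def seq_simps seq_shift comp)
  qed
qed

text \<open>
  The derivative \<open>(1 + \<epsilon>\<^sup>2) * (1 + w) powr \<epsilon>\<^sup>2\<close> of \<open>V'\<close> stays
  bounded as \<open>w\<close> approaches \<open>-1\<close>, so on any set bounded from above \<open>V'\<close> is
  Lipschitz up to the boundary of its domain.
\<close>

lemma V'_lipschitz:
  assumes "x \<in> {-1<..M}" "y \<in> {-1<..M}"
  shows "\<bar>V' \<epsilon> x - V' \<epsilon> y\<bar> \<le> (1 + \<epsilon>\<^sup>2) * (1 + M) powr \<epsilon>\<^sup>2 * \<bar>x - y\<bar>"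
proof -
  have "norm (V' \<epsilon> x - V' \<epsilon> y) \<le> ((1 + \<epsilon>\<^sup>2) * (1 + M) powr \<epsilon>\<^sup>2) * norm (x - y)"
  proof (rule field_differentiable_bound[of "{-1<..M}"])
    fix z assume z: "z \<in> {-1<..M}"
    then show "(V' \<epsilon> has_field_derivative (1 + \<epsilon>\<^sup>2) * (1 + z) powr \<epsilon>\<^sup>2) (at z within {-1<..M})"
      unfolding V'_def[abs_def] by (auto intro!: derivative_eq_intros)
    show "norm ((1 + \<epsilon>\<^sup>2) * (1 + z) powr \<epsilon>\<^sup>2) \<le> (1 + \<epsilon>\<^sup>2) * (1 + M) powr \<epsilon>\<^sup>2"
      using z by (auto simp: abs_mult intro!: mult_left_mono powr_mono2)
  qed (use assms in auto)
  then show ?thesis by simp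
qed

text \<open>
  Two solutions in \<open>C\<^sup>1\<close> with values in \<open>l\<^sup>2\<close> are bounded on a compact interval,
  where \<open>V'\<close> is Lipschitz; Gronwall's lemma applies to the squared norm of their difference.
\<close>

lemma lattice_uniqueness:
  assumes w: "solves_lattice_ivp \<epsilon> {a..b} w0 p0 w p" "C1_into_l2 {a..b} w" "C1_into_l2 {a..b} p"
    and v: "solves_lattice_ivp \<epsilon> {a..b} w0 p0 v q" "C1_into_l2 {a..b} v" "C1_into_l2 {a..b} q"
    and "a \<le> 0" "0 \<le> b" "t \<in> {a..b}"
  shows "w t = v t \<and> p t = q t"
proof (cases "a < b")
  case False
  then have "t = 0" using assms(7-9) by auto
  then show ?thesis using w(1) v(1) by (simp add: solves_lattice_ivp_def)
next
  case True
  have l2: "w t \<in> l2" "p t \<in> l2" "v t \<in> l2" "q t \<in> l2" if "t \<in> {a..b}" for t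
    using that assms by (auto simp: C1_into_l2_def)
  obtain w' where w'_all: "\<forall>t\<in>{a..b}. ((\<lambda>t. Ell2 (w t)) has_vector_derivative w' t) (at t within {a..b})"
    using C1_into_l2D[OF w(2)] by blast
  obtain p' where p'_all: "\<forall>t\<in>{a..b}. ((\<lambda>t. Ell2 (p t)) has_vector_derivative p' t) (at t within {a..b})"
    using C1_into_l2D[OF w(3)] by blast
  obtain v' where v'_all: "\<forall>t\<in>{a..b}. ((\<lambda>t. Ell2 (v t)) has_vector_derivative v' t) (at t within {a..b})"
    using C1_into_l2D[OF v(2)] by blast
  obtain q' where q'_all: "\<forall>t\<in>{a..b}. ((\<lambda>t. Ell2 (q t)) has_vector_derivative q' t) (at t within {a..b})"
    using C1_into_l2D[OF v(3)] by blast
  note w' = w'_all[rule_format] and p' = p'_all[rule_format] and v' = v'_all[rule_format] and q' = q'_all[rule_format]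
  have component: "seq E n = D"
    if u: "\<And>t. t \<in> {a..b} \<Longrightarrow> u t \<in> l2" and t: "t \<in> {a..b}"
      and u': "((\<lambda>t. Ell2 (u t)) has_vector_derivative E) (at t within {a..b})"
      and D: "((\<lambda>r. u r n) has_real_derivative D) (at t within {a..b})" for u E t n D
  proof -
    have "((\<lambda>t. seq (Ell2 (u t)) n) has_vector_derivative seq E n) (at t within {a..b})"
      by (rule bounded_linear.has_vector_derivative[OF bounded_linear_seq u'])
    then have "((\<lambda>r. u r n) has_vector_derivative seq E n) (at t within {a..b})"
      by (rule has_vector_derivative_transform[OF t, rotated 1]) (simp add: seq_Ell2 u)
    then show ?thesis
      using vector_derivative_unique_within_closed_interval[OF True, of t "\<lambda>r. u r n"] t
        D[unfolded has_real_derivative_iff_has_vector_derivative] by simp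
  qed
  obtain M1 M2 where M1: "\<And>t. t \<in> {a..b} \<Longrightarrow> l2_norm (w t) \<le> M1"
    and M2: "\<And>t. t \<in> {a..b} \<Longrightarrow> l2_norm (v t) \<le> M2"
    using C1_into_l2_bounded[OF w(2)] C1_into_l2_bounded[OF v(2)] by metis
  define M where "M = max M1 M2"
  have range: "w t n \<in> {-1<..M} \<and> v t n \<in> {-1<..M}" if "t \<in> {a..b}" for t n
    using w(1) v(1) that abs_le_l2_norm[OF l2(1)[OF that], of n] abs_le_l2_norm[OF l2(3)[OF that], of n]
      M1[OF that] M2[OF that]
    by (auto simp: solves_lattice_ivp_def M_def)
  define L where "L = (1 + \<epsilon>\<^sup>2) * (1 + M) powr \<epsilon>\<^sup>2"
  have "0 \<le> L" by (simp add: L_def)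
  define z where "z t = (Ell2 (w t) - Ell2 (v t), Ell2 (p t) - Ell2 (q t))" for t
  define z' where "z' t = (w' t - v' t, p' t - q' t)" for t
  have z': "(z has_vector_derivative z' t) (at t within {a..b})" if "t \<in> {a..b}" for t
    unfolding z_def[abs_def] z'_def
    by (intro has_vector_derivative_Pair has_vector_derivative_diff w' v' p' q' that)
  have z'_le: "norm (z' t) \<le> (2 + 2 * L) * norm (z t)" if t: "t \<in> {a..b}" for t
  proof -
    define c where "c = (\<lambda>n. V' \<epsilon> (w t n) - V' \<epsilon> (v t n))"
    have c: "\<bar>c n\<bar> \<le> L * \<bar>w t n - v t n\<bar>" for n
      unfolding c_def L_def using V'_lipschitz range[OF t] by blast
    have "c \<in> l2"
      by (rule l2_dominated(1)[OF _ c \<open>0 \<le> L\<close>]) (use l2_add_scale[OF l2(1,3)[OF t], of "-1"] in simp)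
    have "seq (w' t) n = p t (n + 1) - p t n" "seq (p' t) n = V' \<epsilon> (w t n) - V' \<epsilon> (w t (n - 1))"
      "seq (v' t) n = q t (n + 1) - q t n" "seq (q' t) n = V' \<epsilon> (v t n) - V' \<epsilon> (v t (n - 1))" for n
      using w(1) v(1) t component[where u = w, OF l2(1) t w'[OF t]] component[where u = p, OF l2(2) t p'[OF t]]
        component[where u = v, OF l2(3) t v'[OF t]] component[where u = q, OF l2(4) t q'[OF t]]
      unfolding solves_lattice_ivp_def by blast+
    then have "z' t = (shift 1 (snd (z t)) - snd (z t), Ell2 c - shift (-1) (Ell2 c))"
      unfolding z'_def prod_eq_iff seq_inject[symmetric] z_def
      by (auto simp: seq_simps seq_shift seq_Ell2 l2[OF t] \<open>c \<in> l2\<close> fun_eq_iff) (simp_all add: c_def)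
    then show ?thesis
      using norm_lattice_difference_le[of "Ell2 c" L "fst (z t)" "snd (z t)"] c \<open>0 \<le> L\<close>
      by (simp add: z_def seq_simps seq_Ell2 l2[OF t] \<open>c \<in> l2\<close>)
  qed
  have "z t \<bullet> z t + 0 \<le> (z 0 \<bullet> z 0 + 0) * exp (2 * (2 + 2 * L) * \<bar>t\<bar>)"
  proof (rule gronwall[where y' = "\<lambda>t. 2 * (z t \<bullet> z' t)", OF _ _ assms(7-9)])
    fix t assume t: "t \<in> {a..b}"
    have "((\<lambda>t. z t \<bullet> z t) has_vector_derivative z t \<bullet> z' t + z' t \<bullet> z t) (at t within {a..b})"
      by (rule bounded_bilinear.has_vector_derivative[OF bounded_bilinear_inner z'[OF t] z'[OF t]])
    then show "((\<lambda>t. z t \<bullet> z t) has_real_derivative 2 * (z t \<bullet> z' t)) (at t within {a..b})"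
      by (simp add: has_real_derivative_iff_has_vector_derivative inner_commute)
    have "\<bar>z t \<bullet> z' t\<bar> \<le> norm (z t) * norm (z' t)" by (rule Cauchy_Schwarz_ineq2)
    also have "\<dots> \<le> norm (z t) * ((2 + 2 * L) * norm (z t))"
      by (intro mult_left_mono z'_le[OF t]) simp
    finally show "\<bar>2 * (z t \<bullet> z' t)\<bar> \<le> 2 * (2 + 2 * L) * (z t \<bullet> z t + 0)"
      by (simp add: power2_norm_eq_inner[symmetric] power2_eq_square algebra_simps abs_mult)
  qed
  moreover have "z 0 = 0" using w(1) v(1) by (simp add: z_def solves_lattice_ivp_def zero_prod_def)
  ultimately have "z t \<bullet> z t = 0" using inner_ge_zero[of "z t"] by simp
  then have "z t = 0" by simp
  then have "Ell2 (w t) = Ell2 (v t)" "Ell2 (p t) = Ell2 (q t)"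
    by (simp_all add: z_def zero_prod_def)
  then show ?thesis using l2[OF assms(9)] by (simp add: Ell2_inject)
qed

corollary unique_l2_solutionI:
  assumes "solves_lattice_ivp \<epsilon> I w0 p0 w p" "C1_into_l2 I w" "C1_into_l2 I p"
  shows "unique_l2_solution \<epsilon> I w0 p0 w p"
  unfolding unique_l2_solution_def
proof (intro allI impI ballI, elim conjE)
  fix a b v q t
  assume "a \<le> 0" "0 \<le> b" "{a..b} \<subseteq> I" "t \<in> {a..b}"
    and v: "solves_lattice_ivp \<epsilon> {a..b} w0 p0 v q" "C1_into_l2 {a..b} v" "C1_into_l2 {a..b} q"
  then show "v t = w t \<and> q t = p t"
    using lattice_uniqueness[OF v solves_lattice_ivp_subset[OF assms(1)]
        C1_into_l2_subset[OF assms(2)] C1_into_l2_subset[OF assms(3)]] by blast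
qed

section \<open>Smooth functions with compact support\<close>

definition smooth :: "(real \<Rightarrow> real) \<Rightarrow> bool" where
  "smooth \<phi> \<longleftrightarrow> (\<forall>k x. (deriv ^^ k) \<phi> differentiable (at x))"

text \<open>
  Smoothness by coinduction: a class of functions that contains a derivative of each of its members consists of smooth
  functions. This replaces formulas for higher derivatives of sums, products and compositions.
\<close>

lemma smooth_coinduct:
  assumes "f \<in> S" and step: "\<And>f. f \<in> S \<Longrightarrow> \<exists>f'\<in>S. \<forall>x. (f has_real_derivative f' x) (at x)"
  shows "smooth f"
proof -
  have deriv: "deriv f \<in> S \<and> (\<forall>x. f differentiable (at x))" if "f \<in> S" for f
  proof -
    obtain f' where "f' \<in> S" "\<And>x. (f has_real_derivative f' x) (at x)" using step[OF \<open>f \<in> S\<close>] by blast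
    moreover from this have "deriv f = f'" by (intro ext DERIV_imp_deriv)
    ultimately show ?thesis using real_differentiable_def by blast
  qed
  have "(deriv ^^ k) f \<in> S" for k
    using \<open>f \<in> S\<close> deriv by (induction k) auto
  then show ?thesis using deriv by (simp add: smooth_def)
qed

lemma smooth_deriv:
  assumes "smooth f"
  shows "smooth (deriv f)" "(f has_real_derivative deriv f x) (at x)" "continuous_on UNIV f"
proof -
  have d: "(deriv ^^ k) f differentiable (at x)" for k x using assms by (simp add: smooth_def)
  have "(deriv ^^ k) (deriv f) = (deriv ^^ Suc k) f" for k
    by (simp add: funpow_swap1)
  then show "smooth (deriv f)" unfolding smooth_def using d by metis
  have "f differentiable (at x)" for x using d[of 0] by simp
  then show *: "(f has_real_derivative deriv f x) (at x)" for x
    by (simp add: DERIV_deriv_iff_real_differentiable)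
  show "continuous_on UNIV f"
    by (intro continuous_at_imp_continuous_on ballI DERIV_isCont[OF *])
qed

lemma smooth_diff_scale:
  assumes "smooth f" "smooth u"
  shows "smooth (\<lambda>x. f x - c * u x)"
proof (rule smooth_coinduct[where S = "{\<lambda>x. f x - c * u x | f u. smooth f \<and> smooth u}"])
  fix h assume "h \<in> {\<lambda>x. f x - c * u x | f u. smooth f \<and> smooth u}"
  then obtain f u where h: "h = (\<lambda>x. f x - c * u x)" and fu: "smooth f" "smooth u" by blast
  have "(h has_real_derivative deriv f x - c * deriv u x) (at x)" for x
    unfolding h by (intro DERIV_diff DERIV_cmult smooth_deriv(2) fu)
  then show "\<exists>h'\<in>{\<lambda>x. f x - c * u x | f u. smooth f \<and> smooth u}. \<forall>x. (h has_real_derivative h' x) (at x)"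
    using smooth_deriv(1)[OF fu(1)] smooth_deriv(1)[OF fu(2)]
    by (intro bexI[of _ "\<lambda>x. deriv f x - c * deriv u x"]) auto
qed (use assms in blast)

lemma smooth_antiderivative:
  assumes "\<And>x. (f has_real_derivative u x) (at x)" "smooth u"
  shows "smooth f"
proof (rule smooth_coinduct[where S = "insert f {u. smooth u}"])
  fix h assume "h \<in> insert f {u. smooth u}"
  then consider "h = f" | "smooth h" by blast
  then show "\<exists>h'\<in>insert f {u. smooth u}. \<forall>x. (h has_real_derivative h' x) (at x)"
    by cases (use assms smooth_deriv in blast)+
qed simp

text \<open>
  The functions \<open>q(1/y) exp(-1/y)\<close> for \<open>y > 0\<close>, extended by zero. For varying polynomials
  \<open>q\<close> they form a class closed under differentiation, see \<open>flat_deriv\<close>.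
\<close>

definition flat :: "real poly \<Rightarrow> real \<Rightarrow> real" where
  "flat q y = (if y > 0 then poly q (1 / y) * exp (- (1 / y)) else 0)"

lemma power_poly_exp_tendsto_0: "((\<lambda>z. z ^ k * poly q z * exp (- z)) \<longlongrightarrow> (0::real)) at_top"
proof (induction q arbitrary: k)
  case (pCons a q)
  have "((\<lambda>z. z ^ k / exp z) \<longlongrightarrow> (0::real)) at_top" by (rule tendsto_power_div_exp_0)
  then have "((\<lambda>z. a * (z ^ k / exp z) + z ^ Suc k * poly q z * exp (- z)) \<longlongrightarrow> a * 0 + 0) at_top"
    by (intro tendsto_add tendsto_mult_left pCons.IH)
  then show ?case by (simp add: algebra_simps exp_minus divide_inverse)
qed simp

text \<open>
  At \<open>y = 0\<close> the difference quotient from the right becomes, with \<open>z = 1 / y\<close>, a polynomial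
  times \<open>exp (- z)\<close> for \<open>z\<close> tending to infinity.
\<close>

lemma flat_deriv: "(flat q has_real_derivative flat ([:0, 0, 1:] * (q - pderiv q)) y) (at y)"
proof -
  consider "y > 0" | "y < 0" | "y = 0" by linarith
  then show ?thesis
  proof cases
    case 1
    have "((\<lambda>y. poly q (1 / y) * exp (- (1 / y))) has_real_derivative
        poly ([:0, 0, 1:] * (q - pderiv q)) (1 / y) * exp (- (1 / y))) (at y)"
      using 1 by (auto intro!: derivative_eq_intros DERIV_chain2[OF poly_DERIV]
          simp: power2_eq_square algebra_simps divide_simps)
    then have "((\<lambda>y. poly q (1 / y) * exp (- (1 / y))) has_real_derivative
        flat ([:0, 0, 1:] * (q - pderiv q)) y) (at y)"
      using 1 by (simp add: flat_def)
    then show ?thesis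
      by (rule has_field_derivative_transform_within_open[where S = "{0<..}"])
        (use 1 in \<open>auto simp: flat_def\<close>)
  next
    case 2
    have "((\<lambda>_. 0) has_real_derivative flat ([:0, 0, 1:] * (q - pderiv q)) y) (at y)"
      using 2 by (simp add: flat_def)
    then show ?thesis
      by (rule has_field_derivative_transform_within_open[where S = "{..<0}"])
        (use 2 in \<open>auto simp: flat_def\<close>)
  next
    case 3
    have "((\<lambda>h. (flat q (0 + h) - flat q 0) / h) \<longlongrightarrow> 0) (at 0)"
    proof (rule filterlim_split_at)
      show "((\<lambda>h. (flat q (0 + h) - flat q 0) / h) \<longlongrightarrow> 0) (at_left 0)"
        by (rule tendsto_eventually) (auto simp: flat_def eventually_at_filter)
      have "((\<lambda>z. (flat q (0 + inverse z) - flat q 0) / inverse z) \<longlongrightarrow> 0) at_top"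
      proof (rule Lim_transform_eventually[OF power_poly_exp_tendsto_0[of 1 q]])
        show "\<forall>\<^sub>F z in at_top. z ^ 1 * poly q z * exp (- z) = (flat q (0 + inverse z) - flat q 0) / inverse z"
          using eventually_gt_at_top[of "0::real"]
          by eventually_elim (simp add: flat_def divide_inverse)
      qed
      then show "((\<lambda>h. (flat q (0 + h) - flat q 0) / h) \<longlongrightarrow> 0) (at_right 0)"
        by (subst filterlim_at_right_to_top)
    qed
    then show ?thesis using 3 by (simp add: DERIV_def flat_def)
  qed
qed

text \<open>
  The smallest class that contains the functions \<open>flat q\<close> after affine changes of variable and is closed
  under sums and products. By the product rule it is closed under derivatives.
\<close>

inductive_set flat_algebra :: "(real \<Rightarrow> real) set" where
  flat: "(\<lambda>x. flat q (c * x + d)) \<in> flat_algebra"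
| add: "f \<in> flat_algebra \<Longrightarrow> u \<in> flat_algebra \<Longrightarrow> (\<lambda>x. f x + u x) \<in> flat_algebra"
| mult: "f \<in> flat_algebra \<Longrightarrow> u \<in> flat_algebra \<Longrightarrow> (\<lambda>x. f x * u x) \<in> flat_algebra"

lemma flat_algebra_deriv:
  assumes "f \<in> flat_algebra"
  shows "\<exists>f'\<in>flat_algebra. \<forall>x. (f has_real_derivative f' x) (at x)"
  using assms
proof induction
  case (flat q c d)
  let ?q = "smult c ([:0, 0, 1:] * (q - pderiv q))"
  have "((\<lambda>x. flat q (c * x + d)) has_real_derivative flat ?q (c * x + d)) (at x)" for x
  proof -
    have "((\<lambda>x. c * x + d) has_real_derivative c) (at x)"
      by (auto intro!: derivative_eq_intros)
    moreover have "flat ?q y = flat ([:0, 0, 1:] * (q - pderiv q)) y * c" for y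
      by (simp only: flat_def poly_smult) simp
    ultimately show ?thesis using DERIV_chain2[OF flat_deriv] by simp
  qed
  then show ?case by (intro bexI[OF _ flat_algebra.flat[of ?q c d]]) auto
next
  case (add f u)
  then obtain f' u' where "f' \<in> flat_algebra" "u' \<in> flat_algebra"
    and d: "\<And>x. (f has_real_derivative f' x) (at x)" "\<And>x. (u has_real_derivative u' x) (at x)" by blast
  then show ?case
    by (intro bexI[OF _ flat_algebra.add[of f' u']] allI DERIV_add) auto
next
  case (mult f u)
  then obtain f' u' where "f' \<in> flat_algebra" "u' \<in> flat_algebra"
    and d: "\<And>x. (f has_real_derivative f' x) (at x)" "\<And>x. (u has_real_derivative u' x) (at x)" by blast
  then have "(\<lambda>x. f' x * u x + u' x * f x) \<in> flat_algebra"
    using mult.hyps by (intro flat_algebra.intros)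
  then show ?case
    by (rule bexI[rotated]) (intro allI DERIV_mult d)
qed

lemma smooth_flat_algebra: "f \<in> flat_algebra \<Longrightarrow> smooth f"
  by (rule smooth_coinduct[OF _ flat_algebra_deriv])

lemma test_functionI:
  assumes "smooth \<phi>" "\<And>x. x \<notin> {a..b} \<Longrightarrow> \<phi> x = 0"
  shows "test_function \<phi>"
proof -
  have "closure {x. \<phi> x \<noteq> 0} \<subseteq> {a..b}"
    by (rule closure_minimal) (use assms(2) in blast, simp)
  then have "compact (closure {x. \<phi> x \<noteq> 0})"
    using compact_Icc bounded_subset[of "{a..b}"] by (simp add: compact_eq_bounded_closed bounded_closed_interval)
  then show ?thesis using assms(1) by (simp add: test_function_def smooth_def)
qed

lemma test_functionD:
  assumes "test_function \<phi>"
  obtains R where "R > 0" "\<And>x. \<bar>x\<bar> > R \<Longrightarrow> \<phi> x = 0" "\<And>x. \<bar>x\<bar> > R \<Longrightarrow> deriv \<phi> x = 0" "smooth \<phi>"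
proof -
  have "bounded {x. \<phi> x \<noteq> 0}"
    using assms compact_imp_bounded bounded_subset closure_subset unfolding test_function_def by blast
  then obtain R where R: "R > 0" "\<And>x. \<phi> x \<noteq> 0 \<Longrightarrow> \<bar>x\<bar> \<le> R"
    unfolding bounded_pos by auto
  have "deriv \<phi> x = 0" if "\<bar>x\<bar> > R" for x
  proof (rule DERIV_imp_deriv, rule has_field_derivative_transform_within_open)
    show "((\<lambda>_. 0) has_real_derivative 0) (at x)" by simp
    show "open {y. \<bar>y\<bar> > R}" by (intro open_Collect_less continuous_intros)
  qed (use R(2) that in force)+
  moreover have "smooth \<phi>" using assms by (simp add: test_function_def smooth_def)
  ultimately show thesis using that R by fastforce
qed

text \<open>
  Smooth approximations of the indicator of \<open>{a<..<b}\<close>, supported in \<open>{a..b}\<close>: \<open>flat 1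
  (n * z)\<close> tends to \<open>1\<close> for \<open>z > 0\<close> and vanishes for \<open>z \<le> 0\<close>.
\<close>

definition plateau :: "real \<Rightarrow> real \<Rightarrow> nat \<Rightarrow> real \<Rightarrow> real" where
  "plateau a b n x = flat 1 (of_nat n * x + - (of_nat n * a)) * flat 1 (- of_nat n * x + of_nat n * b)"

lemma test_function_plateau: "test_function (plateau a b n)"
proof (rule test_functionI)
  show "smooth (plateau a b n)"
    unfolding plateau_def[abs_def]
    by (rule smooth_flat_algebra[OF flat_algebra.mult[OF flat_algebra.flat flat_algebra.flat]])
  show "plateau a b n x = 0" if "x \<notin> {a..b}" for x
  proof -
    have "of_nat n * x \<le> of_nat n * a \<or> of_nat n * b \<le> of_nat n * x"
      using that mult_left_mono[of x a "of_nat n"] mult_left_mono[of b x "of_nat n"] by auto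
    then show ?thesis by (auto simp: plateau_def flat_def)
  qed
qed

lemma flat_1_bounds: "0 \<le> flat 1 y" "flat 1 y \<le> 1"
  by (auto simp: flat_def)

lemma plateau_bounds: "0 \<le> plateau a b n x" "plateau a b n x \<le> indicator {a<..<b} x"
proof -
  show "0 \<le> plateau a b n x"
    by (simp add: plateau_def flat_1_bounds)
  have "plateau a b n x \<le> 1"
    unfolding plateau_def by (intro mult_le_one flat_1_bounds)
  moreover have "plateau a b n x = 0" if "x \<notin> {a<..<b}"
  proof -
    have "of_nat n * x \<le> of_nat n * a \<or> of_nat n * b \<le> of_nat n * x"
      using that mult_left_mono[of x a "of_nat n"] mult_left_mono[of b x "of_nat n"] by auto
    then show ?thesis by (auto simp: plateau_def flat_def)
  qed
  ultimately show "plateau a b n x \<le> indicator {a<..<b} x" by (auto simp: indicator_def)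
qed

lemma plateau_pos: "x \<in> {a<..<b} \<Longrightarrow> n > 0 \<Longrightarrow> plateau a b n x > 0"
  by (auto simp: plateau_def flat_def)

lemma plateau_tendsto: "(\<lambda>n. plateau a b n x) \<longlonglongrightarrow> indicator {a<..<b} x"
proof (cases "x \<in> {a<..<b}")
  case False
  then have "plateau a b n x = 0" for n
    using plateau_bounds[of a b n x] by simp
  then show ?thesis using False by simp
next
  case True
  have "(\<lambda>n. flat 1 (of_nat n * c)) \<longlonglongrightarrow> 1" if "c > 0" for c
  proof (rule Lim_transform_eventually)
    have "(\<lambda>n. exp (- (inverse (real n) * inverse c))) \<longlonglongrightarrow> exp (- (0 * inverse c))"
      by (intro tendsto_intros lim_inverse_n)
    then show "(\<lambda>n. exp (- (inverse (real n) * inverse c))) \<longlonglongrightarrow> 1" by simp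
    show "\<forall>\<^sub>F n in sequentially. exp (- (inverse (real n) * inverse c)) = flat 1 (of_nat n * c)"
      using eventually_gt_at_top[of 0] by eventually_elim (use that in \<open>simp add: flat_def divide_inverse\<close>)
  qed
  from tendsto_mult[OF this[of "x - a"] this[of "b - x"]]
  show ?thesis using True by (simp add: plateau_def algebra_simps)
qed

lemmas density_unique_lborel = sigma_finite_measure.density_unique_iff[OF lborel.sigma_finite_measure_axioms]

section \<open>Functions determined by their integrals against test functions\<close>

text \<open>
  The positive and the negative part of \<open>f\<close> are densities of two finite measures that agree on all rays,
  hence coincide.
\<close>

lemma AE_zero_if_rays_zero:
  fixes f :: "real \<Rightarrow> real"
  assumes f: "integrable lborel f" and zero: "\<And>a. (LINT x|lborel. f x * indicator {a<..} x) = 0"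
  shows "AE x in lborel. f x = 0"
proof -
  define M where "M s = density lborel (\<lambda>x. ennreal (max 0 (s * f x)))" for s :: real
  have [measurable]: "f \<in> borel_measurable borel" using f by simp
  have M_ray: "emeasure (M s) {a<..} = ennreal (LINT x|lborel. max 0 (s * f x) * indicator {a<..} x)" for s a
  proof -
    have "emeasure (M s) {a<..} = (\<integral>\<^sup>+x. ennreal (max 0 (s * f x) * indicator {a<..} x) \<partial>lborel)"
      unfolding M_def by (subst emeasure_density) (auto simp: ennreal_mult' ennreal_indicator[symmetric] intro!: nn_integral_cong split: split_indicator)
    also have "\<dots> = ennreal (LINT x|lborel. max 0 (s * f x) * indicator {a<..} x)"
      by (intro nn_integral_eq_integral integrable_real_mult_indicator integrable_max)
        (use f in auto)
    finally show ?thesis .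
  qed
  have "M 1 = M (-1)"
  proof (rule measure_eqI_lessThan)
    show "sets (M 1) = sets borel" "sets (M (-1)) = sets borel" by (simp_all add: M_def)
    show "emeasure (M 1) {a<..} < \<infinity>" for a by (simp add: M_ray)
    fix a
    have "(LINT x|lborel. max 0 (1 * f x) * indicator {a<..} x) - (LINT x|lborel. max 0 (-1 * f x) * indicator {a<..} x)
        = (LINT x|lborel. max 0 (1 * f x) * indicator {a<..} x - max 0 (-1 * f x) * indicator {a<..} x)"
      by (intro Bochner_Integration.integral_diff[symmetric] integrable_real_mult_indicator integrable_max) (use f in auto)
    also have "\<dots> = (LINT x|lborel. f x * indicator {a<..} x)"
      by (intro Bochner_Integration.integral_cong) (auto split: split_indicator)
    finally show "emeasure (M 1) {a<..} = emeasure (M (-1)) {a<..}"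
      unfolding M_ray zero by simp
  qed
  then have "AE x in lborel. ennreal (max 0 (1 * f x)) = ennreal (max 0 (-1 * f x))"
    unfolding M_def by (subst (asm) density_unique_lborel) auto
  then show ?thesis
    by eventually_elim (auto simp: max_def split: if_splits)
qed

text \<open>
  The fundamental lemma of the calculus of variations. Testing with plateau functions gives, by dominated convergence,
  that the integral over every bounded interval vanishes.
\<close>

lemma AE_zero_if_test_zero:
  assumes f: "\<And>N::nat. integrable lborel (\<lambda>x. f x * indicator {-real N<..<real N} x)"
    and zero: "\<And>\<phi>. test_function \<phi> \<Longrightarrow> (LINT x|lborel. f x * \<phi> x) = 0"
  shows "AE x in lborel. f x = 0"
proof -
  have interval: "(LINT x|lborel. f x * indicator {a<..<b} x) = 0" if N: "{a<..<b} \<subseteq> {-real N<..<real N}" for a b N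
  proof (rule LIMSEQ_unique)
    show "(\<lambda>n. LINT x|lborel. f x * plateau a b n x) \<longlonglongrightarrow> (LINT x|lborel. f x * indicator {a<..<b} x)"
    proof (rule integral_dominated_convergence[where w = "\<lambda>x. \<bar>f x * indicator {-real N<..<real N} x\<bar>"])
      have m[measurable]: "(\<lambda>x. f x * indicator {-real N<..<real N} x) \<in> borel_measurable lborel"
        using f by simp
      have c: "continuous_on UNIV (plateau a b n)" for n
        using test_function_plateau[of a b n] smooth_deriv(3) by (simp add: test_function_def smooth_def)
      have [measurable]: "plateau a b n \<in> borel_measurable lborel" for n
        using borel_measurable_continuous_onI[OF c] by simp
      have eq: "f x * indicator {a<..<b} x = f x * indicator {-real N<..<real N} x * indicator {a<..<b} x"
        "f x * plateau a b n x = f x * indicator {-real N<..<real N} x * plateau a b n x" for x n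
        using N plateau_bounds[of a b n x] by (auto split: split_indicator split_indicator_asm)
      show "(\<lambda>x. f x * indicator {a<..<b} x) \<in> borel_measurable lborel"
        unfolding eq(1) by measurable
      show "(\<lambda>x. f x * plateau a b n x) \<in> borel_measurable lborel" for n
        unfolding eq(2) by measurable
      show "integrable lborel (\<lambda>x. \<bar>f x * indicator {-real N<..<real N} x\<bar>)"
        by (intro integrable_abs f)
      show "AE x in lborel. (\<lambda>n. f x * plateau a b n x) \<longlonglongrightarrow> f x * indicator {a<..<b} x"
        by (intro AE_I2 tendsto_mult_left plateau_tendsto)
      show "AE x in lborel. norm (f x * plateau a b n x) \<le> \<bar>f x * indicator {-real N<..<real N} x\<bar>" for n
      proof (rule AE_I2)
        fix x
        have "plateau a b n x \<le> 1" using plateau_bounds[of a b n x] by (simp split: split_indicator_asm)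
        then show "norm (f x * plateau a b n x) \<le> \<bar>f x * indicator {-real N<..<real N} x\<bar>"
          unfolding eq(2) using plateau_bounds(1)[of a b n x]
          by (simp add: abs_mult mult_left_le)
      qed
    qed
    show "(\<lambda>n. LINT x|lborel. f x * plateau a b n x) \<longlonglongrightarrow> 0"
      using zero[OF test_function_plateau] by simp
  qed
  have "AE x in lborel. f x * indicator {-real N<..<real N} x = 0" for N
  proof (rule AE_zero_if_rays_zero[OF f])
    fix a
    have "(\<lambda>x. f x * indicator {-real N<..<real N} x * indicator {a<..} x)
        = (\<lambda>x. f x * indicator {max a (-real N)<..<real N} x)"
      by (auto split: split_indicator)
    moreover have "{max a (-real N)<..<real N} \<subseteq> {-real N<..<real N}" by auto
    ultimately show "(LINT x|lborel. f x * indicator {-real N<..<real N} x * indicator {a<..} x) = 0"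
      using interval by simp
  qed
  then have "AE x in lborel. \<forall>N. f x * indicator {-real N<..<real N} x = 0"
    unfolding AE_all_countable by (rule allI)
  then show ?thesis
  proof eventually_elim
    case (elim x)
    obtain N where "\<bar>x\<bar> < real N" using reals_Archimedean2 by blast
    then show ?case using elim[rule_format, of N] by (auto split: split_indicator_asm)
  qed
qed

section \<open>The du Bois-Reymond lemma\<close>

text \<open>
  Integrability over bounded intervals; the exhausting intervals are those of \<open>AE_zero_if_test_zero\<close>.
\<close>

definition locally_integrable :: "(real \<Rightarrow> real) \<Rightarrow> bool" where
  "locally_integrable f \<longleftrightarrow> (\<forall>N::nat. integrable lborel (\<lambda>x. f x * indicator {-real N<..<real N} x))"

lemma square_integrable_on_finite_measure:
  assumes "square_integrable f" and [measurable]: "S \<in> sets borel" and "emeasure lborel S < \<infinity>"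
  shows "integrable lborel (\<lambda>x. f x * indicator S x)"
proof (rule Bochner_Integration.integrable_bound)
  have [measurable]: "f \<in> borel_measurable borel" and i: "integrable lborel (\<lambda>x. (f x)\<^sup>2)"
    using assms(1) by (auto simp: square_integrable_def)
  show "integrable lborel (\<lambda>x. (f x)\<^sup>2 + indicator S x)"
    using assms by (intro Bochner_Integration.integrable_add i integrable_real_indicator) auto
  show "(\<lambda>x. f x * indicator S x) \<in> borel_measurable lborel" by measurable
  show "AE x in lborel. norm (f x * indicator S x) \<le> norm ((f x)\<^sup>2 + indicator S x)"
  proof (rule AE_I2)
    fix x
    have "\<bar>f x\<bar> \<le> (f x)\<^sup>2 + 1"
    proof -
      have "0 \<le> (\<bar>f x\<bar> - 1 / 2)\<^sup>2" by simp
      then show ?thesis by (simp add: power2_diff power2_abs power_divide)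
    qed
    then show "norm (f x * indicator S x) \<le> norm ((f x)\<^sup>2 + indicator S x)"
      by (auto split: split_indicator)
  qed
qed

lemma locally_integrable_square_integrable: "square_integrable f \<Longrightarrow> locally_integrable f"
  unfolding locally_integrable_def by (auto intro!: square_integrable_on_finite_measure)

lemma locally_integrable_continuous:
  assumes "continuous_on UNIV f" shows "locally_integrable f"
  unfolding locally_integrable_def
proof
  fix N :: nat
  have "integrable lborel (\<lambda>x. indicator {-real N..real N} x *\<^sub>R f x)"
    by (intro borel_integrable_compact compact_Icc continuous_on_subset[OF assms]) simp
  then have "integrable lborel (\<lambda>x. (indicator {-real N..real N} x *\<^sub>R f x) * indicator {-real N<..<real N} x)"
    by (intro integrable_real_mult_indicator) auto
  moreover have "(\<lambda>x. (indicator {-real N..real N} x *\<^sub>R f x) * indicator {-real N<..<real N} x)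
      = (\<lambda>x. f x * indicator {-real N<..<real N} x)"
    by (auto split: split_indicator)
  ultimately show "integrable lborel (\<lambda>x. f x * indicator {-real N<..<real N} x)" by (simp only:)
qed

lemma locally_integrable_diff:
  assumes "locally_integrable f" "locally_integrable u"
  shows "locally_integrable (\<lambda>x. f x - u x)"
  using assms unfolding locally_integrable_def left_diff_distrib
  by (intro allI Bochner_Integration.integrable_diff) auto

lemma locally_integrable_mult_compact_support:
  assumes f: "locally_integrable f" and \<phi>: "continuous_on UNIV \<phi>" "\<And>x. \<bar>x\<bar> > R \<Longrightarrow> \<phi> x = 0"
  shows "integrable lborel (\<lambda>x. f x * \<phi> x)"
proof -
  obtain N where N: "R < real N" using reals_Archimedean2 by blast
  have fN: "integrable lborel (\<lambda>x. f x * indicator {-real N<..<real N} x)"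
    using f by (simp add: locally_integrable_def)
  have "compact (\<phi> ` {-R..R})"
    by (intro compact_continuous_image continuous_on_subset[OF \<phi>(1)]) auto
  then obtain B where B: "\<And>x. x \<in> {-R..R} \<Longrightarrow> \<bar>\<phi> x\<bar> \<le> B"
    using compact_imp_bounded[of "\<phi> ` {-R..R}"] by (metis bounded_iff imageI real_norm_def)
  have B': "\<bar>\<phi> x\<bar> \<le> \<bar>B\<bar>" for x
  proof (cases "\<bar>x\<bar> > R")
    case False
    then have "x \<in> {-R..R}" unfolding atLeastAtMost_iff by linarith
    from B[OF this] show ?thesis by linarith
  qed (use \<phi>(2) in simp)
  have [measurable]: "\<phi> \<in> borel_measurable borel" by (rule borel_measurable_continuous_onI[OF \<phi>(1)])
  have "integrable lborel (\<lambda>x. (f x * indicator {-real N<..<real N} x) * \<phi> x)"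
  proof (rule Bochner_Integration.integrable_bound)
    show "integrable lborel (\<lambda>x. \<bar>B\<bar> * (f x * indicator {-real N<..<real N} x))"
      by (intro integrable_mult_right fN)
    show "(\<lambda>x. (f x * indicator {-real N<..<real N} x) * \<phi> x) \<in> borel_measurable lborel"
      using borel_measurable_integrable[OF fN] by measurable
    show "AE x in lborel. norm ((f x * indicator {-real N<..<real N} x) * \<phi> x)
        \<le> norm (\<bar>B\<bar> * (f x * indicator {-real N<..<real N} x))"
      using B' by (intro AE_I2) (auto simp: abs_mult mult.commute intro!: mult_right_mono split: split_indicator)
  qed
  moreover have "(f x * indicator {-real N<..<real N} x) * \<phi> x = f x * \<phi> x" for x
    using \<phi>(2)[of x] N by (auto split: split_indicator)
  ultimately show ?thesis by simp
qed

lemma locally_integrable_mult_test: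
  assumes "locally_integrable f" "test_function \<phi>"
  shows "integrable lborel (\<lambda>x. f x * \<phi> x)" "integrable lborel (\<lambda>x. f x * deriv \<phi> x)"
proof -
  obtain R where R: "\<And>x. \<bar>x\<bar> > R \<Longrightarrow> \<phi> x = 0" "\<And>x. \<bar>x\<bar> > R \<Longrightarrow> deriv \<phi> x = 0" "smooth \<phi>"
    using test_functionD[OF assms(2)] by metis
  show "integrable lborel (\<lambda>x. f x * \<phi> x)" "integrable lborel (\<lambda>x. f x * deriv \<phi> x)"
    using locally_integrable_mult_compact_support[OF assms(1) smooth_deriv(3)[OF R(3)] R(1)]
      locally_integrable_mult_compact_support[OF assms(1) smooth_deriv(3)[OF smooth_deriv(1)[OF R(3)]] R(2)]
    by auto
qed

text \<open>
  The nonnegative quantity is the integral over \<open>S\<close> of the squared deviation of \<open>f\<close> from its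
  mean.
\<close>

lemma Cauchy_Schwarz_set_integral:
  fixes f :: "real \<Rightarrow> real"
  assumes f: "integrable lborel (\<lambda>x. f x * indicator S x)" "integrable lborel (\<lambda>x. (f x)\<^sup>2 * indicator S x)"
    and S: "S \<in> sets borel" "emeasure lborel S < \<infinity>" "0 < measure lborel S"
  shows "(LINT x|lborel. f x * indicator S x)\<^sup>2 \<le> measure lborel S * (LINT x|lborel. (f x)\<^sup>2 * indicator S x)"
proof -
  let ?I = "LINT x|lborel. f x * indicator S x" and ?J = "LINT x|lborel. (f x)\<^sup>2 * indicator S x"
  let ?\<mu> = "measure lborel S" and ?m = "(LINT x|lborel. f x * indicator S x) / measure lborel S"
  have i: "integrable lborel (indicator S :: real \<Rightarrow> real)"
    using S by (intro integrable_real_indicator) auto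
  have "0 \<le> (LINT x|lborel. (f x - ?m)\<^sup>2 * indicator S x)"
    by (intro integral_nonneg_AE AE_I2) simp
  also have "\<dots> = (LINT x|lborel. (f x)\<^sup>2 * indicator S x - 2 * ?m * (f x * indicator S x) + ?m\<^sup>2 * indicator S x)"
    by (intro Bochner_Integration.integral_cong) (auto simp: power2_diff algebra_simps)
  also have "\<dots> = ?J - 2 * ?m * ?I + ?m\<^sup>2 * ?\<mu>"
    using f i S by simp
  also have "\<dots> = ?J - ?I\<^sup>2 / ?\<mu>"
    using S(3) by (simp add: power2_eq_square field_simps)
  finally show ?thesis using S(3) by (simp add: field_simps)
qed

text \<open>
  \<open>primitive h x\<close> is the integral of \<open>h\<close> from \<open>0\<close> to \<open>x\<close>, with a
  sign for negative \<open>x\<close>. Writing it as an integral against a kernel over the whole line prepares for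
  Fubini's theorem.
\<close>

definition step_kernel :: "real \<Rightarrow> real \<Rightarrow> real" where
  "step_kernel x s = (if 0 < s \<and> s \<le> x then 1 else 0) - (if x < s \<and> s \<le> 0 then 1 else 0)"

definition primitive :: "(real \<Rightarrow> real) \<Rightarrow> real \<Rightarrow> real" where
  "primitive h x = (LINT s|lborel. step_kernel x s * h s)"

lemma emeasure_lborel_Ioc_finite: "emeasure lborel {a<..b::real} < \<infinity>"
  by (rule emeasure_bounded_finite, rule bounded_subset[of "{a..b}"]) auto

lemma integrable_step_kernel:
  assumes "square_integrable h"
  shows "integrable lborel (\<lambda>s. step_kernel x s * h s)"
proof -
  have "(\<lambda>s. step_kernel x s * h s) = (\<lambda>s. h s * indicator {0<..x} s - h s * indicator {x<..0} s)"
    by (auto simp: step_kernel_def split: split_indicator)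
  moreover have "integrable lborel (\<lambda>s. h s * indicator {0<..x} s - h s * indicator {x<..0} s)"
    by (intro Bochner_Integration.integrable_diff square_integrable_on_finite_measure assms)
      (simp_all add: emeasure_lborel_Ioc_finite[simplified])
  ultimately show ?thesis by simp
qed

lemma primitive_diff:
  assumes "square_integrable h" "x \<le> y"
  shows "primitive h y - primitive h x = (LINT s|lborel. h s * indicator {x<..y} s)"
proof -
  have "primitive h y - primitive h x = (LINT s|lborel. step_kernel y s * h s - step_kernel x s * h s)"
    unfolding primitive_def
    by (rule Bochner_Integration.integral_diff[symmetric]) (rule integrable_step_kernel[OF assms(1)])+
  also have "\<dots> = (LINT s|lborel. h s * indicator {x<..y} s)"
    using assms(2) by (intro Bochner_Integration.integral_cong) (auto simp: step_kernel_def split: split_indicator)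
  finally show ?thesis .
qed

lemma primitive_modulus:
  assumes h: "square_integrable h"
  shows "(primitive h y - primitive h x)\<^sup>2 \<le> \<bar>y - x\<bar> * (LINT s|lborel. (h s)\<^sup>2)"
proof -
  have *: "(primitive h y - primitive h x)\<^sup>2 \<le> \<bar>y - x\<bar> * (LINT s|lborel. (h s)\<^sup>2)" if "x < y" for x y
  proof -
    have i: "integrable lborel (\<lambda>x. (h x)\<^sup>2)" using h by (simp add: square_integrable_def)
    have "(primitive h y - primitive h x)\<^sup>2 \<le> (y - x) * (LINT s|lborel. (h s)\<^sup>2 * indicator {x<..y} s)"
      using Cauchy_Schwarz_set_integral[of h "{x<..y}"] that
        square_integrable_on_finite_measure[OF h, of "{x<..y}"] integrable_real_mult_indicator[OF _ i, of "{x<..y}"]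
      by (simp add: primitive_diff[OF h] emeasure_lborel_Ioc_finite[simplified])
    also have "\<dots> \<le> (y - x) * (LINT s|lborel. (h s)\<^sup>2)"
      using that integrable_real_mult_indicator[OF _ i, of "{x<..y}"]
      by (intro mult_left_mono integral_mono i) (auto split: split_indicator)
    finally show ?thesis using that by simp
  qed
  consider "x < y" | "x = y" | "y < x" by linarith
  then show ?thesis using *[of x y] *[of y x]
    by cases (auto simp: power2_commute abs_minus_commute)
qed

lemma continuous_primitive:
  assumes "square_integrable h"
  shows "continuous_on UNIV (primitive h)"
proof -
  let ?J = "LINT s|lborel. (h s)\<^sup>2"
  have "(primitive h \<longlongrightarrow> primitive h x) (at x)" for x
  proof (rule LIM_zero_cancel, rule Lim_null_comparison)
    show "\<forall>\<^sub>F y in at x. norm (primitive h y - primitive h x) \<le> sqrt (\<bar>y - x\<bar> * ?J)"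
      using primitive_modulus[OF assms] by (intro always_eventually allI) (simp add: real_le_rsqrt)
    have "((\<lambda>y. sqrt (\<bar>y - x\<bar> * ?J)) \<longlongrightarrow> sqrt (\<bar>x - x\<bar> * ?J)) (at x)"
      by (intro tendsto_intros)
    then show "((\<lambda>y. sqrt (\<bar>y - x\<bar> * ?J)) \<longlongrightarrow> 0) (at x)" by simp
  qed
  then show ?thesis by (simp add: continuous_on_def)
qed

lemma integrable_product_lborel:
  fixes f u :: "real \<Rightarrow> real"
  assumes f: "integrable lborel f" and u: "integrable lborel u"
  shows "integrable (lborel \<Otimes>\<^sub>M lborel) (\<lambda>(x, s). f x * u s)"
proof (rule lborel_pair.Fubini_integrable)
  have [measurable]: "f \<in> borel_measurable borel" "u \<in> borel_measurable borel" using assms by auto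
  show "(\<lambda>(x, s). f x * u s) \<in> borel_measurable (lborel \<Otimes>\<^sub>M lborel)"
    by measurable
  have "(\<lambda>x. LINT y|lborel. norm (case (x, y) of (x, s) \<Rightarrow> f x * u s)) = (\<lambda>x. \<bar>f x\<bar> * (LINT y|lborel. \<bar>u y\<bar>))"
    by (simp add: abs_mult)
  then show "integrable lborel (\<lambda>x. LINT y|lborel. norm (case (x, y) of (x, s) \<Rightarrow> f x * u s))"
    using f by simp
  show "AE x in lborel. integrable lborel (\<lambda>y. case (x, y) of (x, s) \<Rightarrow> f x * u s)"
    using u by simp
qed

lemma integral_step_kernel_deriv:
  assumes \<phi>: "smooth \<phi>" and R: "\<And>x. \<bar>x\<bar> > R \<Longrightarrow> \<phi> x = 0" "\<And>x. \<bar>x\<bar> > R \<Longrightarrow> deriv \<phi> x = 0"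
  shows "(LINT x|lborel. step_kernel x s * deriv \<phi> x) = - \<phi> s"
proof -
  define K where "K = \<bar>R\<bar> + \<bar>s\<bar> + 1"
  have K: "\<bar>R\<bar> < K" "\<bar>s\<bar> < K" by (auto simp: K_def)
  have ftc: "(LINT x|lborel. deriv \<phi> x * indicator {a..b} x) = \<phi> b - \<phi> a" if "a \<le> b" for a b
    using that smooth_deriv(2)[OF \<phi>] smooth_deriv(3)[OF smooth_deriv(1)[OF \<phi>]]
    by (intro integral_FTC_Icc_real) (auto simp: continuous_on_eq_continuous_at)
  have ends: "\<phi> K = 0" "\<phi> (- K) = 0" using R(1)[of K] R(1)[of "- K"] K by auto
  show ?thesis
  proof (cases "s > 0")
    case True
    have "step_kernel x s * deriv \<phi> x = deriv \<phi> x * indicator {s..K} x" for x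
      using True R(2)[of x] K by (auto simp: step_kernel_def split: split_indicator)
    then have "(LINT x|lborel. step_kernel x s * deriv \<phi> x) = (LINT x|lborel. deriv \<phi> x * indicator {s..K} x)"
      by (simp only:)
    then show ?thesis using ftc[of s K] K ends by simp
  next
    case False
    have "(LINT x|lborel. step_kernel x s * deriv \<phi> x) = (LINT x|lborel. - (deriv \<phi> x * indicator {-K..s} x))"
    proof (rule integral_cong_AE)
      have [measurable]: "deriv \<phi> \<in> borel_measurable borel"
        by (rule borel_measurable_continuous_onI[OF smooth_deriv(3)[OF smooth_deriv(1)[OF \<phi>]]])
      show "(\<lambda>x. step_kernel x s * deriv \<phi> x) \<in> borel_measurable lborel"
        unfolding step_kernel_def by measurable
      show "(\<lambda>x. - (deriv \<phi> x * indicator {-K..s} x)) \<in> borel_measurable lborel" by measurable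
      show "AE x in lborel. step_kernel x s * deriv \<phi> x = - (deriv \<phi> x * indicator {-K..s} x)"
        using AE_lborel_singleton[of s]
      proof eventually_elim
        case (elim x)
        then show ?case
          using False R(2)[of x] K by (auto simp: step_kernel_def split: split_indicator)
      qed
    qed
    then show ?thesis using ftc[of "- K" s] K ends by simp
  qed
qed

text \<open>
  Integration by parts for a primitive that need not be differentiable everywhere: exchange the order of integration and
  apply the fundamental theorem to the test function instead.
\<close>

lemma primitive_weak_deriv:
  assumes h: "square_integrable h" and "test_function \<phi>"
  shows "(LINT x|lborel. primitive h x * deriv \<phi> x) = - (LINT x|lborel. h x * \<phi> x)"
proof -
  obtain R where "R > 0" and R: "\<And>x. \<bar>x\<bar> > R \<Longrightarrow> \<phi> x = 0" "\<And>x. \<bar>x\<bar> > R \<Longrightarrow> deriv \<phi> x = 0"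
    and \<phi>: "smooth \<phi>"
    using test_functionD[OF assms(2)] by metis
  have [measurable]: "h \<in> borel_measurable borel" using h by (simp add: square_integrable_def)
  have cont: "continuous_on UNIV (deriv \<phi>)" by (rule smooth_deriv(3)[OF smooth_deriv(1)[OF \<phi>]])
  have [measurable]: "deriv \<phi> \<in> borel_measurable borel" by (rule borel_measurable_continuous_onI[OF cont])
  have i1: "integrable lborel (\<lambda>x. 1 * deriv \<phi> x)"
    by (rule locally_integrable_mult_compact_support[OF locally_integrable_continuous cont R(2)]) auto
  have i2: "integrable lborel (\<lambda>s. h s * indicator {-R..R} s)"
    by (rule square_integrable_on_finite_measure[OF h _ emeasure_bounded_finite]) auto
  have i: "integrable (lborel \<Otimes>\<^sub>M lborel) (\<lambda>(x, s). step_kernel x s * h s * deriv \<phi> x)"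
  proof (rule Bochner_Integration.integrable_bound[OF integrable_product_lborel[OF i1 i2]])
    show "(\<lambda>(x, s). step_kernel x s * h s * deriv \<phi> x) \<in> borel_measurable (lborel \<Otimes>\<^sub>M lborel)"
      unfolding step_kernel_def by measurable
    have "\<bar>step_kernel x s * h s * deriv \<phi> x\<bar> \<le> \<bar>1 * deriv \<phi> x * (h s * indicator {-R..R} s)\<bar>" for x s
    proof (cases "\<bar>x\<bar> > R")
      case False
      then have "\<bar>step_kernel x s\<bar> \<le> indicator {-R..R} s"
        by (auto simp: step_kernel_def split: split_indicator)
      then have "\<bar>step_kernel x s\<bar> * (\<bar>h s\<bar> * \<bar>deriv \<phi> x\<bar>) \<le> indicator {-R..R} s * (\<bar>h s\<bar> * \<bar>deriv \<phi> x\<bar>)"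
        by (intro mult_right_mono) auto
      then show ?thesis by (simp add: abs_mult mult_ac)
    qed (simp add: R(2))
    then show "AE z in lborel \<Otimes>\<^sub>M lborel. norm (case z of (x, s) \<Rightarrow> step_kernel x s * h s * deriv \<phi> x)
        \<le> norm (case z of (x, s) \<Rightarrow> 1 * deriv \<phi> x * (h s * indicator {-R..R} s))"
      by (intro AE_I2) (simp add: case_prod_beta del: mult_1)
  qed
  have "(LINT x|lborel. primitive h x * deriv \<phi> x) = (LINT x|lborel. LINT s|lborel. step_kernel x s * h s * deriv \<phi> x)"
    unfolding primitive_def by simp
  also have "\<dots> = (LINT s|lborel. LINT x|lborel. step_kernel x s * h s * deriv \<phi> x)"
    by (rule lborel_pair.Fubini_integral[OF i, symmetric])
  also have "\<dots> = (LINT s|lborel. h s * (LINT x|lborel. step_kernel x s * deriv \<phi> x))"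
    by (subst Bochner_Integration.integral_mult_right_zero[symmetric]) (simp add: mult_ac)
  also have "\<dots> = - (LINT x|lborel. h x * \<phi> x)"
    by (simp add: integral_step_kernel_deriv[OF \<phi> R])
  finally show ?thesis .
qed

text \<open>
  The antiderivative of a test function is constant to the left and to the right of its support; both constants agree
  because the mean vanishes.
\<close>

lemma test_function_zero_mean_is_deriv:
  assumes "test_function u" "(LINT x|lborel. u x) = 0"
  obtains \<phi> where "test_function \<phi>" "deriv \<phi> = u"
proof -
  obtain R where "R > 0" and R: "\<And>x. \<bar>x\<bar> > R \<Longrightarrow> u x = 0" and u: "smooth u"
    using test_functionD[OF assms(1)] by metis
  have cont: "continuous_on UNIV u" by (rule smooth_deriv(3)[OF u])
  obtain G where G: "\<And>x. (G has_real_derivative u x) (at x)"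
    using antiderivative_banach[OF cont] unfolding has_real_derivative_iff_has_vector_derivative by auto
  have ftc: "(LINT x|lborel. u x * indicator {a..b} x) = G b - G a" if "a \<le> b" for a b
    using that G cont by (intro integral_FTC_Icc_real) (auto simp: continuous_on_eq_continuous_at)
  have zero: "G x = G (- R - 1)" if "\<bar>x\<bar> > R" for x
  proof (cases "x > R")
    case True
    have "u z * indicator {- R - 1..x} z = u z" for z
      using R[of z] True by (auto split: split_indicator)
    then have "(LINT z|lborel. u z * indicator {- R - 1..x} z) = 0"
      using assms(2) by (simp only:)
    then show ?thesis using ftc[of "- R - 1" x] True \<open>R > 0\<close> by simp
  next
    case False
    have "u z * indicator {min x (- R - 1)..max x (- R - 1)} z = 0" for z
      using R[of z] that False by (auto split: split_indicator)
    then have "(LINT z|lborel. u z * indicator {min x (- R - 1)..max x (- R - 1)} z) = 0"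
      by (simp only: Bochner_Integration.integral_zero)
    then have "G (max x (- R - 1)) - G (min x (- R - 1)) = 0"
      using ftc[of "min x (- R - 1)" "max x (- R - 1)"] by (simp del: mult_eq_0_iff)
    then show ?thesis by (auto simp: max_def min_def split: if_splits)
  qed
  have d: "((\<lambda>x. G x - G (- R - 1)) has_real_derivative u x) (at x)" for x
    using DERIV_diff[OF G DERIV_const] by simp
  show thesis
  proof (rule that)
    show "test_function (\<lambda>x. G x - G (- R - 1))"
    proof (rule test_functionI[OF smooth_antiderivative[OF d u], of "- R" R])
      fix x assume "x \<notin> {- R..R}"
      then have "\<bar>x\<bar> > R" unfolding atLeastAtMost_iff by linarith
      from zero[OF this] show "G x - G (- R - 1) = 0" by (simp only: diff_self)
    qed
    show "deriv (\<lambda>x. G x - G (- R - 1)) = u" by (intro ext DERIV_imp_deriv d)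
  qed
qed

text \<open>
  Subtracting a multiple of a fixed bump turns an arbitrary test function into one with vanishing mean, that is, into a
  derivative. Thus \<open>D\<close> integrates every test function like a constant.
\<close>

lemma AE_const_if_weak_deriv_zero:
  assumes D: "locally_integrable D" and zero: "\<And>\<phi>. test_function \<phi> \<Longrightarrow> (LINT x|lborel. D x * deriv \<phi> x) = 0"
  shows "\<exists>c. AE x in lborel. D x = c"
proof -
  \<comment> \<open>Any test function with nonzero mean would do.\<close>
  define \<rho> where "\<rho> = plateau 0 1 1"
  have \<rho>: "test_function \<rho>" unfolding \<rho>_def by (rule test_function_plateau)
  have one: "locally_integrable (\<lambda>_. 1)" by (rule locally_integrable_continuous) simp
  have int: "integrable lborel \<psi>" if "test_function \<psi>" for \<psi>
    using locally_integrable_mult_test(1)[OF one that] by simp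
  have "(LINT x|lborel. \<rho> x) \<noteq> 0"
  proof
    assume "(LINT x|lborel. \<rho> x) = 0"
    then have "AE x in lborel. \<rho> x = 0"
      using integral_nonneg_eq_0_iff_AE[OF int[OF \<rho>]] plateau_bounds(1) by (simp add: \<rho>_def)
    then have "AE x in lborel. x \<notin> {0<..<1::real}"
      by eventually_elim (use plateau_pos[of _ 0 1 1] in \<open>force simp: \<rho>_def\<close>)
    then have "{0<..<1::real} \<in> null_sets lborel" by (subst AE_iff_null_sets) auto
    then show False by (simp add: null_sets_def)
  qed
  define r where "r = (LINT x|lborel. \<rho> x)"
  define c where "c = (LINT x|lborel. D x * \<rho> x) / r"
  have r: "r \<noteq> 0" unfolding r_def by fact
  have "AE x in lborel. D x - c = 0"
  proof (rule AE_zero_if_test_zero)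
    have lc: "locally_integrable (\<lambda>x. D x - c)"
      by (intro locally_integrable_diff D locally_integrable_continuous) simp
    then show "integrable lborel (\<lambda>x. (D x - c) * indicator {- real N<..<real N} x)" for N
      by (simp add: locally_integrable_def)
    fix \<psi> assume \<psi>: "test_function \<psi>"
    define I where "I = (LINT x|lborel. \<psi> x)"
    define u where "u x = \<psi> x - I / r * \<rho> x" for x
    obtain R1 R2 where R12: "\<And>x. \<bar>x\<bar> > R1 \<Longrightarrow> \<psi> x = 0" "\<And>x. \<bar>x\<bar> > R2 \<Longrightarrow> \<rho> x = 0"
      using test_functionD[OF \<psi>] test_functionD[OF \<rho>] by metis
    have supp: "u x = 0" if "x \<notin> {- max R1 R2..max R1 R2}" for x
    proof -
      have "\<bar>x\<bar> > max R1 R2" using that unfolding atLeastAtMost_iff by linarith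
      then show ?thesis using R12[of x] by (simp add: u_def)
    qed
    have smooths: "smooth \<psi>" "smooth \<rho>" using \<psi> \<rho> by (simp_all add: test_function_def smooth_def)
    have "smooth u" unfolding u_def[abs_def] by (rule smooth_diff_scale[OF smooths])
    then have tu: "test_function u" by (rule test_functionI) (rule supp)
    have "(LINT x|lborel. u x) = 0"
      unfolding u_def using int[OF \<psi>] int[OF \<rho>] r by (simp add: I_def r_def)
    then obtain \<phi> where "test_function \<phi>" "deriv \<phi> = u"
      using test_function_zero_mean_is_deriv[OF tu] by metis
    then have "0 = (LINT x|lborel. D x * u x)" using zero by metis
    also have "\<dots> = (LINT x|lborel. D x * \<psi> x - I / r * (D x * \<rho> x))"
      by (simp add: u_def algebra_simps)
    also have "\<dots> = (LINT x|lborel. D x * \<psi> x) - I / r * (LINT x|lborel. D x * \<rho> x)"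
      using locally_integrable_mult_test(1)[OF D] \<psi> \<rho> by simp
    finally have "(LINT x|lborel. D x * \<psi> x) = c * I" by (simp add: c_def)
    moreover have "(LINT x|lborel. (D x - c) * \<psi> x) = (LINT x|lborel. D x * \<psi> x) - c * I"
      unfolding left_diff_distrib I_def
      using locally_integrable_mult_test(1)[OF D \<psi>] int[OF \<psi>] by simp
    ultimately show "(LINT x|lborel. (D x - c) * \<psi> x) = 0" by simp
  qed
  then show ?thesis by auto
qed

text \<open>
  The primitive of \<open>h\<close> has the weak derivative \<open>h\<close>, so \<open>f\<close> differs from it by a
  function with weak derivative zero.
\<close>

theorem weak_deriv_primitive:
  assumes f: "square_integrable f" and h: "square_integrable h"
    and weak: "\<And>\<phi>. test_function \<phi> \<Longrightarrow> (LINT x|lborel. f x * deriv \<phi> x) = - (LINT x|lborel. h x * \<phi> x)"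
  shows "\<exists>c. AE x in lborel. f x = c + primitive h x"
proof -
  note lf = locally_integrable_square_integrable[OF f]
  note lh = locally_integrable_continuous[OF continuous_primitive[OF h]]
  have "(LINT x|lborel. (f x - primitive h x) * deriv \<phi> x) = 0" if "test_function \<phi>" for \<phi>
    unfolding left_diff_distrib
    using locally_integrable_mult_test(2)[OF lf that] locally_integrable_mult_test(2)[OF lh that]
      weak[OF that] primitive_weak_deriv[OF h that] by simp
  from AE_const_if_weak_deriv_zero[OF locally_integrable_diff[OF lf lh] this]
  obtain c where "AE x in lborel. f x - primitive h x = c" by blast
  then have "AE x in lborel. f x = c + primitive h x" by eventually_elim simp
  then show ?thesis by blast
qed

section \<open>Classical derivatives of Sobolev functions\<close>

text \<open>
  A nonempty open set is not a null set.
\<close>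

lemma AE_lborel_eq_imp_eq:
  fixes f u :: "real \<Rightarrow> real"
  assumes "continuous_on UNIV f" "continuous_on UNIV u" "AE x in lborel. f x = u x"
  shows "f = u"
proof (rule ccontr)
  assume "f \<noteq> u"
  then obtain x where x: "f x \<noteq> u x" by auto
  have "open {x. f x \<noteq> u x}" using assms(1,2) by (rule open_Collect_neq)
  with x obtain e where e: "e > 0" "\<And>y. \<bar>y - x\<bar> < e \<Longrightarrow> f y \<noteq> u y"
    unfolding open_dist dist_real_def by blast
  have "AE y in lborel. y \<notin> {x - e<..<x + e}"
    using assms(3) by eventually_elim (use e(2) in \<open>force simp: abs_less_iff\<close>)
  then have "{x - e<..<x + e} \<in> null_sets lborel" by (subst AE_iff_null_sets) auto
  then show False using e(1) by (simp add: null_sets_def)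
qed

lemma primitive_has_derivative:
  assumes h: "square_integrable h" and D: "continuous_on UNIV D" and eq: "AE x in lborel. h x = D x"
  shows "(primitive h has_real_derivative D x) (at x)"
proof -
  obtain G where G: "\<And>x. (G has_real_derivative D x) (at x)"
    using antiderivative_banach[OF D] unfolding has_real_derivative_iff_has_vector_derivative by auto
  have [measurable]: "h \<in> borel_measurable borel" using h by (simp add: square_integrable_def)
  have [measurable]: "D \<in> borel_measurable borel" by (rule borel_measurable_continuous_onI[OF D])
  have diff: "primitive h y - primitive h x = G y - G x" if "x \<le> y" for x y
  proof -
    have "primitive h y - primitive h x = (LINT s|lborel. h s * indicator {x<..y} s)"
      by (rule primitive_diff[OF h that])
    also have "\<dots> = (LINT s|lborel. D s * indicator {x..y} s)"
    proof (rule integral_cong_AE)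
      show "AE s in lborel. h s * indicator {x<..y} s = D s * indicator {x..y} s"
        using AE_lborel_singleton[of x] eq by eventually_elim (auto split: split_indicator)
    qed measurable
    also have "\<dots> = G y - G x"
      using that G D by (intro integral_FTC_Icc_real) (auto simp: continuous_on_eq_continuous_at)
    finally show ?thesis .
  qed
  have "primitive h = (\<lambda>x. G x + (primitive h 0 - G 0))"
  proof
    fix x show "primitive h x = G x + (primitive h 0 - G 0)"
      using diff[of 0 x] diff[of x 0] by (cases "0 \<le> x") auto
  qed
  then show ?thesis using DERIV_add[OF G[of x] DERIV_const[of "primitive h 0 - G 0"]] by simp
qed

lemma test_function_deriv:
  assumes "test_function \<phi>" shows "test_function (deriv \<phi>)"
proof -
  obtain R where "\<And>x. \<bar>x\<bar> > R \<Longrightarrow> deriv \<phi> x = 0" "smooth \<phi>"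
    using test_functionD[OF assms] by metis
  then show ?thesis
    by (intro test_functionI[OF smooth_deriv(1), of \<phi> "- R" R]) auto
qed

text \<open>
  Weak derivatives of different orders are defined independently of each other from \<open>f\<close>; testing with
  \<open>deriv \<phi>\<close> shows that each is the weak derivative of the preceding one.
\<close>

lemma has_weak_deriv_step:
  assumes "has_weak_deriv k f h" "has_weak_deriv (Suc k) f h'" "test_function \<phi>"
  shows "(LINT x|lborel. h x * deriv \<phi> x) = - (LINT x|lborel. h' x * \<phi> x)"
proof -
  have "(-1) ^ k * (LINT x|lborel. h x * deriv \<phi> x) = (LINT x|lborel. f x * (deriv ^^ k) (deriv \<phi>) x)"
    using assms(1) test_function_deriv[OF assms(3)] by (simp add: has_weak_deriv_def)
  also have "\<dots> = (LINT x|lborel. f x * (deriv ^^ Suc k) \<phi> x)"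
    by (simp add: funpow_swap1)
  also have "\<dots> = (-1) ^ Suc k * (LINT x|lborel. h' x * \<phi> x)"
    using assms(2,3) unfolding has_weak_deriv_def by blast
  finally have "(-1) ^ k * (LINT x|lborel. h x * deriv \<phi> x) = (-1) ^ k * - (LINT x|lborel. h' x * \<phi> x)"
    by simp
  then show ?thesis by (rule mult_left_cancel[THEN iffD1, rotated]) simp
qed

lemma weak_deriv_spec:
  assumes "f \<in> sobolev_space s" "k \<le> s"
  shows "square_integrable (weak_deriv k f) \<and> has_weak_deriv k f (weak_deriv k f)"
proof -
  have "\<exists>h. square_integrable h \<and> has_weak_deriv k f h"
    using assms by (simp add: sobolev_space_def)
  from someI_ex[OF this] show ?thesis by (simp add: weak_deriv_def)
qed

text \<open>
  Each weak derivative \<open>h\<^sub>k\<close> with \<open>k < s\<close> agrees almost everywhere with a primitive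
  \<open>D\<^sub>k\<close> of \<open>h\<^sub>k\<^sub>+\<^sub>1\<close>, which is continuous. As
  \<open>h\<^sub>k\<^sub>+\<^sub>1\<close> in turn agrees with the continuous \<open>D\<^sub>k\<^sub>+\<^sub>1\<close>,
  the function \<open>D\<^sub>k\<close> is differentiable with derivative \<open>D\<^sub>k\<^sub>+\<^sub>1\<close>; and
  \<open>D\<^sub>0 = f\<close> because both are continuous.
\<close>

theorem sobolev_classical_derivatives:
  assumes f: "f \<in> sobolev_space s" "continuous_on UNIV f" and "k < s"
  shows "continuous_on UNIV ((deriv ^^ k) f)"
    and "AE x in lborel. (deriv ^^ k) f x = weak_deriv k f x"
    and "Suc k < s \<Longrightarrow> ((deriv ^^ k) f has_real_derivative (deriv ^^ Suc k) f x) (at x)"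
proof -
  define h where "h k = weak_deriv k f" for k
  have h: "square_integrable (h k) \<and> has_weak_deriv k f (h k)" if "k \<le> s" for k
    unfolding h_def by (rule weak_deriv_spec[OF f(1) that])
  have "\<exists>c. AE x in lborel. h k x = c + primitive (h (Suc k)) x" if "k < s" for k
  proof (rule weak_deriv_primitive)
    have "k \<le> s" "Suc k \<le> s" using that by auto
    note hk = h[OF this(1)] h[OF this(2)]
    show "square_integrable (h k)" "square_integrable (h (Suc k))" using hk by blast+
    show "(LINT x|lborel. h k x * deriv \<phi> x) = - (LINT x|lborel. h (Suc k) x * \<phi> x)"
      if "test_function \<phi>" for \<phi>
      by (rule has_weak_deriv_step[OF conjunct2[OF hk(1)] conjunct2[OF hk(2)] that])
  qed
  then have "\<forall>k. \<exists>c. k < s \<longrightarrow> (AE x in lborel. h k x = c + primitive (h (Suc k)) x)" by blast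
  from choice[OF this] obtain c where
    c: "\<And>k. k < s \<Longrightarrow> AE x in lborel. h k x = c k + primitive (h (Suc k)) x"
    by blast
  define D where "D k x = c k + primitive (h (Suc k)) x" for k x
  have contD: "continuous_on UNIV (D k)" if "k < s" for k
    unfolding D_def[abs_def] using h[of "Suc k"] that
    by (intro continuous_intros continuous_primitive) auto
  have AE_D: "AE x in lborel. h k x = D k x" if "k < s" for k
    using c[OF that] by (simp add: D_def)
  have D_deriv: "(D k has_real_derivative D (Suc k) x) (at x)" if "Suc k < s" for k x
    unfolding D_def[of k, abs_def] using h[of "Suc k"] that
      DERIV_add[OF DERIV_const primitive_has_derivative[OF _ contD[OF that] AE_D[OF that]]]
    by simp
  have "AE x in lborel. f x - h 0 x = 0"
  proof (rule AE_zero_if_test_zero)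
    have sf: "square_integrable f" using f by (simp add: sobolev_space_def)
    have h0: "square_integrable (h 0)" "has_weak_deriv 0 f (h 0)" using h[of 0] by auto
    note l = locally_integrable_square_integrable[OF sf] locally_integrable_square_integrable[OF h0(1)]
    show "integrable lborel (\<lambda>x. (f x - h 0 x) * indicator {- real N<..<real N} x)" for N
      using locally_integrable_diff[OF l] by (simp add: locally_integrable_def)
    show "(LINT x|lborel. (f x - h 0 x) * \<phi> x) = 0" if "test_function \<phi>" for \<phi>
      using h0(2) that locally_integrable_mult_test(1)[OF l(1) that] locally_integrable_mult_test(1)[OF l(2) that]
      by (simp add: has_weak_deriv_def left_diff_distrib)
  qed
  moreover have "0 < s" using \<open>k < s\<close> by simp
  ultimately have "AE x in lborel. f x = D 0 x"
    using AE_D[of 0] by auto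
  then have "f = D 0" by (intro AE_lborel_eq_imp_eq f contD \<open>0 < s\<close>)
  then have D_eq: "(deriv ^^ k) f = D k" if "k < s" for k
    using that
  proof (induction k)
    case (Suc k)
    then have "(deriv ^^ Suc k) f = deriv (D k)" by simp
    also have "\<dots> = D (Suc k)" using D_deriv[OF Suc.prems(2)] by (intro ext DERIV_imp_deriv)
    finally show ?case .
  qed simp
  show "continuous_on UNIV ((deriv ^^ k) f)" using contD D_eq \<open>k < s\<close> by simp
  show "AE x in lborel. (deriv ^^ k) f x = weak_deriv k f x"
    using AE_D[OF \<open>k < s\<close>] unfolding D_eq[OF \<open>k < s\<close>] h_def by eventually_elim simp
  show "((deriv ^^ k) f has_real_derivative (deriv ^^ Suc k) f x) (at x)" if "Suc k < s"
    using D_deriv[OF that] by (simp only: D_eq[OF \<open>k < s\<close>] D_eq[OF that])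
qed

corollary sobolev_deriv_L2:
  assumes f: "f \<in> sobolev_space s" "continuous_on UNIV f" and "k < s"
  shows "integrable lborel (\<lambda>x. ((deriv ^^ k) f x)\<^sup>2)"
    and "(LINT x|lborel. ((deriv ^^ k) f x)\<^sup>2) \<le> (sobolev_norm s f)\<^sup>2"
proof -
  have h: "square_integrable (weak_deriv j f)" if "j \<le> s" for j
    using weak_deriv_spec[OF f(1) that] by blast
  have [measurable]: "weak_deriv k f \<in> borel_measurable borel" and i: "integrable lborel (\<lambda>x. (weak_deriv k f x)\<^sup>2)"
    using h[of k] \<open>k < s\<close> by (auto simp: square_integrable_def)
  have [measurable]: "(deriv ^^ k) f \<in> borel_measurable borel"
    by (rule borel_measurable_continuous_onI[OF sobolev_classical_derivatives(1)[OF assms]])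
  have ae: "AE x in lborel. ((deriv ^^ k) f x)\<^sup>2 = (weak_deriv k f x)\<^sup>2"
    using sobolev_classical_derivatives(2)[OF assms] by eventually_elim simp
  show "integrable lborel (\<lambda>x. ((deriv ^^ k) f x)\<^sup>2)"
    by (subst integrable_cong_AE[OF _ _ ae]) (use i in auto)
  have "(LINT x|lborel. ((deriv ^^ k) f x)\<^sup>2) = (LINT x|lborel. (weak_deriv k f x)\<^sup>2)"
    by (rule integral_cong_AE[OF _ _ ae]) auto
  also have "\<dots> \<le> (\<Sum>j\<le>s. LINT x|lborel. (weak_deriv j f x)\<^sup>2)"
    using \<open>k < s\<close> by (intro member_le_sum) auto
  also have "\<dots> = (sobolev_norm s f)\<^sup>2"
    unfolding sobolev_norm_def by (simp add: sum_nonneg)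
  finally show "(LINT x|lborel. ((deriv ^^ k) f x)\<^sup>2) \<le> (sobolev_norm s f)\<^sup>2" .
qed

section \<open>Sampling functions with square-integrable derivatives\<close>

text \<open>
  Here \<open>d k\<close> plays the role of the \<open>k\<close>-th derivative of the wave at a fixed time. The three
  requirements are the information extracted from \<open>W \<in> C(I, H\<^sup>6)\<close>: square-integrable derivatives
  up to the fifth with a common bound, and a lower bound on the wave itself.
\<close>

definition profile :: "real \<Rightarrow> real \<Rightarrow> (nat \<Rightarrow> real \<Rightarrow> real) \<Rightarrow> bool" where
  "profile B r d \<longleftrightarrow>
     (\<forall>k\<le>5. continuous_on UNIV (d k) \<and> integrable lborel (\<lambda>x. (d k x)\<^sup>2) \<and> (LINT x|lborel. (d k x)\<^sup>2) \<le> B) \<and>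
     (\<forall>k<5. \<forall>x. (d k has_real_derivative d (Suc k) x) (at x)) \<and> (\<forall>x. r \<le> d 0 x)"

lemma profileD:
  assumes "profile B r d"
  shows "k \<le> 5 \<Longrightarrow> continuous_on UNIV (d k)" "k \<le> 5 \<Longrightarrow> integrable lborel (\<lambda>x. (d k x)\<^sup>2)"
    "k \<le> 5 \<Longrightarrow> (LINT x|lborel. (d k x)\<^sup>2) \<le> B"
    "k < 5 \<Longrightarrow> (d k has_real_derivative d (Suc k) x) (at x)" "r \<le> d 0 x"
  using assms by (auto simp: profile_def)

text \<open>
  The local size of the profile in the lattice cell of length \<open>\<epsilon>\<close> around \<open>x\<close>. All
  errors below are bounded pointwise by powers of \<open>\<epsilon>\<close> times this quantity, and
  \<open>sum_mass_le\<close> then sums them over the lattice.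
\<close>

definition mass :: "(nat \<Rightarrow> real \<Rightarrow> real) \<Rightarrow> real \<Rightarrow> real \<Rightarrow> real" where
  "mass d \<epsilon> x = (LINT y|lborel. (\<Sum>k\<le>5. (d k y)\<^sup>2) * indicator {x - \<epsilon> / 2<..x + \<epsilon> / 2} y)"

lemma profile_mass:
  assumes p: "profile B r d"
  shows "integrable lborel (\<lambda>y. \<Sum>k\<le>5. (d k y)\<^sup>2)" "(LINT y|lborel. (\<Sum>k\<le>5. (d k y)\<^sup>2)) \<le> 6 * B"
    "integrable lborel (\<lambda>y. (\<Sum>k\<le>5. (d k y)\<^sup>2) * indicator {a<..b} y)"
proof -
  show i: "integrable lborel (\<lambda>y. \<Sum>k\<le>5. (d k y)\<^sup>2)"
    by (intro Bochner_Integration.integrable_sum profileD[OF p]) auto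
  have "(LINT y|lborel. (\<Sum>k\<le>5. (d k y)\<^sup>2)) = (\<Sum>k\<le>5. LINT y|lborel. (d k y)\<^sup>2)"
    by (intro Bochner_Integration.integral_sum profileD[OF p]) auto
  also have "\<dots> \<le> (\<Sum>k\<le>(5::nat). B)"
    by (intro sum_mono profileD[OF p]) auto
  finally show "(LINT y|lborel. (\<Sum>k\<le>5. (d k y)\<^sup>2)) \<le> 6 * B" by simp
  show "integrable lborel (\<lambda>y. (\<Sum>k\<le>5. (d k y)\<^sup>2) * indicator {a<..b} y)"
    by (intro integrable_real_mult_indicator i) auto
qed

lemma mass_nonneg: "0 \<le> mass d \<epsilon> x"
  unfolding mass_def by (intro integral_nonneg_AE AE_I2 mult_nonneg_nonneg sum_nonneg) auto

lemma le_mass: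
  assumes p: "profile B r d" and sub: "x - \<epsilon> / 2 \<le> a" "b \<le> x + \<epsilon> / 2"
    and q: "integrable lborel (\<lambda>y. q y * indicator {a<..b} y)" "\<And>y. q y \<le> (\<Sum>k\<le>5. (d k y)\<^sup>2)"
  shows "(LINT y|lborel. q y * indicator {a<..b} y) \<le> mass d \<epsilon> x"
  unfolding mass_def
proof (rule integral_mono[OF q(1) profile_mass(3)[OF p]])
  fix y
  have "0 \<le> (\<Sum>k\<le>5. (d k y)\<^sup>2)" by (intro sum_nonneg) auto
  then show "q y * indicator {a<..b} y \<le> (\<Sum>k\<le>5. (d k y)\<^sup>2) * indicator {x - \<epsilon> / 2<..x + \<epsilon> / 2} y"
    using q(2)[of y] sub by (auto split: split_indicator)
qed

lemma integral_Ioc_deriv: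
  assumes "a \<le> b" and d: "\<And>x. (f has_real_derivative f' x) (at x)" and c: "continuous_on UNIV f'"
  shows "(LINT x|lborel. f' x * indicator {a<..b} x) = f b - f a"
    "integrable lborel (\<lambda>x. f' x * indicator {a<..b} x)"
proof -
  have [measurable]: "f' \<in> borel_measurable borel" by (rule borel_measurable_continuous_onI[OF c])
  have ae: "AE x in lborel. f' x * indicator {a<..b} x = f' x * indicator {a..b} x"
    using AE_lborel_singleton[of a] by eventually_elim (auto split: split_indicator)
  have "(LINT x|lborel. f' x * indicator {a<..b} x) = (LINT x|lborel. f' x * indicator {a..b} x)"
    by (rule integral_cong_AE[OF _ _ ae]) measurable
  also have "\<dots> = f b - f a"
    using assms by (intro integral_FTC_Icc_real) (auto simp: continuous_on_eq_continuous_at)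
  finally show "(LINT x|lborel. f' x * indicator {a<..b} x) = f b - f a" .
  have "integrable lborel (\<lambda>x. indicator {a..b} x *\<^sub>R f' x)"
    by (intro borel_integrable_compact compact_Icc continuous_on_subset[OF c]) simp
  then show "integrable lborel (\<lambda>x. f' x * indicator {a<..b} x)"
    by (subst integrable_cong_AE[OF _ _ ae]) (simp_all add: mult.commute)
qed

text \<open>
  The fundamental theorem of calculus and the Cauchy-Schwarz inequality.
\<close>

lemma increment_square_le:
  assumes "a \<le> b" and d: "\<And>x. (f has_real_derivative f' x) (at x)" and c: "continuous_on UNIV f'"
  shows "(f b - f a)\<^sup>2 \<le> (b - a) * (LINT x|lborel. (f' x)\<^sup>2 * indicator {a<..b} x)"
proof (cases "a = b")
  case False
  with \<open>a \<le> b\<close> have "a < b" by simp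
  have "continuous_on UNIV (\<lambda>x. (f' x)\<^sup>2)" by (intro continuous_intros c)
  then obtain G where "\<And>x. (G has_real_derivative (f' x)\<^sup>2) (at x)" "continuous_on UNIV (\<lambda>x. (f' x)\<^sup>2)"
    using antiderivative_banach unfolding has_real_derivative_iff_has_vector_derivative by blast
  from integral_Ioc_deriv(2)[OF \<open>a \<le> b\<close> this] integral_Ioc_deriv[OF assms]
    Cauchy_Schwarz_set_integral[of f' "{a<..b}"] emeasure_lborel_Ioc_finite[of a b] \<open>a < b\<close>
  show ?thesis by simp
qed simp

lemma profile_increment:
  assumes p: "profile B r d" and k: "k < 5" and "x - \<epsilon> / 2 \<le> a" "a \<le> b" "b \<le> x + \<epsilon> / 2"
  shows "(d k b - d k a)\<^sup>2 \<le> (b - a) * mass d \<epsilon> x"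
proof -
  have "(d k b - d k a)\<^sup>2 \<le> (b - a) * (LINT x|lborel. (d (Suc k) x)\<^sup>2 * indicator {a<..b} x)"
    using k by (intro increment_square_le \<open>a \<le> b\<close> profileD[OF p]) auto
  also have "\<dots> \<le> (b - a) * mass d \<epsilon> x"
  proof (intro mult_left_mono le_mass[OF p])
    show "integrable lborel (\<lambda>y. (d (Suc k) y)\<^sup>2 * indicator {a<..b} y)"
      using k by (intro integrable_real_mult_indicator profileD(2)[OF p]) auto
    show "(d (Suc k) y)\<^sup>2 \<le> (\<Sum>k\<le>5. (d k y)\<^sup>2)" for y
      using k by (intro member_le_sum) auto
  qed (use assms in auto)
  finally show ?thesis .
qed

text \<open>
  The value at \<open>x\<close> exceeds the value at any other point of the cell by at most the integral of \<open>2 f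
  f'\<close>; averaging over the cell gives the factor \<open>1 / \<epsilon>\<close>, the price of sampling.
\<close>

lemma profile_sample:
  assumes p: "profile B r d" and k: "k < 5" and \<epsilon>: "0 < \<epsilon>" "\<epsilon> \<le> 1"
  shows "(d k x)\<^sup>2 \<le> 2 / \<epsilon> * mass d \<epsilon> x"
proof -
  define a b where "a = x - \<epsilon> / 2" and "b = x + \<epsilon> / 2"
  define K where "K = mass d \<epsilon> x"
  have ab: "a \<le> b" "b - a = \<epsilon>" "a \<le> x" "x \<le> b" using \<epsilon> by (auto simp: a_def b_def)
  have cont: "continuous_on UNIV (\<lambda>y. 2 * d k y * d (Suc k) y)"
    using k by (intro continuous_intros profileD(1)[OF p]) auto
  have der: "((\<lambda>y. (d k y)\<^sup>2) has_real_derivative 2 * d k y * d (Suc k) y) (at y)" for y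
    using DERIV_power[OF profileD(4)[OF p k, of y], of 2] by (simp add: mult_ac)
  have le: "2 * d k y * d (Suc k) y \<le> (\<Sum>k\<le>5. (d k y)\<^sup>2)" "- (2 * d k y * d (Suc k) y) \<le> (\<Sum>k\<le>5. (d k y)\<^sup>2)"
    "(d k y)\<^sup>2 \<le> (\<Sum>k\<le>5. (d k y)\<^sup>2)" for y
  proof -
    have "(\<Sum>j\<in>{k, Suc k}. (d j y)\<^sup>2) \<le> (\<Sum>k\<le>5. (d k y)\<^sup>2)"
      using k by (intro sum_mono2) auto
    then have *: "(d k y)\<^sup>2 + (d (Suc k) y)\<^sup>2 \<le> (\<Sum>k\<le>5. (d k y)\<^sup>2)" by simp
    then show "2 * d k y * d (Suc k) y \<le> (\<Sum>k\<le>5. (d k y)\<^sup>2)" "- (2 * d k y * d (Suc k) y) \<le> (\<Sum>k\<le>5. (d k y)\<^sup>2)"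
      using sum_squares_bound[of "d k y" "d (Suc k) y"] sum_squares_bound[of "d k y" "- d (Suc k) y"] by auto
    show "(d k y)\<^sup>2 \<le> (\<Sum>k\<le>5. (d k y)\<^sup>2)"
      using k by (intro member_le_sum) auto
  qed
  have diff: "(d k x)\<^sup>2 \<le> (d k y)\<^sup>2 + K" if "y \<in> {a<..b}" for y
  proof (cases "y \<le> x")
    case True
    have "(d k x)\<^sup>2 - (d k y)\<^sup>2 = (LINT z|lborel. 2 * d k z * d (Suc k) z * indicator {y<..x} z)"
      by (rule integral_Ioc_deriv(1)[OF True der cont, symmetric])
    also have "\<dots> \<le> K" unfolding K_def
      by (rule le_mass[OF p _ _ integral_Ioc_deriv(2)[OF True der cont]]) (use that ab le in \<open>auto simp: a_def b_def\<close>)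
    finally show ?thesis by simp
  next
    case False
    then have "x \<le> y" by simp
    have "(d k x)\<^sup>2 - (d k y)\<^sup>2 = - (LINT z|lborel. 2 * d k z * d (Suc k) z * indicator {x<..y} z)"
      using integral_Ioc_deriv(1)[OF \<open>x \<le> y\<close> der cont] by simp
    also have "\<dots> = (LINT z|lborel. - (2 * d k z * d (Suc k) z) * indicator {x<..y} z)"
      by (simp flip: Bochner_Integration.integral_minus)
    also have "\<dots> \<le> K" unfolding K_def
    proof (rule le_mass[OF p])
      show "integrable lborel (\<lambda>z. - (2 * d k z * d (Suc k) z) * indicator {x<..y} z)"
        using integral_Ioc_deriv(2)[OF \<open>x \<le> y\<close> der cont] by simp
    qed (use that ab le in \<open>auto simp: a_def b_def\<close>)
    finally show ?thesis by simp
  qed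
  have i1: "integrable lborel (\<lambda>y. c * indicator {a<..b} y)" for c :: real
    by (intro integrable_mult_right integrable_real_indicator) (simp_all add: emeasure_lborel_Ioc_finite[simplified])
  have i2: "integrable lborel (\<lambda>y. (d k y)\<^sup>2 * indicator {a<..b} y)"
    using k by (intro integrable_real_mult_indicator profileD(2)[OF p]) auto
  have "\<epsilon> * (d k x)\<^sup>2 = (LINT y|lborel. (d k x)\<^sup>2 * indicator {a<..b} y)"
    using ab by simp
  also have "\<dots> \<le> (LINT y|lborel. (d k y)\<^sup>2 * indicator {a<..b} y + K * indicator {a<..b} y)"
    by (intro integral_mono i1 Bochner_Integration.integrable_add i2) (use diff in \<open>auto split: split_indicator\<close>)
  also have "\<dots> = (LINT y|lborel. (d k y)\<^sup>2 * indicator {a<..b} y) + K * \<epsilon>"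
    using i1[of K] i2 ab by simp
  also have "(LINT y|lborel. (d k y)\<^sup>2 * indicator {a<..b} y) \<le> K" unfolding K_def
    by (rule le_mass[OF p _ _ i2 le(3)]) (auto simp: a_def b_def)
  also have "K + K * \<epsilon> \<le> 2 * K"
    using \<epsilon> mass_nonneg[of d \<epsilon> x] by (simp add: K_def mult_left_le)
  finally show ?thesis using \<epsilon> by (simp add: K_def field_simps)
qed

text \<open>
  The cells around the points of a lattice with spacing \<open>\<epsilon>\<close> are disjoint.
\<close>

lemma sum_mass_le:
  assumes p: "profile B r d" and \<epsilon>: "0 < \<epsilon>" and A: "finite A"
  shows "(\<Sum>n\<in>A. mass d \<epsilon> (\<epsilon> * of_int n + c)) \<le> 6 * B"
proof -
  let ?J = "\<lambda>n::int. {\<epsilon> * of_int n + c - \<epsilon> / 2<..\<epsilon> * of_int n + c + \<epsilon> / 2}"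
  have disj: "m = n" if "y \<in> ?J m" "y \<in> ?J n" for m n y
  proof -
    have "\<bar>\<epsilon> * of_int m - \<epsilon> * of_int n\<bar> < \<epsilon>" using that by auto
    then have "\<epsilon> * \<bar>of_int m - of_int n\<bar> < \<epsilon> * 1"
      using \<epsilon> by (simp add: abs_mult flip: right_diff_distrib)
    then have "\<bar>of_int (m - n)\<bar> < (1::real)" using \<epsilon> by simp
    then show ?thesis by linarith
  qed
  have ind: "(\<Sum>n\<in>A. indicator (?J n) y) \<le> (1::real)" for y
  proof (cases "\<exists>m\<in>A. y \<in> ?J m")
    case True
    then obtain m where m: "m \<in> A" "y \<in> ?J m" by blast
    have "(\<Sum>n\<in>A. indicator (?J n) y) = (\<Sum>n\<in>A. if n = m then 1 else 0 :: real)"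
    proof (rule sum.cong[OF refl])
      fix n show "indicator (?J n) y = (if n = m then 1 else 0 :: real)"
      proof (cases "n = m")
        case True
        then show ?thesis using m(2) by (simp only: indicator_simps if_True refl)
      next
        case False
        then have "y \<notin> ?J n" using disj[OF _ m(2)] by blast
        then show ?thesis using False by (simp only: indicator_simps if_False not_False_eq_True)
      qed
    qed
    also have "\<dots> = 1" using m A by (subst sum.delta) auto
    finally show ?thesis by simp
  next
    case False
    then have "(\<Sum>n\<in>A. indicator (?J n) y :: real) = 0" by (intro sum.neutral) auto
    then show ?thesis by simp
  qed
  have "(\<Sum>n\<in>A. mass d \<epsilon> (\<epsilon> * of_int n + c))
      = (LINT y|lborel. (\<Sum>n\<in>A. (\<Sum>k\<le>5. (d k y)\<^sup>2) * indicator (?J n) y))"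
    unfolding mass_def by (intro Bochner_Integration.integral_sum[symmetric] profile_mass(3)[OF p])
  also have "\<dots> \<le> (LINT y|lborel. (\<Sum>k\<le>5. (d k y)\<^sup>2))"
  proof (intro integral_mono profile_mass[OF p] Bochner_Integration.integrable_sum)
    show "(\<Sum>n\<in>A. (\<Sum>k\<le>5. (d k y)\<^sup>2) * indicator (?J n) y) \<le> (\<Sum>k\<le>5. (d k y)\<^sup>2)" for y
      unfolding sum_distrib_left[symmetric] by (intro mult_left_le ind sum_nonneg) auto
  qed
  also have "\<dots> \<le> 6 * B" by (rule profile_mass(2)[OF p])
  finally show ?thesis .
qed

lemma mass_le:
  assumes p: "profile B r d" shows "mass d \<epsilon> x \<le> 6 * B"
proof (cases "0 < \<epsilon>")
  case True
  then show ?thesis using sum_mass_le[OF p True, of "{0}" x] by simp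
next
  case False
  then have "{x - \<epsilon> / 2<..x + \<epsilon> / 2} = {}" by auto
  then have "mass d \<epsilon> x = 0" unfolding mass_def by simp
  moreover have "0 \<le> (LINT x|lborel. (d 0 x)\<^sup>2)" by simp
  then have "0 \<le> B" using profileD(3)[OF p, of 0] by linarith
  ultimately show ?thesis by simp
qed

text \<open>
  Sampling with cells of length one.
\<close>

lemma profile_sup:
  assumes "profile B r d" "k < 5"
  shows "(d k x)\<^sup>2 \<le> 12 * B"
  using profile_sample[OF assms, of 1 x] mass_le[OF assms(1), of 1 x] by simp

lemma l2_from_mass:
  assumes p: "profile B r d" and \<epsilon>: "0 < \<epsilon>" and "0 \<le> K"
    and a: "\<And>n. (a n)\<^sup>2 \<le> K * mass d \<epsilon> (\<epsilon> * of_int n + c)" and A: "finite A"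
  shows "(\<Sum>n\<in>A. (a n)\<^sup>2) \<le> K * (6 * B)"
proof -
  have "(\<Sum>n\<in>A. (a n)\<^sup>2) \<le> K * (\<Sum>n\<in>A. mass d \<epsilon> (\<epsilon> * of_int n + c))"
    unfolding sum_distrib_left by (intro sum_mono a)
  also have "\<dots> \<le> K * (6 * B)"
    by (intro mult_left_mono sum_mass_le[OF p \<epsilon> A] \<open>0 \<le> K\<close>)
  finally show ?thesis .
qed

section \<open>Centred Taylor remainders\<close>

lemma square_add_le: "(a + b)\<^sup>2 \<le> 2 * a\<^sup>2 + 2 * (b::real)\<^sup>2"
  using sum_squares_bound[of a b] by (simp add: power2_sum)

lemma maclaurin_all_derivatives:
  assumes "0 < h" "0 < n" "\<And>m s. m < n \<Longrightarrow> (q m has_real_derivative q (Suc m) s) (at s)"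
  shows "\<exists>t. 0 < t \<and> t < h \<and> q 0 h = (\<Sum>m<n. q m 0 / fact m * h ^ m) + q n t / fact n * h ^ n"
  by (rule Maclaurin[OF assms(1,2) refl]) (use assms(3) in blast)

lemma profile_shift_deriv:
  assumes p: "profile B r d" and k: "k < 5"
  shows "((\<lambda>s. d k (x + s)) has_real_derivative d (Suc k) (x + s)) (at s)"
    "((\<lambda>s. d k (x - s)) has_real_derivative - d (Suc k) (x - s)) (at s)"
proof -
  have "((\<lambda>s. x + s) has_real_derivative 1) (at s)" "((\<lambda>s. x - s) has_real_derivative - 1) (at s)"
    by (auto intro!: derivative_eq_intros)
  from DERIV_chain2[OF profileD(4)[OF p k] this(1)] DERIV_chain2[OF profileD(4)[OF p k] this(2)]
  show "((\<lambda>s. d k (x + s)) has_real_derivative d (Suc k) (x + s)) (at s)"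
    "((\<lambda>s. d k (x - s)) has_real_derivative - d (Suc k) (x - s)) (at s)" by simp_all
qed

text \<open>
  In the symmetric difference all even derivatives drop out. As a function of the step, the remainder vanishes to fourth
  order with fourth derivative \<open>d 4 (x + s) - d 4 (x - s)\<close>, and this increment is controlled by the square
  integral of \<open>d 5\<close> over the cell. Only square-integrability of the fifth derivative is used, not its size
  at a point.
\<close>

lemma fifth_order_remainder:
  assumes p: "profile B r d" and h: "0 < h"
  shows "(d 0 (x + h) - d 0 (x - h) - 2 * h * d 1 x - h ^ 3 / 3 * d 3 x)\<^sup>2 \<le> h ^ 9 * mass d (2 * h) x"
proof -
  \<comment> \<open>The successive derivatives of the remainder with respect to the step \<open>s\<close>; they all vanish at \<open>s = 0\<close>.\<close>
  define q where "q m s = (if m = 0 then d 0 (x + s) - d 0 (x - s) - 2 * s * d 1 x - s ^ 3 / 3 * d 3 x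
    else if m = 1 then d 1 (x + s) + d 1 (x - s) - 2 * d 1 x - s\<^sup>2 * d 3 x
    else if m = 2 then d 2 (x + s) - d 2 (x - s) - 2 * s * d 3 x
    else if m = 3 then d 3 (x + s) + d 3 (x - s) - 2 * d 3 x
    else d 4 (x + s) - d 4 (x - s))" for m :: nat and s
  have D: "((\<lambda>s. d 0 (x + s)) has_real_derivative d 1 (x + s)) (at s)" "((\<lambda>s. d 0 (x - s)) has_real_derivative - d 1 (x - s)) (at s)"
    "((\<lambda>s. d 1 (x + s)) has_real_derivative d 2 (x + s)) (at s)" "((\<lambda>s. d 1 (x - s)) has_real_derivative - d 2 (x - s)) (at s)"
    "((\<lambda>s. d 2 (x + s)) has_real_derivative d 3 (x + s)) (at s)" "((\<lambda>s. d 2 (x - s)) has_real_derivative - d 3 (x - s)) (at s)"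
    "((\<lambda>s. d 3 (x + s)) has_real_derivative d 4 (x + s)) (at s)" "((\<lambda>s. d 3 (x - s)) has_real_derivative - d 4 (x - s)) (at s)" for s
    using profile_shift_deriv[OF p, of 0 x s] profile_shift_deriv[OF p, of 1 x s]
      profile_shift_deriv[OF p, of 2 x s] profile_shift_deriv[OF p, of 3 x s]
    by (simp_all add: numeral_eq_Suc)
  have "(q m has_real_derivative q (Suc m) s) (at s)" if "m < 4" for m s
  proof -
    have "m = 0 \<or> m = 1 \<or> m = 2 \<or> m = 3" using that by linarith
    then consider "m = 0" | "m = 1" | "m = 2" | "m = 3" by blast
    then show ?thesis
    proof cases
      case 1
      have "((\<lambda>s. 2 * s * d 1 x) has_real_derivative 2 * d 1 x) (at s)"
        "((\<lambda>s. s ^ 3 / 3 * d 3 x) has_real_derivative s\<^sup>2 * d 3 x) (at s)"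
        by (auto intro!: derivative_eq_intros)
      from DERIV_diff[OF DERIV_diff[OF DERIV_diff[OF D(1,2)] this(1)] this(2)]
      show ?thesis using 1 by (simp add: q_def[abs_def])
    next
      case 2
      have "((\<lambda>s. s\<^sup>2 * d 3 x) has_real_derivative 2 * s * d 3 x) (at s)"
        by (auto intro!: derivative_eq_intros)
      from DERIV_diff[OF DERIV_diff[OF DERIV_add[OF D(3,4)] DERIV_const] this]
      show ?thesis using 2 by (simp add: q_def[abs_def] numeral_2_eq_2)
    next
      case 3
      have "((\<lambda>s. 2 * s * d 3 x) has_real_derivative 2 * d 3 x) (at s)"
        by (auto intro!: derivative_eq_intros)
      from DERIV_diff[OF DERIV_diff[OF D(5,6)] this]
      show ?thesis using 3 by (simp add: q_def[abs_def] numeral_eq_Suc)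
    next
      case 4
      from DERIV_diff[OF DERIV_add[OF D(7,8)] DERIV_const]
      show ?thesis using 4 by (simp add: q_def[abs_def] numeral_eq_Suc)
    qed
  qed
  from maclaurin_all_derivatives[where q = q and n = 4, OF h _ this]
  obtain t where t: "0 < t" "t < h" "q 0 h = (\<Sum>m<4. q m 0 / fact m * h ^ m) + q 4 t / fact 4 * h ^ 4"
    by auto
  have "(\<Sum>m<4. q m 0 / fact m * h ^ m) = 0"
    by (simp add: q_def numeral_eq_Suc)
  then have "q 0 h = q 4 t / 24 * h ^ 4"
    using t(3) by (simp add: fact_numeral)
  then have "(q 0 h)\<^sup>2 = (q 4 t / 24 * h ^ 4)\<^sup>2" by (simp only:)
  also have "\<dots> = (q 4 t)\<^sup>2 * (h ^ 8 / 576)"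
    by (simp add: power_mult_distrib power_divide flip: power_mult)
  finally have "(q 0 h)\<^sup>2 = (q 4 t)\<^sup>2 * (h ^ 8 / 576)" .
  also have "\<dots> \<le> (2 * h * mass d (2 * h) x) * (h ^ 8 / 576)"
  proof (intro mult_right_mono)
    have "(d 4 (x + t) - d 4 (x - t))\<^sup>2 \<le> (x + t - (x - t)) * mass d (2 * h) x"
      using t by (intro profile_increment[OF p]) auto
    also have "\<dots> \<le> 2 * h * mass d (2 * h) x"
      using t by (intro mult_right_mono mass_nonneg) auto
    finally show "(q 4 t)\<^sup>2 \<le> 2 * h * mass d (2 * h) x" by (simp add: q_def)
  qed (use h in auto)
  also have "\<dots> = h ^ 9 * mass d (2 * h) x * (1 / 288)"
    by (simp add: power_Suc numeral_eq_Suc)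
  also have "\<dots> \<le> h ^ 9 * mass d (2 * h) x * 1"
    using h by (intro mult_left_mono mult_nonneg_nonneg mass_nonneg) auto
  finally show ?thesis by (simp add: q_def)
qed

text \<open>
  As in \<open>fifth_order_remainder\<close>, with one-sided increments. The power \<open>h ^ 3\<close> is exactly what
  the passage from the half shift to \<open>P\<^sub>\<epsilon>\<close> can afford.
\<close>

lemma second_order_remainder:
  assumes p: "profile B r d" and h: "0 < h"
  shows "(d 0 (x - h) - d 0 x + h * d 1 x)\<^sup>2 \<le> h ^ 3 * mass d (2 * h) x"
proof -
  define q where "q m s = (if m = 0 then d 0 (x - s) - d 0 x + s * d 1 x else d 1 x - d 1 (x - s))" for m :: nat and s
  have "(q 0 has_real_derivative q 1 s) (at s)" for s
  proof -
    have "((\<lambda>s. d 0 (x - s)) has_real_derivative - d 1 (x - s)) (at s)"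
      using profile_shift_deriv(2)[OF p, of 0 x s] by simp
    from DERIV_add[OF DERIV_diff[OF this DERIV_const] DERIV_cmult_right[OF DERIV_ident]]
    show ?thesis by (simp add: q_def[abs_def])
  qed
  then have "(q m has_real_derivative q (Suc m) s) (at s)" if "m < 1" for m s
    using that by simp
  from maclaurin_all_derivatives[where q = q and n = 1, OF h _ this]
  obtain t where t: "0 < t" "t < h" "q 0 h = (\<Sum>m<1. q m 0 / fact m * h ^ m) + q 1 t / fact 1 * h ^ 1"
    by auto
  then have "(q 0 h)\<^sup>2 = (q 1 t)\<^sup>2 * h\<^sup>2"
    by (simp add: q_def power_mult_distrib)
  also have "\<dots> \<le> (h * mass d (2 * h) x) * h\<^sup>2"
  proof (intro mult_right_mono)
    have "(d 1 x - d 1 (x - t))\<^sup>2 \<le> (x - (x - t)) * mass d (2 * h) x"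
      using t by (intro profile_increment[OF p]) auto
    also have "\<dots> \<le> h * mass d (2 * h) x"
      using t by (intro mult_right_mono mass_nonneg) auto
    finally show "(q 1 t)\<^sup>2 \<le> h * mass d (2 * h) x" by (simp add: q_def)
  qed auto
  finally show ?thesis by (simp add: q_def power2_eq_square power3_eq_cube mult_ac)
qed

text \<open>
  A bound on \<open>\<bar>ln (1 + w)\<bar>\<close> and \<open>\<bar>1 + ln (1 + w)\<bar>\<close> for \<open>w\<close> in
  the range of a profile, which is contained in \<open>{r..sqrt (12 * B)}\<close> by \<open>profile_sup\<close>. The
  constants below depend on \<open>B\<close> and \<open>r\<close> alone.
\<close>

definition log_bound :: "real \<Rightarrow> real \<Rightarrow> real" where
  "log_bound B r = 1 + \<bar>ln (1 + r)\<bar> + sqrt (12 * B)"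

lemma log_bound:
  assumes "-1 < r" "r \<le> w" "w \<le> sqrt (12 * B)"
  shows "\<bar>ln (1 + w)\<bar> \<le> log_bound B r" "\<bar>1 + ln (1 + w)\<bar> \<le> log_bound B r"
proof -
  have "ln (1 + w) \<le> w" using assms by (intro ln_add_one_self_le_self2) auto
  moreover have "ln (1 + r) \<le> ln (1 + w)" using assms by simp
  ultimately show "\<bar>ln (1 + w)\<bar> \<le> log_bound B r" "\<bar>1 + ln (1 + w)\<bar> \<le> log_bound B r"
    using assms unfolding log_bound_def by linarith+
qed

lemma profile_range:
  assumes p: "profile B r d" and "k < 5"
  shows "\<bar>d k x\<bar> \<le> sqrt (12 * B)" "0 \<le> B"
proof -
  show "\<bar>d k x\<bar> \<le> sqrt (12 * B)"
    using profile_sup[OF assms] by (intro real_le_rsqrt) simp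
  show "0 \<le> B" using profile_sup[OF assms, of x] zero_le_power2[of "d k x"] by linarith
qed

lemma g_deriv: "-1 < w \<Longrightarrow> (g has_real_derivative 1 + ln (1 + w)) (at w within S)"
  unfolding g_def[abs_def] by (auto intro!: derivative_eq_intros simp: add.commute)

lemma g_lipschitz:
  assumes "-1 < r" "a \<in> {r..sqrt (12 * B)}" "b \<in> {r..sqrt (12 * B)}"
  shows "\<bar>g a - g b\<bar> \<le> log_bound B r * \<bar>a - b\<bar>"
proof -
  have "norm (g a - g b) \<le> log_bound B r * norm (a - b)"
  proof (rule field_differentiable_bound[of "{r..sqrt (12 * B)}"])
    show "(g has_field_derivative 1 + ln (1 + z)) (at z within {r..sqrt (12 * B)})"
      if "z \<in> {r..sqrt (12 * B)}" for z
      using that assms by (intro g_deriv) auto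
    show "norm (1 + ln (1 + z)) \<le> log_bound B r" if "z \<in> {r..sqrt (12 * B)}" for z
      using that log_bound(2)[of r z B] assms by auto
  qed (use assms in auto)
  then show ?thesis by simp
qed

text \<open>
  Expanding \<open>(1 + w) powr (1 + \<epsilon>\<^sup>2) = (1 + w) exp (\<epsilon>\<^sup>2 ln (1 + w))\<close> in
  \<open>\<epsilon>\<^sup>2\<close> gives \<open>V' w = w + \<epsilon>\<^sup>2 g w + O(\<epsilon>\<^sup>4)\<close>; this
  is the last term.
\<close>

definition V'_rest :: "real \<Rightarrow> real \<Rightarrow> real" where
  "V'_rest \<epsilon> w = V' \<epsilon> w - w - \<epsilon>\<^sup>2 * g w"

lemma exp_quadratic_remainder: "\<bar>exp y - 1 - y\<bar> \<le> exp \<bar>y\<bar> * y\<^sup>2" for y :: real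
proof -
  obtain t where t: "\<bar>t\<bar> \<le> \<bar>y\<bar>" "exp y = (\<Sum>m<2. y ^ m / fact m) + exp t / fact 2 * y ^ 2"
    using Maclaurin_exp_le[of y 2] by blast
  then have "exp y - 1 - y = exp t / 2 * y\<^sup>2" by (simp add: numeral_2_eq_2)
  moreover have "exp t \<le> exp \<bar>y\<bar>" using t(1) by simp
  then have "exp t / 2 \<le> exp \<bar>y\<bar>" using exp_gt_zero[of t] by linarith
  then have "exp t / 2 * y\<^sup>2 \<le> exp \<bar>y\<bar> * y\<^sup>2" by (intro mult_right_mono) auto
  moreover have "0 \<le> exp t / 2 * y\<^sup>2" by simp
  ultimately show ?thesis by linarith
qed

definition rest_bound :: "real \<Rightarrow> real \<Rightarrow> real" where
  "rest_bound B r = 2 * exp (log_bound B r) * (log_bound B r)\<^sup>2 + log_bound B r"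

text \<open>
  The derivative of the rest equals \<open>(1 + \<epsilon>\<^sup>2) (exp y - 1 - y) + \<epsilon>\<^sup>4 ln (1 +
  w)\<close> with \<open>y = \<epsilon>\<^sup>2 ln (1 + w)\<close>, and both terms are
  \<open>O(\<epsilon>\<^sup>4)\<close>.
\<close>

lemma V'_rest_lipschitz:
  assumes "-1 < r" "a \<in> {r..sqrt (12 * B)}" "b \<in> {r..sqrt (12 * B)}" and \<epsilon>: "0 < \<epsilon>" "\<epsilon> \<le> 1"
  shows "\<bar>V'_rest \<epsilon> a - V'_rest \<epsilon> b\<bar> \<le> rest_bound B r * \<epsilon> ^ 4 * \<bar>a - b\<bar>"
proof -
  have \<epsilon>2: "\<epsilon>\<^sup>2 \<le> 1" using \<epsilon> by (simp add: power_le_one)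
  have "norm (V'_rest \<epsilon> a - V'_rest \<epsilon> b) \<le> (rest_bound B r * \<epsilon> ^ 4) * norm (a - b)"
  proof (rule field_differentiable_bound[of "{r..sqrt (12 * B)}"])
    fix z assume z: "z \<in> {r..sqrt (12 * B)}"
    then have z1: "-1 < z" using assms by auto
    let ?L = "ln (1 + z)" and ?\<Lambda> = "log_bound B r"
    have L: "\<bar>?L\<bar> \<le> ?\<Lambda>" using log_bound(1)[of r z B] z assms by auto
    show "(V'_rest \<epsilon> has_field_derivative (1 + \<epsilon>\<^sup>2) * (exp (\<epsilon>\<^sup>2 * ?L) - 1 - \<epsilon>\<^sup>2 * ?L) + \<epsilon> ^ 4 * ?L)
        (at z within {r..sqrt (12 * B)})"
    proof -
      have "(V' \<epsilon> has_field_derivative (1 + \<epsilon>\<^sup>2) * (1 + z) powr \<epsilon>\<^sup>2) (at z within {r..sqrt (12 * B)})"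
        unfolding V'_def[abs_def] using z1 by (auto intro!: derivative_eq_intros)
      then have "(V'_rest \<epsilon> has_field_derivative (1 + \<epsilon>\<^sup>2) * (1 + z) powr \<epsilon>\<^sup>2 - 1 - \<epsilon>\<^sup>2 * (1 + ?L))
          (at z within {r..sqrt (12 * B)})"
        unfolding V'_rest_def[abs_def] by (intro DERIV_diff DERIV_ident DERIV_cmult g_deriv z1)
      moreover have "(1 + z) powr \<epsilon>\<^sup>2 = exp (\<epsilon>\<^sup>2 * ?L)" using z1 by (simp add: powr_def)
      moreover have "(1 + \<epsilon>\<^sup>2) * E - 1 - \<epsilon>\<^sup>2 * (1 + ?L) = (1 + \<epsilon>\<^sup>2) * (E - 1 - \<epsilon>\<^sup>2 * ?L) + \<epsilon> ^ 4 * ?L" for E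
        by (simp add: algebra_simps power2_eq_square power4_eq_xxxx)
      ultimately show ?thesis by simp
    qed
    have "\<epsilon>\<^sup>2 * \<bar>?L\<bar> \<le> 1 * ?\<Lambda>" using L \<epsilon>2 by (intro mult_mono) auto
    then have "\<bar>exp (\<epsilon>\<^sup>2 * ?L) - 1 - \<epsilon>\<^sup>2 * ?L\<bar> \<le> exp ?\<Lambda> * (\<epsilon>\<^sup>2 * ?L)\<^sup>2"
      using exp_quadratic_remainder[of "\<epsilon>\<^sup>2 * ?L"]
      by (elim order_trans) (auto intro!: mult_right_mono simp: abs_mult)
    also have "\<dots> \<le> exp ?\<Lambda> * (\<epsilon> ^ 4 * ?\<Lambda>\<^sup>2)"
      using power_mono[OF L abs_ge_zero, of 2]
      by (simp add: power_mult_distrib mult_left_mono flip: power_mult)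
    finally have "(1 + \<epsilon>\<^sup>2) * \<bar>exp (\<epsilon>\<^sup>2 * ?L) - 1 - \<epsilon>\<^sup>2 * ?L\<bar> \<le> 2 * (exp ?\<Lambda> * (\<epsilon> ^ 4 * ?\<Lambda>\<^sup>2))"
      using \<epsilon>2 by (intro mult_mono) auto
    moreover have "\<epsilon> ^ 4 * \<bar>?L\<bar> \<le> \<epsilon> ^ 4 * ?\<Lambda>" using L by (intro mult_left_mono) auto
    moreover have "\<bar>(1 + \<epsilon>\<^sup>2) * (exp (\<epsilon>\<^sup>2 * ?L) - 1 - \<epsilon>\<^sup>2 * ?L) + \<epsilon> ^ 4 * ?L\<bar>
        \<le> (1 + \<epsilon>\<^sup>2) * \<bar>exp (\<epsilon>\<^sup>2 * ?L) - 1 - \<epsilon>\<^sup>2 * ?L\<bar> + \<epsilon> ^ 4 * \<bar>?L\<bar>"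
      by (rule order_trans[OF abs_triangle_ineq]) (simp add: abs_mult)
    moreover have "2 * (exp ?\<Lambda> * (\<epsilon> ^ 4 * ?\<Lambda>\<^sup>2)) + \<epsilon> ^ 4 * ?\<Lambda> = rest_bound B r * \<epsilon> ^ 4"
      by (simp add: rest_bound_def algebra_simps)
    ultimately show "norm ((1 + \<epsilon>\<^sup>2) * (exp (\<epsilon>\<^sup>2 * ?L) - 1 - \<epsilon>\<^sup>2 * ?L) + \<epsilon> ^ 4 * ?L) \<le> rest_bound B r * \<epsilon> ^ 4"
      unfolding real_norm_def by linarith
  qed (use assms in auto)
  then show ?thesis by simp
qed

definition g_profile_bound :: "real \<Rightarrow> real \<Rightarrow> real" where
  "g_profile_bound B r = log_bound B r + 3 * (sqrt (12 * B) / (1 + r)) + (sqrt (12 * B) / (1 + r))\<^sup>2"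

text \<open>
  The third derivative of \<open>g W\<close> is a combination of \<open>W'\<close> and \<open>W'''\<close> with bounded
  coefficients, hence square-integrable over the cell. One order of remainder less than for \<open>W\<close> suffices,
  since \<open>g W\<close> enters the residual with a factor \<open>\<epsilon>\<^sup>2\<close>.
\<close>

lemma g_third_order_remainder:
  assumes p: "profile B r d" and r: "-1 < r" and h: "0 < h"
  shows "(g (d 0 (x + h)) - g (d 0 (x - h)) - 2 * h * ((1 + ln (1 + d 0 x)) * d 1 x))\<^sup>2
    \<le> h ^ 5 * (2 * (g_profile_bound B r)\<^sup>2) * mass d (2 * h) x"
proof -
  let ?K = "g_profile_bound B r" and ?S = "sqrt (12 * B)" and ?\<Lambda> = "log_bound B r"
  define u0 where "u0 y = g (d 0 y)" for y
  define u1 where "u1 y = (1 + ln (1 + d 0 y)) * d 1 y" for y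
  define u2 where "u2 y = (1 + ln (1 + d 0 y)) * d 2 y + d 1 y * d 1 y / (1 + d 0 y)" for y
  define u3 where "u3 y = (1 + ln (1 + d 0 y)) * d 3 y + 3 * (d 2 y / (1 + d 0 y)) * d 1 y
    - (d 1 y / (1 + d 0 y))\<^sup>2 * d 1 y" for y
  have pos: "0 < 1 + d 0 y" "1 + r \<le> 1 + d 0 y" for y using profileD(5)[OF p, of y] r by auto
  then have nz: "1 + d 0 y \<noteq> 0" for y by (metis less_irrefl)
  note D = profileD(4)[OF p, of 0, simplified] profileD(4)[OF p, of 1, simplified] profileD(4)[OF p, of 2, simplified]
  have D0: "(d 0 has_real_derivative d 1 y) (at y)" and D1: "(d 1 has_real_derivative d 2 y) (at y)"
    and D2: "(d 2 has_real_derivative d 3 y) (at y)" for y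
    using D by (simp_all add: numeral_eq_Suc)
  have d0: "(u0 has_real_derivative u1 y) (at y)" for y
    unfolding u0_def[abs_def] u1_def using pos(1)[of y] by (intro DERIV_chain2[OF g_deriv D0]) auto
  have dlog: "((\<lambda>y. 1 + ln (1 + d 0 y)) has_real_derivative d 1 y / (1 + d 0 y)) (at y)" for y
    using pos(1)[of y] by (auto intro!: derivative_eq_intros D0)
  have d1: "(u1 has_real_derivative u2 y) (at y)" for y
    unfolding u1_def[abs_def] u2_def
    by (rule DERIV_cong[OF DERIV_mult[OF dlog D1]]) (simp add: algebra_simps)
  have d2: "(u2 has_real_derivative u3 y) (at y)" for y
  proof -
    have alg: "p / a * q + c * L + ((q * p + q * p) * a - p * p * (0 + p)) / (a * a)
        = L * c + 3 * (q / a) * p - (p / a)\<^sup>2 * p" if "a \<noteq> 0" for a p q c L :: real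
      using that by (simp add: field_simps power2_eq_square)
    show ?thesis
      unfolding u2_def[abs_def] u3_def
      by (rule DERIV_cong[OF DERIV_add[OF DERIV_mult[OF dlog D2]
              DERIV_divide[OF DERIV_mult[OF D1 D1] DERIV_add[OF DERIV_const D0] nz]]])
        (rule alg[OF nz])
  qed
  have S: "\<bar>d k y\<bar> \<le> ?S" if "k < 5" for k y using profile_range(1)[OF p that] .
  have \<Lambda>: "\<bar>1 + ln (1 + d 0 y)\<bar> \<le> ?\<Lambda>" for y
    using log_bound(2)[OF r profileD(5)[OF p]] S[of 0 y] by auto
  have quot: "\<bar>d k y / (1 + d 0 y)\<bar> \<le> ?S / (1 + r)" if "k < 5" for k y
    using S[OF that, of y] pos[of y] r profile_range(2)[OF p, of 0] by (simp add: abs_divide frac_le)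
  have S0: "0 \<le> ?S / (1 + r)" using quot[of 0 0] by linarith
  have \<Lambda>0: "0 \<le> ?\<Lambda>" using \<Lambda>[of 0] by linarith
  have u3: "(u3 y)\<^sup>2 \<le> 2 * ?K\<^sup>2 * (\<Sum>k\<le>5. (d k y)\<^sup>2)" for y
  proof -
    have "\<bar>u3 y\<bar> \<le> \<bar>(1 + ln (1 + d 0 y)) * d 3 y\<bar> + \<bar>3 * (d 2 y / (1 + d 0 y)) * d 1 y\<bar>
        + \<bar>(d 1 y / (1 + d 0 y))\<^sup>2 * d 1 y\<bar>"
      unfolding u3_def by linarith
    also have "\<bar>(1 + ln (1 + d 0 y)) * d 3 y\<bar> \<le> ?\<Lambda> * \<bar>d 3 y\<bar>"
      unfolding abs_mult by (intro mult_right_mono \<Lambda>) auto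
    also have "\<bar>3 * (d 2 y / (1 + d 0 y)) * d 1 y\<bar> \<le> 3 * (?S / (1 + r)) * \<bar>d 1 y\<bar>"
      unfolding abs_mult using quot[of 2 y] by (intro mult_right_mono) auto
    also have "\<bar>(d 1 y / (1 + d 0 y))\<^sup>2 * d 1 y\<bar> \<le> (?S / (1 + r))\<^sup>2 * \<bar>d 1 y\<bar>"
      unfolding abs_mult using power_mono[OF quot[of 1 y] abs_ge_zero, of 2]
      by (intro mult_right_mono) (simp_all add: power_divide)
    finally have "\<bar>u3 y\<bar> \<le> ?\<Lambda> * \<bar>d 3 y\<bar> + (3 * (?S / (1 + r)) + (?S / (1 + r))\<^sup>2) * \<bar>d 1 y\<bar>"
      by (simp add: algebra_simps)
    also have "\<dots> \<le> ?K * \<bar>d 3 y\<bar> + ?K * \<bar>d 1 y\<bar>"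
      unfolding g_profile_bound_def using S0 \<Lambda>0 by (intro add_mono mult_right_mono) auto
    finally have "\<bar>u3 y\<bar>\<^sup>2 \<le> (?K * \<bar>d 3 y\<bar> + ?K * \<bar>d 1 y\<bar>)\<^sup>2" by (intro power_mono) auto
    also have "\<dots> \<le> 2 * (?K * \<bar>d 3 y\<bar>)\<^sup>2 + 2 * (?K * \<bar>d 1 y\<bar>)\<^sup>2" by (rule square_add_le)
    also have "\<dots> = 2 * ?K\<^sup>2 * ((d 3 y)\<^sup>2 + (d 1 y)\<^sup>2)" by (simp add: power_mult_distrib algebra_simps)
    also have "(d 3 y)\<^sup>2 + (d 1 y)\<^sup>2 = (\<Sum>k\<in>{3, 1}. (d k y)\<^sup>2)" by simp
    also have "2 * ?K\<^sup>2 * \<dots> \<le> 2 * ?K\<^sup>2 * (\<Sum>k\<le>5. (d k y)\<^sup>2)"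
      by (intro mult_left_mono sum_mono2) auto
    finally show ?thesis by simp
  qed
  have c: "continuous_on UNIV (d k)" if "k \<le> 5" for k by (rule profileD(1)[OF p that])
  have cont: "continuous_on UNIV u3"
    unfolding u3_def[abs_def] using pos nz by (intro continuous_intros c) auto
  define q where "q m s = (if m = 0 then u0 (x + s) - u0 (x - s) - 2 * s * u1 x
    else if m = 1 then u1 (x + s) + u1 (x - s) - 2 * u1 x else u2 (x + s) - u2 (x - s))" for m :: nat and s
  have plus: "((\<lambda>s. x + s) has_real_derivative 1) (at s)" and minus: "((\<lambda>s. x - s) has_real_derivative - 1) (at s)" for s
    by (auto intro!: derivative_eq_intros)
  note E = DERIV_chain2[OF d0 plus] DERIV_chain2[OF d0 minus] DERIV_chain2[OF d1 plus] DERIV_chain2[OF d1 minus]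
  have "(q m has_real_derivative q (Suc m) s) (at s)" if "m < 2" for m s
  proof -
    have "m = 0 \<or> m = 1" using that by linarith
    then consider "m = 0" | "m = 1" by blast
    then show ?thesis
    proof cases
      case 1
      have "((\<lambda>s. 2 * s * u1 x) has_real_derivative 2 * u1 x) (at s)"
        by (auto intro!: derivative_eq_intros)
      from DERIV_diff[OF DERIV_diff[OF E(1,2)] this]
      show ?thesis using 1 by (simp add: q_def[abs_def])
    next
      case 2
      from DERIV_diff[OF DERIV_add[OF E(3,4)] DERIV_const]
      show ?thesis using 2 by (simp add: q_def[abs_def])
    qed
  qed
  from maclaurin_all_derivatives[where q = q and n = 2, OF h _ this]
  obtain t where t: "0 < t" "t < h" and qh: "q 0 h = (\<Sum>m<2. q m 0 / fact m * h ^ m) + q 2 t / fact 2 * h ^ 2"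
    by auto
  note qh
  moreover have "(\<Sum>m<2. q m 0 / fact m * h ^ m) = 0"
    by (simp add: q_def numeral_2_eq_2)
  ultimately have "q 0 h = q 2 t / 2 * h\<^sup>2" by simp
  then have "(q 0 h)\<^sup>2 = (q 2 t / 2 * h\<^sup>2)\<^sup>2" by (simp only:)
  also have "\<dots> = (q 2 t)\<^sup>2 * (h ^ 4 / 4)"
    by (simp add: power_mult_distrib power_divide flip: power_mult)
  finally have "(q 0 h)\<^sup>2 = (q 2 t)\<^sup>2 * (h ^ 4 / 4)" .
  also have "\<dots> \<le> (2 * h * (2 * ?K\<^sup>2 * mass d (2 * h) x)) * (h ^ 4 / 4)"
  proof (intro mult_right_mono)
    have "(u2 (x + t) - u2 (x - t))\<^sup>2 \<le> (x + t - (x - t)) * (LINT y|lborel. (u3 y)\<^sup>2 * indicator {x - t<..x + t} y)"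
      using t by (intro increment_square_le d2 cont) auto
    also have "(LINT y|lborel. (u3 y)\<^sup>2 * indicator {x - t<..x + t} y)
        \<le> (LINT y|lborel. 2 * ?K\<^sup>2 * ((\<Sum>k\<le>5. (d k y)\<^sup>2) * indicator {x - t<..x + t} y))"
    proof (rule integral_mono)
      have "continuous_on UNIV (\<lambda>y. (u3 y)\<^sup>2)" by (intro continuous_intros cont)
      then obtain G where "\<And>y. (G has_real_derivative (u3 y)\<^sup>2) (at y)" "continuous_on UNIV (\<lambda>y. (u3 y)\<^sup>2)"
        using antiderivative_banach unfolding has_real_derivative_iff_has_vector_derivative by blast
      then show "integrable lborel (\<lambda>y. (u3 y)\<^sup>2 * indicator {x - t<..x + t} y)"
        using t by (intro integral_Ioc_deriv(2)) auto
      show "integrable lborel (\<lambda>y. 2 * ?K\<^sup>2 * ((\<Sum>k\<le>5. (d k y)\<^sup>2) * indicator {x - t<..x + t} y))"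
        by (intro integrable_mult_right profile_mass(3)[OF p])
      show "(u3 y)\<^sup>2 * indicator {x - t<..x + t} y \<le> 2 * ?K\<^sup>2 * ((\<Sum>k\<le>5. (d k y)\<^sup>2) * indicator {x - t<..x + t} y)" for y
        using u3[of y] by (auto split: split_indicator)
    qed
    also have "\<dots> = 2 * ?K\<^sup>2 * (LINT y|lborel. (\<Sum>k\<le>5. (d k y)\<^sup>2) * indicator {x - t<..x + t} y)"
      by (rule integral_mult_right_zero)
    also have "\<dots> \<le> 2 * ?K\<^sup>2 * mass d (2 * h) x"
      using t by (intro mult_left_mono le_mass[OF p] profile_mass(3)[OF p]) auto
    also have "(x + t - (x - t)) * (2 * ?K\<^sup>2 * mass d (2 * h) x) \<le> 2 * h * (2 * ?K\<^sup>2 * mass d (2 * h) x)"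
      using t mass_nonneg[of d "2 * h" x] by (intro mult_right_mono) auto
    finally show "(q 2 t)\<^sup>2 \<le> 2 * h * (2 * ?K\<^sup>2 * mass d (2 * h) x)"
      using t by (simp add: q_def)
  qed auto
  also have "\<dots> = h ^ 5 * ?K\<^sup>2 * mass d (2 * h) x" by (simp add: numeral_eq_Suc)
  also have "\<dots> \<le> h ^ 5 * (2 * ?K\<^sup>2) * mass d (2 * h) x"
    using h by (intro mult_right_mono mult_left_mono mass_nonneg) auto
  finally show ?thesis by (simp add: q_def u0_def u1_def)
qed

section \<open>The residual of the half-shifted ansatz\<close>

text \<open>
  The value of \<open>W\<^sub>\<tau>\<close> that the log-KdV equation prescribes; \<open>time_rate\<close> is the
  resulting time derivative along the lattice, where \<open>\<xi> = \<epsilon> (n - t)\<close> and \<open>\<tau> =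
  \<epsilon>\<^sup>3 t\<close>.
\<close>

definition tau_rate :: "(nat \<Rightarrow> real \<Rightarrow> real) \<Rightarrow> real \<Rightarrow> real" where
  "tau_rate d x = - (d 3 x / 24 + (1 + ln (1 + d 0 x)) * d 1 x / 2)"

definition time_rate :: "(nat \<Rightarrow> real \<Rightarrow> real) \<Rightarrow> real \<Rightarrow> real \<Rightarrow> real" where
  "time_rate d \<epsilon> x = - \<epsilon> * d 1 x + \<epsilon> ^ 3 * tau_rate d x"

definition Q :: "real \<Rightarrow> real \<Rightarrow> real" where
  "Q \<epsilon> w = w + \<epsilon>\<^sup>2 / 2 * g w"

text \<open>
  The defect of the first lattice equation at \<open>\<xi> = x\<close>, where the momentum of the ansatz is \<open>- Q
  (W (\<xi> - \<epsilon> / 2))\<close>.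
\<close>

definition residual1 :: "(nat \<Rightarrow> real \<Rightarrow> real) \<Rightarrow> real \<Rightarrow> real \<Rightarrow> real" where
  "residual1 d \<epsilon> x = time_rate d \<epsilon> x + (Q \<epsilon> (d 0 (x + \<epsilon> / 2)) - Q \<epsilon> (d 0 (x - \<epsilon> / 2)))"

text \<open>
  The defect of the second lattice equation, expressed at the shifted point \<open>x = \<xi> - \<epsilon> / 2\<close>.
  There the force difference between two neighbouring sites is a centred difference.
\<close>

definition residual2 :: "(nat \<Rightarrow> real \<Rightarrow> real) \<Rightarrow> real \<Rightarrow> real \<Rightarrow> real" where
  "residual2 d \<epsilon> x = - (1 + \<epsilon>\<^sup>2 / 2 * (1 + ln (1 + d 0 x))) * time_rate d \<epsilon> x
     - (V' \<epsilon> (d 0 (x + \<epsilon> / 2)) - V' \<epsilon> (d 0 (x - \<epsilon> / 2)))"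

lemma profile_in_range:
  assumes "profile B r d"
  shows "d 0 x \<in> {r..sqrt (12 * B)}"
  using profile_range(1)[OF assms, of 0 x] profileD(5)[OF assms, of x] by auto

lemma profile_log_bound:
  assumes p: "profile B r d" and r: "-1 < r"
  shows "\<bar>1 + ln (1 + d 0 x)\<bar> \<le> log_bound B r" "0 \<le> log_bound B r"
proof -
  show "\<bar>1 + ln (1 + d 0 x)\<bar> \<le> log_bound B r"
    using log_bound(2)[OF r] profile_in_range[OF p, of x] by auto
  then show "0 \<le> log_bound B r" by linarith
qed

text \<open>
  Involves no derivative beyond the third, so point values can be sampled at the cost of the fourth derivative.
\<close>

lemma tau_rate_bounds:
  assumes p: "profile B r d" and r: "-1 < r"
  shows "\<bar>tau_rate d x\<bar> \<le> (1 + log_bound B r) * sqrt (12 * B)"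
    and "\<lbrakk>0 < \<epsilon>; \<epsilon> \<le> 1\<rbrakk> \<Longrightarrow> (tau_rate d x)\<^sup>2 \<le> (1 + (log_bound B r)\<^sup>2) * (2 / \<epsilon> * mass d \<epsilon> x)"
proof -
  let ?\<Lambda> = "log_bound B r" and ?S = "sqrt (12 * B)"
  note \<Lambda> = profile_log_bound[OF p r]
  have le: "\<bar>(1 + ln (1 + d 0 x)) * d 1 x\<bar> \<le> ?\<Lambda> * \<bar>d 1 x\<bar>"
    unfolding abs_mult by (intro mult_right_mono \<Lambda>) auto
  also have "\<dots> \<le> ?\<Lambda> * ?S"
    by (intro mult_left_mono profile_range[OF p] \<Lambda>) auto
  finally have "\<bar>(1 + ln (1 + d 0 x)) * d 1 x\<bar> \<le> ?\<Lambda> * ?S" .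
  moreover have "\<bar>d 3 x\<bar> \<le> ?S" by (rule profile_range[OF p]) simp
  moreover have "(1 + ?\<Lambda>) * ?S = ?S + ?\<Lambda> * ?S" by (simp add: distrib_right)
  ultimately show "\<bar>tau_rate d x\<bar> \<le> (1 + ?\<Lambda>) * ?S"
    unfolding tau_rate_def by linarith
  assume \<epsilon>: "0 < \<epsilon>" "\<epsilon> \<le> 1"
  have "((1 + ln (1 + d 0 x)) * d 1 x)\<^sup>2 \<le> (?\<Lambda> * \<bar>d 1 x\<bar>)\<^sup>2"
    using power_mono[OF le abs_ge_zero, of 2] by simp
  then have b: "((1 + ln (1 + d 0 x)) * d 1 x)\<^sup>2 \<le> ?\<Lambda>\<^sup>2 * (d 1 x)\<^sup>2"
    by (simp add: power_mult_distrib)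
  have "(tau_rate d x)\<^sup>2 = (d 3 x / 24 + (1 + ln (1 + d 0 x)) * d 1 x / 2)\<^sup>2"
    by (simp add: tau_rate_def power2_eq_square algebra_simps)
  also have "\<dots> \<le> 2 * (d 3 x / 24)\<^sup>2 + 2 * ((1 + ln (1 + d 0 x)) * d 1 x / 2)\<^sup>2"
    by (rule square_add_le)
  also have "\<dots> = (d 3 x)\<^sup>2 / 288 + ((1 + ln (1 + d 0 x)) * d 1 x)\<^sup>2 / 2"
    by (simp add: power_divide)
  also have "\<dots> \<le> (d 3 x)\<^sup>2 + ?\<Lambda>\<^sup>2 * (d 1 x)\<^sup>2"
    using b zero_le_power2[of "d 3 x"] zero_le_power2[of "(1 + ln (1 + d 0 x)) * d 1 x"] by linarith
  also have "\<dots> \<le> 2 / \<epsilon> * mass d \<epsilon> x + ?\<Lambda>\<^sup>2 * (2 / \<epsilon> * mass d \<epsilon> x)"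
    by (intro add_mono mult_left_mono profile_sample[OF p _ \<epsilon>]) auto
  finally show "(tau_rate d x)\<^sup>2 \<le> (1 + ?\<Lambda>\<^sup>2) * (2 / \<epsilon> * mass d \<epsilon> x)"
    by (simp only: distrib_right mult_1)
qed

lemma time_rate_bound:
  assumes p: "profile B r d" and r: "-1 < r" and \<epsilon>: "0 < \<epsilon>" "\<epsilon> \<le> 1"
  shows "\<bar>time_rate d \<epsilon> x\<bar> \<le> (2 + log_bound B r) * sqrt (12 * B) * \<epsilon>"
proof -
  let ?\<Lambda> = "log_bound B r" and ?S = "sqrt (12 * B)"
  have "\<bar>time_rate d \<epsilon> x\<bar> \<le> \<epsilon> * \<bar>d 1 x\<bar> + \<epsilon> ^ 3 * \<bar>tau_rate d x\<bar>"
    unfolding time_rate_def using \<epsilon> by (intro order_trans[OF abs_triangle_ineq]) (simp add: abs_mult)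
  also have "\<dots> \<le> \<epsilon> * ?S + \<epsilon> ^ 1 * ((1 + ?\<Lambda>) * ?S)"
    using \<epsilon> by (intro add_mono mult_mono profile_range[OF p] tau_rate_bounds[OF p r] power_decreasing) auto
  finally show ?thesis by (simp add: algebra_simps)
qed

lemma g_remainder_step:
  assumes p: "profile B r d" and r: "-1 < r" and \<epsilon>: "0 < \<epsilon>" "\<epsilon> \<le> 1"
  shows "(g (d 0 (x + \<epsilon> / 2)) - g (d 0 (x - \<epsilon> / 2)) - \<epsilon> * ((1 + ln (1 + d 0 x)) * d 1 x))\<^sup>2
    \<le> 2 * (g_profile_bound B r)\<^sup>2 * \<epsilon> ^ 5 * mass d \<epsilon> x"
proof -
  have "(\<epsilon> / 2) ^ 5 \<le> \<epsilon> ^ 5" using \<epsilon> by (intro power_mono) auto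
  then have "(\<epsilon> / 2) ^ 5 * (2 * (g_profile_bound B r)\<^sup>2 * mass d \<epsilon> x) \<le> \<epsilon> ^ 5 * (2 * (g_profile_bound B r)\<^sup>2 * mass d \<epsilon> x)"
    by (intro mult_right_mono) (auto simp: mass_nonneg)
  then show ?thesis
    using g_third_order_remainder[OF p r, of "\<epsilon> / 2" x] \<epsilon> by (simp add: mult_ac)
qed

lemma profile_remainder_step:
  assumes p: "profile B r d" and \<epsilon>: "0 < \<epsilon>" "\<epsilon> \<le> 1"
  shows "(d 0 (x + \<epsilon> / 2) - d 0 (x - \<epsilon> / 2) - \<epsilon> * d 1 x - \<epsilon> ^ 3 / 24 * d 3 x)\<^sup>2 \<le> \<epsilon> ^ 9 * mass d \<epsilon> x"
proof -
  have "(\<epsilon> / 2) ^ 9 * mass d \<epsilon> x \<le> \<epsilon> ^ 9 * mass d \<epsilon> x"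
    using \<epsilon> by (intro mult_right_mono power_mono mass_nonneg) auto
  moreover have "2 * (\<epsilon> / 2) = \<epsilon>" "(\<epsilon> / 2) ^ 3 / 3 = \<epsilon> ^ 3 / 24"
    by (simp_all add: power_divide)
  ultimately show ?thesis
    using fifth_order_remainder[OF p half_gt_zero[OF \<epsilon>(1)], of x] by (simp only: order_trans)
qed

text \<open>
  The terms of order \<open>\<epsilon>\<close> and \<open>\<epsilon>\<^sup>3\<close> are subtracted exactly by
  \<open>time_rate\<close>, which leaves the Taylor remainders of \<open>W\<close> and of \<open>\<epsilon>\<^sup>2 / 2
  * g W\<close>.
\<close>

lemma residual1_bound:
  assumes p: "profile B r d" and r: "-1 < r" and \<epsilon>: "0 < \<epsilon>" "\<epsilon> \<le> 1"
  shows "(residual1 d \<epsilon> x)\<^sup>2 \<le> (2 + (g_profile_bound B r)\<^sup>2) * \<epsilon> ^ 9 * mass d \<epsilon> x"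
proof -
  let ?K = "g_profile_bound B r"
  define a where "a = d 0 (x + \<epsilon> / 2) - d 0 (x - \<epsilon> / 2) - \<epsilon> * d 1 x - \<epsilon> ^ 3 / 24 * d 3 x"
  define b where "b = g (d 0 (x + \<epsilon> / 2)) - g (d 0 (x - \<epsilon> / 2)) - \<epsilon> * ((1 + ln (1 + d 0 x)) * d 1 x)"
  have "residual1 d \<epsilon> x = a + \<epsilon>\<^sup>2 / 2 * b"
    unfolding residual1_def time_rate_def tau_rate_def Q_def a_def b_def
    by (simp add: algebra_simps power2_eq_square power3_eq_cube)
  then have "(residual1 d \<epsilon> x)\<^sup>2 \<le> 2 * a\<^sup>2 + 2 * (\<epsilon>\<^sup>2 / 2 * b)\<^sup>2"
    using square_add_le by simp
  also have "(\<epsilon>\<^sup>2 / 2 * b)\<^sup>2 = \<epsilon> ^ 4 / 4 * b\<^sup>2"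
    by (simp add: power_mult_distrib power_divide flip: power_mult)
  also have "2 * a\<^sup>2 + 2 * (\<epsilon> ^ 4 / 4 * b\<^sup>2)
      \<le> 2 * (\<epsilon> ^ 9 * mass d \<epsilon> x) + 2 * (\<epsilon> ^ 4 / 4 * (2 * ?K\<^sup>2 * \<epsilon> ^ 5 * mass d \<epsilon> x))"
    unfolding a_def b_def
    by (intro add_mono mult_left_mono profile_remainder_step[OF p \<epsilon>] g_remainder_step[OF p r \<epsilon>])
      (use \<epsilon> in auto)
  also have "\<dots> = (2 + ?K\<^sup>2) * \<epsilon> ^ 9 * mass d \<epsilon> x"
  proof -
    have "\<epsilon> ^ 9 = \<epsilon> ^ 4 * \<epsilon> ^ 5" by (simp flip: power_add)
    then show ?thesis by (simp add: algebra_simps)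
  qed
  finally show ?thesis .
qed

definition residual2_const :: "real \<Rightarrow> real \<Rightarrow> real" where
  "residual2_const B r = 4 * (1 + 2 * (g_profile_bound B r)\<^sup>2 + (rest_bound B r)\<^sup>2
     + (log_bound B r)\<^sup>2 * (1 + (log_bound B r)\<^sup>2))"

text \<open>
  Beyond the two Taylor remainders, two contributions survive: the increment of \<open>V'_rest\<close> across a cell,
  and the term \<open>\<epsilon>\<^sup>5 / 2\<close> times the time derivative of \<open>g W\<close>, which comes from
  differentiating the correction \<open>\<epsilon>\<^sup>2 / 2 * g W\<close> of the momentum.
\<close>

lemma residual2_bound:
  assumes p: "profile B r d" and r: "-1 < r" and \<epsilon>: "0 < \<epsilon>" "\<epsilon> \<le> 1"
  shows "(residual2 d \<epsilon> x)\<^sup>2 \<le> residual2_const B r * \<epsilon> ^ 9 * mass d \<epsilon> x"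
proof -
  let ?K = "g_profile_bound B r" and ?\<Lambda> = "log_bound B r" and ?R = "rest_bound B r"
  let ?m = "mass d \<epsilon> x" and ?u = "d 0 (x + \<epsilon> / 2)" and ?v = "d 0 (x - \<epsilon> / 2)"
  define a where "a = ?u - ?v - \<epsilon> * d 1 x - \<epsilon> ^ 3 / 24 * d 3 x"
  define b where "b = g ?u - g ?v - \<epsilon> * ((1 + ln (1 + d 0 x)) * d 1 x)"
  define c where "c = V'_rest \<epsilon> ?u - V'_rest \<epsilon> ?v"
  define e where "e = (1 + ln (1 + d 0 x)) * tau_rate d x"
  have "residual2 d \<epsilon> x = - ((a + \<epsilon>\<^sup>2 * b) + (c + \<epsilon> ^ 5 / 2 * e))"
  proof -
    have V: "V' \<epsilon> w = w + \<epsilon>\<^sup>2 * g w + V'_rest \<epsilon> w" for w by (simp add: V'_rest_def)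
    define L where "L = 1 + ln (1 + d 0 x)"
    have \<epsilon>5: "\<epsilon> ^ 5 = \<epsilon>\<^sup>2 * \<epsilon> ^ 3" by (simp flip: power_add)
    have "\<epsilon> ^ 3 * tau_rate d x = - (\<epsilon> ^ 3 * d 3 x / 24 + \<epsilon> ^ 3 * L * d 1 x / 2)"
      by (simp add: tau_rate_def L_def algebra_simps)
    then have "- (1 + \<epsilon>\<^sup>2 / 2 * L) * time_rate d \<epsilon> x
        = \<epsilon> * d 1 x + \<epsilon> ^ 3 * L * d 1 x + \<epsilon> ^ 3 / 24 * d 3 x - \<epsilon> ^ 5 / 2 * (L * tau_rate d x)"
      unfolding time_rate_def \<epsilon>5 by (simp add: algebra_simps power2_eq_square power3_eq_cube)
    then show ?thesis
      unfolding residual2_def V a_def b_def c_def e_def L_def[symmetric]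
      by (simp add: algebra_simps power2_eq_square power3_eq_cube)
  qed
  then have "(residual2 d \<epsilon> x)\<^sup>2 = ((a + \<epsilon>\<^sup>2 * b) + (c + \<epsilon> ^ 5 / 2 * e))\<^sup>2"
    by (simp only: power2_minus)
  also have "\<dots> \<le> 2 * (a + \<epsilon>\<^sup>2 * b)\<^sup>2 + 2 * (c + \<epsilon> ^ 5 / 2 * e)\<^sup>2"
    by (rule square_add_le)
  also have "\<dots> \<le> 2 * (2 * a\<^sup>2 + 2 * (\<epsilon>\<^sup>2 * b)\<^sup>2) + 2 * (2 * c\<^sup>2 + 2 * (\<epsilon> ^ 5 / 2 * e)\<^sup>2)"
    by (intro add_mono mult_left_mono square_add_le) auto
  also have "\<dots> = 4 * (a\<^sup>2 + \<epsilon> ^ 4 * b\<^sup>2 + c\<^sup>2 + \<epsilon> ^ 10 / 4 * e\<^sup>2)"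
    by (simp add: power_mult_distrib power_divide algebra_simps flip: power_mult)
  also have "\<dots> \<le> 4 * (\<epsilon> ^ 9 * ?m + \<epsilon> ^ 4 * (2 * ?K\<^sup>2 * \<epsilon> ^ 5 * ?m) + ?R\<^sup>2 * \<epsilon> ^ 8 * (\<epsilon> * ?m)
      + \<epsilon> ^ 10 / 4 * (?\<Lambda>\<^sup>2 * ((1 + ?\<Lambda>\<^sup>2) * (2 / \<epsilon> * ?m))))"
  proof (intro add_mono mult_left_mono)
    show "a\<^sup>2 \<le> \<epsilon> ^ 9 * ?m" unfolding a_def by (rule profile_remainder_step[OF p \<epsilon>])
    show "b\<^sup>2 \<le> 2 * ?K\<^sup>2 * \<epsilon> ^ 5 * ?m" unfolding b_def by (rule g_remainder_step[OF p r \<epsilon>])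
    have "\<bar>c\<bar> \<le> ?R * \<epsilon> ^ 4 * \<bar>?u - ?v\<bar>"
      unfolding c_def by (intro V'_rest_lipschitz r profile_in_range[OF p] \<epsilon>)
    then have "\<bar>c\<bar>\<^sup>2 \<le> (?R * \<epsilon> ^ 4 * \<bar>?u - ?v\<bar>)\<^sup>2" by (intro power_mono) auto
    then have "c\<^sup>2 \<le> ?R\<^sup>2 * \<epsilon> ^ 8 * (?u - ?v)\<^sup>2" by (simp add: power_mult_distrib flip: power_mult)
    also have "\<dots> \<le> ?R\<^sup>2 * \<epsilon> ^ 8 * (\<epsilon> * ?m)"
      using profile_increment[OF p, of 0 x \<epsilon> "x - \<epsilon> / 2" "x + \<epsilon> / 2"] \<epsilon>
      by (intro mult_left_mono) auto
    finally show "c\<^sup>2 \<le> ?R\<^sup>2 * \<epsilon> ^ 8 * (\<epsilon> * ?m)" .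
    have "e\<^sup>2 = \<bar>1 + ln (1 + d 0 x)\<bar>\<^sup>2 * (tau_rate d x)\<^sup>2" by (simp add: e_def power_mult_distrib)
    also have "\<dots> \<le> ?\<Lambda>\<^sup>2 * ((1 + ?\<Lambda>\<^sup>2) * (2 / \<epsilon> * ?m))"
      by (intro mult_mono power_mono profile_log_bound[OF p r] tau_rate_bounds(2)[OF p r \<epsilon>]) auto
    finally show "e\<^sup>2 \<le> ?\<Lambda>\<^sup>2 * ((1 + ?\<Lambda>\<^sup>2) * (2 / \<epsilon> * ?m))" .
  qed (use \<epsilon> in auto)
  also have "\<dots> = 4 * (1 + 2 * ?K\<^sup>2 + ?R\<^sup>2 + ?\<Lambda>\<^sup>2 * (1 + ?\<Lambda>\<^sup>2) / 2) * (\<epsilon> ^ 9 * ?m)"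
  proof -
    have e: "\<epsilon> ^ 4 * \<epsilon> ^ 5 = \<epsilon> ^ 9" "\<epsilon> ^ 8 * \<epsilon> = \<epsilon> ^ 9" "\<epsilon> ^ 10 = \<epsilon> ^ 9 * \<epsilon>"
      by (simp_all add: eval_nat_numeral)
    have "\<epsilon> ^ 4 * (2 * ?K\<^sup>2 * \<epsilon> ^ 5 * ?m) = 2 * ?K\<^sup>2 * (\<epsilon> ^ 9 * ?m)"
      "?R\<^sup>2 * \<epsilon> ^ 8 * (\<epsilon> * ?m) = ?R\<^sup>2 * (\<epsilon> ^ 9 * ?m)"
      "\<epsilon> ^ 10 / 4 * (?\<Lambda>\<^sup>2 * ((1 + ?\<Lambda>\<^sup>2) * (2 / \<epsilon> * ?m))) = ?\<Lambda>\<^sup>2 * (1 + ?\<Lambda>\<^sup>2) / 2 * (\<epsilon> ^ 9 * ?m)"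
      using \<epsilon>(1) by (simp only: e(1)[symmetric] mult_ac, simp only: e(2)[symmetric] mult_ac, simp add: e(3))
    note eqs = this
    show ?thesis unfolding eqs by (simp add: distrib_right distrib_left)
  qed
  also have "\<dots> \<le> residual2_const B r * (\<epsilon> ^ 9 * ?m)"
    unfolding residual2_const_def
    using \<epsilon> mass_nonneg[of d \<epsilon> x] by (intro mult_right_mono mult_nonneg_nonneg) auto
  finally show ?thesis by (simp add: mult.assoc)
qed

text \<open>
  \<open>P\<^sub>\<epsilon>\<close> written in terms of a profile.
\<close>

definition P_profile :: "(nat \<Rightarrow> real \<Rightarrow> real) \<Rightarrow> real \<Rightarrow> real \<Rightarrow> real" where
  "P_profile d \<epsilon> x = - d 0 x + \<epsilon> / 2 * d 1 x - \<epsilon>\<^sup>2 / 8 * d 2 x - \<epsilon>\<^sup>2 / 2 * g (d 0 x)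
     + \<epsilon> ^ 3 / 48 * d 3 x + \<epsilon> ^ 3 / 4 * ((1 + ln (1 + d 0 x)) * d 1 x)"

text \<open>
  A crude bound is enough: \<open>P\<^sub>\<epsilon>\<close> and the half-shifted momentum differ by terms of order
  \<open>\<epsilon>\<^sup>2\<close> before sampling, and \<open>\<epsilon>\<^sup>3\<close> on the right-hand side is the
  square of the accuracy claimed in the end.
\<close>

lemma P_profile_bound:
  assumes p: "profile B r d" and r: "-1 < r" and \<epsilon>: "0 < \<epsilon>" "\<epsilon> \<le> 1"
  shows "(P_profile d \<epsilon> x + Q \<epsilon> (d 0 (x - \<epsilon> / 2)))\<^sup>2 \<le> (16 + 8 * (log_bound B r)\<^sup>2) * \<epsilon> ^ 3 * mass d \<epsilon> x"
proof -
  let ?\<Lambda> = "log_bound B r" and ?m = "mass d \<epsilon> x" and ?v = "d 0 (x - \<epsilon> / 2)"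
  define a where "a = ?v - d 0 x + \<epsilon> / 2 * d 1 x"
  define b where "b = g ?v - g (d 0 x)"
  have L: "(1 + ln (1 + d 0 x)) * d 1 x = - 2 * (tau_rate d x + d 3 x / 24)"
    by (simp add: tau_rate_def)
  have "P_profile d \<epsilon> x + Q \<epsilon> ?v = (a + \<epsilon>\<^sup>2 / 2 * b) + (- (\<epsilon>\<^sup>2 / 8 * d 2 x) + - (\<epsilon> ^ 3 / 2 * tau_rate d x))"
    unfolding P_profile_def Q_def a_def b_def L by (simp add: algebra_simps)
  then have "(P_profile d \<epsilon> x + Q \<epsilon> ?v)\<^sup>2
      \<le> 2 * (a + \<epsilon>\<^sup>2 / 2 * b)\<^sup>2 + 2 * (- (\<epsilon>\<^sup>2 / 8 * d 2 x) + - (\<epsilon> ^ 3 / 2 * tau_rate d x))\<^sup>2"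
    using square_add_le by simp
  also have "\<dots> \<le> 2 * (2 * a\<^sup>2 + 2 * (\<epsilon>\<^sup>2 / 2 * b)\<^sup>2) + 2 * (2 * (- (\<epsilon>\<^sup>2 / 8 * d 2 x))\<^sup>2 + 2 * (- (\<epsilon> ^ 3 / 2 * tau_rate d x))\<^sup>2)"
    by (intro add_mono mult_left_mono square_add_le) auto
  also have "\<dots> = 4 * (a\<^sup>2 + \<epsilon> ^ 4 / 4 * b\<^sup>2 + \<epsilon> ^ 4 / 64 * (d 2 x)\<^sup>2 + \<epsilon> ^ 6 / 4 * (tau_rate d x)\<^sup>2)"
    by (simp add: power_mult_distrib power_divide algebra_simps flip: power_mult)
  also have "\<dots> \<le> 4 * (\<epsilon> ^ 3 * ?m + \<epsilon> ^ 4 / 4 * (?\<Lambda>\<^sup>2 * (\<epsilon> * ?m)) + \<epsilon> ^ 4 / 64 * (2 / \<epsilon> * ?m)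
      + \<epsilon> ^ 6 / 4 * ((1 + ?\<Lambda>\<^sup>2) * (2 / \<epsilon> * ?m)))"
  proof (intro add_mono mult_left_mono)
    have "a\<^sup>2 \<le> (\<epsilon> / 2) ^ 3 * ?m"
      using second_order_remainder[OF p, of "\<epsilon> / 2" x] \<epsilon> by (simp add: a_def)
    also have "\<dots> \<le> \<epsilon> ^ 3 * ?m" using \<epsilon> by (intro mult_right_mono power_mono mass_nonneg) auto
    finally show "a\<^sup>2 \<le> \<epsilon> ^ 3 * ?m" .
    have "\<bar>b\<bar> \<le> ?\<Lambda> * \<bar>?v - d 0 x\<bar>"
      unfolding b_def by (intro g_lipschitz[OF r] profile_in_range[OF p])
    then have "\<bar>b\<bar>\<^sup>2 \<le> (?\<Lambda> * \<bar>?v - d 0 x\<bar>)\<^sup>2" by (intro power_mono) auto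
    then have "b\<^sup>2 \<le> ?\<Lambda>\<^sup>2 * (d 0 x - ?v)\<^sup>2" by (simp add: power_mult_distrib power2_commute)
    also have "(d 0 x - ?v)\<^sup>2 \<le> (x - (x - \<epsilon> / 2)) * ?m"
      using \<epsilon> by (intro profile_increment[OF p]) auto
    also have "\<dots> \<le> \<epsilon> * ?m" using \<epsilon> by (intro mult_right_mono mass_nonneg) auto
    finally show "b\<^sup>2 \<le> ?\<Lambda>\<^sup>2 * (\<epsilon> * ?m)" by (simp add: mult_left_mono)
    show "(d 2 x)\<^sup>2 \<le> 2 / \<epsilon> * ?m" by (rule profile_sample[OF p _ \<epsilon>]) simp
    show "(tau_rate d x)\<^sup>2 \<le> (1 + ?\<Lambda>\<^sup>2) * (2 / \<epsilon> * ?m)" by (rule tau_rate_bounds(2)[OF p r \<epsilon>])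
  qed (use \<epsilon> in auto)
  also have "\<dots> = (4 + 1 / 8) * (\<epsilon> ^ 3 * ?m) + ?\<Lambda>\<^sup>2 * (\<epsilon> ^ 5 * ?m) + 2 * (1 + ?\<Lambda>\<^sup>2) * (\<epsilon> ^ 5 * ?m)"
  proof -
    have e4: "\<epsilon> ^ 4 = \<epsilon> ^ 3 * \<epsilon>" and e6: "\<epsilon> ^ 6 = \<epsilon> ^ 5 * \<epsilon>" and e5: "\<epsilon> ^ 4 * \<epsilon> = \<epsilon> ^ 5"
      by (simp_all add: eval_nat_numeral)
    have "\<epsilon> ^ 4 / 64 * (2 / \<epsilon> * ?m) = 1 / 32 * (\<epsilon> ^ 3 * ?m)"
      "\<epsilon> ^ 6 / 4 * ((1 + ?\<Lambda>\<^sup>2) * (2 / \<epsilon> * ?m)) = (1 + ?\<Lambda>\<^sup>2) / 2 * (\<epsilon> ^ 5 * ?m)"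
      "\<epsilon> ^ 4 / 4 * (?\<Lambda>\<^sup>2 * (\<epsilon> * ?m)) = ?\<Lambda>\<^sup>2 / 4 * (\<epsilon> ^ 5 * ?m)"
      using \<epsilon>(1) by (simp add: e4, simp add: e6, simp add: e5[symmetric])
    note eqs = this
    show ?thesis unfolding eqs by (simp add: field_simps)
  qed
  also have "\<dots> \<le> (4 + 1 / 8) * (\<epsilon> ^ 3 * ?m) + ?\<Lambda>\<^sup>2 * (\<epsilon> ^ 3 * ?m) + 2 * (1 + ?\<Lambda>\<^sup>2) * (\<epsilon> ^ 3 * ?m)"
    using \<epsilon> by (intro add_mono mult_left_mono mult_right_mono power_decreasing mass_nonneg) auto
  also have "\<dots> = (6 + 1 / 8 + 3 * ?\<Lambda>\<^sup>2) * (\<epsilon> ^ 3 * ?m)" by (simp add: algebra_simps)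
  also have "\<dots> \<le> (16 + 8 * ?\<Lambda>\<^sup>2) * (\<epsilon> ^ 3 * ?m)"
    using \<epsilon> mass_nonneg[of d \<epsilon> x] by (intro mult_right_mono mult_nonneg_nonneg) auto
  finally show ?thesis by (simp add: mult.assoc)
qed

lemma Q_profile_bound:
  assumes p: "profile B r d" and r: "-1 < r" "r \<le> 0" and \<epsilon>: "0 < \<epsilon>" "\<epsilon> \<le> 1"
  shows "(Q \<epsilon> (d 0 x))\<^sup>2 \<le> (2 + 2 * (log_bound B r)\<^sup>2) * (2 / \<epsilon>) * mass d \<epsilon> x"
proof -
  let ?\<Lambda> = "log_bound B r"
  have "0 \<le> sqrt (12 * B)" using profile_range(2)[OF p, of 0] by simp
  then have "\<bar>g (d 0 x) - g 0\<bar> \<le> ?\<Lambda> * \<bar>d 0 x - 0\<bar>"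
    using r by (intro g_lipschitz[OF r(1)] profile_in_range[OF p]) auto
  then have "\<bar>g (d 0 x)\<bar>\<^sup>2 \<le> (?\<Lambda> * \<bar>d 0 x\<bar>)\<^sup>2" by (intro power_mono) (auto simp: g_def)
  then have gg: "(g (d 0 x))\<^sup>2 \<le> ?\<Lambda>\<^sup>2 * (d 0 x)\<^sup>2" by (simp add: power_mult_distrib)
  have "(\<epsilon>\<^sup>2 / 2)\<^sup>2 \<le> 1\<^sup>2" using \<epsilon> power_le_one[of \<epsilon> 2] by (intro power_mono) auto
  then have "(\<epsilon>\<^sup>2 / 2)\<^sup>2 * (g (d 0 x))\<^sup>2 \<le> 1 * (?\<Lambda>\<^sup>2 * (d 0 x)\<^sup>2)" using gg by (intro mult_mono) auto
  moreover have "(Q \<epsilon> (d 0 x))\<^sup>2 \<le> 2 * (d 0 x)\<^sup>2 + 2 * (\<epsilon>\<^sup>2 / 2 * g (d 0 x))\<^sup>2"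
    unfolding Q_def by (rule square_add_le)
  moreover have "(\<epsilon>\<^sup>2 / 2 * g (d 0 x))\<^sup>2 = (\<epsilon>\<^sup>2 / 2)\<^sup>2 * (g (d 0 x))\<^sup>2" by (rule power_mult_distrib)
  moreover have "(2 + 2 * ?\<Lambda>\<^sup>2) * (d 0 x)\<^sup>2 = 2 * (d 0 x)\<^sup>2 + 2 * (1 * (?\<Lambda>\<^sup>2 * (d 0 x)\<^sup>2))"
    by (simp add: algebra_simps)
  ultimately have "(Q \<epsilon> (d 0 x))\<^sup>2 \<le> (2 + 2 * ?\<Lambda>\<^sup>2) * (d 0 x)\<^sup>2" by linarith
  also have "\<dots> \<le> (2 + 2 * ?\<Lambda>\<^sup>2) * (2 / \<epsilon> * mass d \<epsilon> x)"
    by (intro mult_left_mono profile_sample[OF p _ \<epsilon>]) auto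
  finally show ?thesis by (simp only: mult.assoc)
qed

section \<open>The energy estimate\<close>

text \<open>
  Taylor's theorem for the potential \<open>\<Phi>\<close> and for the force \<open>\<phi>\<close>. The last bound is
  the one that must carry the small Lipschitz constant of \<open>\<kappa>\<close>.
\<close>

lemma convex_potential_bounds:
  fixes \<Phi> \<phi> \<kappa> :: "real \<Rightarrow> real"
  assumes \<Phi>: "\<And>x. (\<Phi> has_real_derivative \<phi> x) (at x)" and \<phi>: "\<And>x. (\<phi> has_real_derivative \<kappa> x) (at x)"
    and \<kappa>: "\<And>x. c \<le> \<kappa> x" "\<And>x. \<kappa> x \<le> C" "0 \<le> c" and lip: "\<And>x y. \<bar>\<kappa> x - \<kappa> y\<bar> \<le> L * \<bar>x - y\<bar>" "0 \<le> L"
  shows "c / 2 * u\<^sup>2 \<le> \<Phi> (x + u) - \<Phi> x - \<phi> x * u" "\<Phi> (x + u) - \<Phi> x - \<phi> x * u \<le> C / 2 * u\<^sup>2"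
    and "\<bar>\<phi> (x + u) - \<phi> x\<bar> \<le> C * \<bar>u\<bar>" "\<bar>\<phi> (x + u) - \<phi> x - \<kappa> x * u\<bar> \<le> L * u\<^sup>2"
proof -
  have line: "((\<lambda>s. x + s * u) has_real_derivative u) (at s)" for s
    by (auto intro!: derivative_eq_intros)
  have \<Phi>': "((\<lambda>s. \<Phi> (x + s * u)) has_real_derivative \<phi> (x + s * u) * u) (at s)" for s
    by (rule DERIV_chain2[OF \<Phi> line])
  have \<phi>': "((\<lambda>s. \<phi> (x + s * u)) has_real_derivative \<kappa> (x + s * u) * u) (at s)" for s
    by (rule DERIV_chain2[OF \<phi> line])
  define q where "q m s = (if m = 0 then \<Phi> (x + s * u) else if m = 1 then \<phi> (x + s * u) * u
    else \<kappa> (x + s * u) * u * u)" for m :: nat and s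
  have "(q m has_real_derivative q (Suc m) s) (at s)" if "m < 2" for m s
  proof -
    have "m = 0 \<or> m = 1" using that by linarith
    then show ?thesis using \<Phi>'[of s] DERIV_cmult_right[OF \<phi>'[of s], of u] by (auto simp: q_def[abs_def])
  qed
  from maclaurin_all_derivatives[where q = q and n = 2 and h = 1, OF _ _ this]
  obtain t where "q 0 1 = (\<Sum>m<2. q m 0 / fact m * 1 ^ m) + q 2 t / fact 2 * 1 ^ 2" by auto
  then have eq: "\<Phi> (x + u) - \<Phi> x - \<phi> x * u = \<kappa> (x + t * u) / 2 * u\<^sup>2"
    by (simp add: q_def numeral_2_eq_2 power2_eq_square)
  show "c / 2 * u\<^sup>2 \<le> \<Phi> (x + u) - \<Phi> x - \<phi> x * u" "\<Phi> (x + u) - \<Phi> x - \<phi> x * u \<le> C / 2 * u\<^sup>2"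
    unfolding eq using \<kappa> by (auto intro!: mult_right_mono)
  define q where "q m s = (if m = 0 then \<phi> (x + s * u) else \<kappa> (x + s * u) * u)" for m :: nat and s
  have "(q m has_real_derivative q (Suc m) s) (at s)" if "m < 1" for m s
    using that \<phi>'[of s] by (auto simp: q_def[abs_def])
  from maclaurin_all_derivatives[where q = q and n = 1 and h = 1, OF _ _ this]
  obtain t where t: "0 < t" "t < 1" "q 0 1 = (\<Sum>m<1. q m 0 / fact m * 1 ^ m) + q 1 t / fact 1 * 1 ^ 1" by auto
  then have eq: "\<phi> (x + u) - \<phi> x = \<kappa> (x + t * u) * u" by (simp add: q_def)
  have "\<bar>\<kappa> (x + t * u)\<bar> \<le> C" using \<kappa>(1,2)[of "x + t * u"] \<kappa>(3) by linarith
  then show "\<bar>\<phi> (x + u) - \<phi> x\<bar> \<le> C * \<bar>u\<bar>" unfolding eq abs_mult by (rule mult_right_mono) simp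
  have "\<bar>\<kappa> (x + t * u) - \<kappa> x\<bar> \<le> L * (t * \<bar>u\<bar>)" using lip(1)[of "x + t * u" x] t by (simp add: abs_mult)
  also have "\<dots> \<le> L * (1 * \<bar>u\<bar>)" using t lip(2) by (intro mult_left_mono mult_right_mono) auto
  finally have "\<bar>\<kappa> (x + t * u) - \<kappa> x\<bar> * \<bar>u\<bar> \<le> L * \<bar>u\<bar> * \<bar>u\<bar>" by (intro mult_right_mono) auto
  moreover have "\<phi> (x + u) - \<phi> x - \<kappa> x * u = (\<kappa> (x + t * u) - \<kappa> x) * u" unfolding eq by (simp add: algebra_simps)
  ultimately show "\<bar>\<phi> (x + u) - \<phi> x - \<kappa> x * u\<bar> \<le> L * u\<^sup>2" by (simp add: abs_mult power2_eq_square)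
qed

text \<open>
  A cut-off of finite support. Its increments are at most \<open>1 / N\<close>, so the flux that the cut-off creates at
  infinity is \<open>1 / N\<close> times a bounded quantity and disappears in the limit. This avoids differentiating
  infinite sums.
\<close>

definition tent :: "nat \<Rightarrow> int \<Rightarrow> real" where
  "tent N n = max 0 (1 - \<bar>of_int n\<bar> / of_nat N)"

lemma tent_bounds: "0 \<le> tent N n" "tent N n \<le> 1"
  by (auto simp: tent_def)

lemma tent_zero: "0 < N \<Longrightarrow> int N \<le> \<bar>n\<bar> \<Longrightarrow> tent N n = 0"
proof -
  assume "0 < N" "int N \<le> \<bar>n\<bar>"
  then have "real N \<le> \<bar>of_int n\<bar>" by (metis of_int_abs of_int_le_iff of_int_of_nat_eq)
  then show ?thesis using \<open>0 < N\<close> by (simp add: tent_def)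
qed

lemma tent_step: "0 < N \<Longrightarrow> \<bar>tent N (n - 1) - tent N n\<bar> \<le> 1 / N"
proof -
  assume N: "0 < N"
  have "\<bar>(1 - \<bar>real_of_int (n - 1)\<bar> / N) - (1 - \<bar>real_of_int n\<bar> / N)\<bar> = \<bar>\<bar>real_of_int n\<bar> - \<bar>real_of_int (n - 1)\<bar>\<bar> / N"
    using N by (simp add: abs_divide flip: diff_divide_distrib)
  also have "\<dots> \<le> 1 / N" by (intro divide_right_mono) auto
  finally show ?thesis unfolding tent_def by (auto simp: max_def abs_if split: if_splits)
qed

lemma tent_tendsto: "(\<lambda>N. tent N n) \<longlonglongrightarrow> 1"
proof -
  have "(\<lambda>N. max 0 (1 - \<bar>real_of_int n\<bar> * inverse (real N))) \<longlonglongrightarrow> max 0 (1 - \<bar>real_of_int n\<bar> * 0)"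
    by (intro tendsto_intros lim_inverse_n)
  then show ?thesis by (simp add: tent_def[abs_def] divide_inverse)
qed

lemma tent_summation_by_parts:
  assumes N: "0 < N"
  shows "(\<Sum>n\<in>{- int N..int N}. tent N n * (b (n + 1) - b n)) = (\<Sum>n\<in>{- int N..int N}. (tent N (n - 1) - tent N n) * b n)"
proof -
  have "(\<Sum>n\<in>{- int N..int N}. tent N n * b (n + 1)) = (\<Sum>n\<in>{- int N + 1..int N + 1}. tent N (n - 1) * b n)"
    by (rule sum.reindex_bij_witness[of _ "\<lambda>n. n - 1" "\<lambda>n. n + 1"]) auto
  also have "\<dots> = (\<Sum>n\<in>{- int N..int N + 1}. tent N (n - 1) * b n)"
    using N by (intro sum.mono_neutral_left) (auto intro!: tent_zero)
  also have "\<dots> = (\<Sum>n\<in>{- int N..int N}. tent N (n - 1) * b n)"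
    using N by (intro sum.mono_neutral_right) (auto intro!: tent_zero)
  finally show ?thesis by (simp add: algebra_simps sum_subtractf)
qed

text \<open>
  Write \<open>U = w - X\<close>, \<open>q = p - Y\<close>, \<open>D = \<phi> w - \<phi> X\<close>. The derivative of the energy density is
  \<open>q\<^sub>n (D\<^sub>n - D\<^sub>n\<^sub>-\<^sub>1) + D\<^sub>n (q\<^sub>n\<^sub>+\<^sub>1 - q\<^sub>n)\<close>, a difference of the flux \<open>D\<^sub>n\<^sub>-\<^sub>1 q\<^sub>n\<close>, plus residual terms
  and \<open>(D - \<kappa>(X) U) X'\<close>. The last is quadratic in \<open>U\<close> with the coefficient \<open>L * \<bar>X'\<bar> \<le> H * \<mu>\<close>, so the
  energy grows at most at the rate \<open>\<mu>\<close>; the residuals enter through their squares divided by \<open>\<mu>\<close>.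
  The bound \<open>Z\<close> on the error makes the flux at infinity vanish, so its size is immaterial.
  In the application \<open>\<mu> = \<epsilon>\<^sup>3\<close>, \<open>E\<close> is of order \<open>\<epsilon>\<^sup>9\<close> and \<open>I\<close> of order \<open>\<epsilon>\<^sup>3\<close>.
\<close>

theorem lattice_energy_estimate:
  fixes \<Phi> \<phi> \<kappa> :: "real \<Rightarrow> real" and w p X Y X' R1 R2 :: "real \<Rightarrow> int \<Rightarrow> real"
  assumes \<Phi>: "\<And>x. (\<Phi> has_real_derivative \<phi> x) (at x)" and \<phi>: "\<And>x. (\<phi> has_real_derivative \<kappa> x) (at x)"
    and \<kappa>: "\<And>x. c \<le> \<kappa> x" "\<And>x. \<kappa> x \<le> C" "0 < c" and lip: "\<And>x y. \<bar>\<kappa> x - \<kappa> y\<bar> \<le> L * \<bar>x - y\<bar>" "0 \<le> L"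
    and w: "\<And>t n. ((\<lambda>r. w r n) has_real_derivative p t (n + 1) - p t n) (at t)"
    and p: "\<And>t n. ((\<lambda>r. p r n) has_real_derivative \<phi> (w t n) - \<phi> (w t (n - 1))) (at t)"
    and X: "\<And>t n. t \<in> {a..b} \<Longrightarrow> ((\<lambda>r. X r n) has_real_derivative X' t n) (at t within {a..b})"
    and X': "\<And>t n. t \<in> {a..b} \<Longrightarrow> X' t n = Y t (n + 1) - Y t n + R1 t n"
    and Y: "\<And>t n. t \<in> {a..b} \<Longrightarrow> ((\<lambda>r. Y r n) has_real_derivative \<phi> (X t n) - \<phi> (X t (n - 1)) + R2 t n) (at t within {a..b})"
    and X'_bound: "\<And>t n. t \<in> {a..b} \<Longrightarrow> L * \<bar>X' t n\<bar> \<le> H * \<mu>" and "0 \<le> H" "0 < \<mu>"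
    and R1: "\<And>t A. t \<in> {a..b} \<Longrightarrow> finite A \<Longrightarrow> (\<Sum>n\<in>A. (R1 t n)\<^sup>2) \<le> E"
    and R2: "\<And>t A. t \<in> {a..b} \<Longrightarrow> finite A \<Longrightarrow> (\<Sum>n\<in>A. (R2 t n)\<^sup>2) \<le> E"
    and Zw: "\<And>t A. t \<in> {a..b} \<Longrightarrow> finite A \<Longrightarrow> (\<Sum>n\<in>A. (w t n - X t n)\<^sup>2) \<le> Z"
    and Zp: "\<And>t A. t \<in> {a..b} \<Longrightarrow> finite A \<Longrightarrow> (\<Sum>n\<in>A. (p t n - Y t n)\<^sup>2) \<le> Z"
    and Iw: "\<And>A. finite A \<Longrightarrow> (\<Sum>n\<in>A. (w 0 n - X 0 n)\<^sup>2) \<le> I"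
    and Ip: "\<And>A. finite A \<Longrightarrow> (\<Sum>n\<in>A. (p 0 n - Y 0 n)\<^sup>2) \<le> I"
    and ab: "a \<le> 0" "0 \<le> b" and t: "t \<in> {a..b}" and A: "finite A"
  shows "(\<Sum>n\<in>A. (p t n - Y t n)\<^sup>2 / 2 + c / 2 * (w t n - X t n)\<^sup>2)
    \<le> (1 + C) / 2 * (I + E / \<mu>\<^sup>2) * exp ((1 + C / c + 2 * H / c) * \<mu> * \<bar>t\<bar>)"
proof -
  define U where "U t n = w t n - X t n" for t n
  define q where "q t n = p t n - Y t n" for t n
  define D where "D t n = \<phi> (w t n) - \<phi> (X t n)" for t n
  define S where "S t n = \<Phi> (w t n) - \<Phi> (X t n) - \<phi> (X t n) * U t n" for t n
  define \<Gamma> where "\<Gamma> = 1 + C / c + 2 * H / c"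
  have C: "0 \<le> C" "c \<le> C" using \<kappa>(1,2)[of 0] \<kappa>(3) by auto
  have \<Gamma>: "1 \<le> \<Gamma>" using C \<kappa>(3) \<open>0 \<le> H\<close> by (simp add: \<Gamma>_def)
  have "0 \<le> c" using \<kappa>(3) by simp
  note convex = convex_potential_bounds[OF \<Phi> \<phi> \<kappa>(1,2) \<open>0 \<le> c\<close> lip, where x = "X t n" and u = "U t n" for t n]
  have wU: "X t n + U t n = w t n" for t n by (simp add: U_def)
  have S1: "c / 2 * (U t n)\<^sup>2 \<le> S t n" and S2: "S t n \<le> C / 2 * (U t n)\<^sup>2" for t n
    using convex(1,2)[of t n] by (simp_all add: S_def wU)
  have D1: "\<bar>D t n\<bar> \<le> C * \<bar>U t n\<bar>" and D2: "\<bar>D t n - \<kappa> (X t n) * U t n\<bar> \<le> L * (U t n)\<^sup>2" for t n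
    using convex(3,4)[of t n] by (simp_all add: D_def wU)
  have S0: "0 \<le> S t n" for t n using \<open>0 \<le> c\<close> by (intro order_trans[OF _ S1[of t n]]) simp
  define den' where "den' t n = q t n * (D t n - D t (n - 1) - R2 t n)
      + (D t n * (q t (n + 1) - q t n - R1 t n) + (D t n - \<kappa> (X t n) * U t n) * X' t n)" for t n
  have den': "((\<lambda>r. (q r n)\<^sup>2 / 2 + S r n) has_real_derivative den' s n) (at s within {a..b})" if s: "s \<in> {a..b}" for s n
  proof -
    note w' = has_field_derivative_at_within[OF w[of n s], of "{a..b}"]
      and p' = has_field_derivative_at_within[OF p[of n s], of "{a..b}"]
    have "((\<lambda>r. q r n) has_real_derivative D s n - D s (n - 1) - R2 s n) (at s within {a..b})"
      using DERIV_diff[OF p' Y[OF s]] by (simp add: q_def[abs_def] D_def algebra_simps)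
    from DERIV_cdivide[OF DERIV_power[OF this, of 2], of 2]
    have 1: "((\<lambda>r. (q r n)\<^sup>2 / 2) has_real_derivative q s n * (D s n - D s (n - 1) - R2 s n)) (at s within {a..b})"
      by (simp add: mult.commute)
    have U': "((\<lambda>r. U r n) has_real_derivative (p s (n + 1) - p s n) - X' s n) (at s within {a..b})"
      using DERIV_diff[OF w' X[OF s]] by (simp add: U_def[abs_def])
    have "((\<lambda>r. S r n) has_real_derivative \<phi> (w s n) * (p s (n + 1) - p s n) - \<phi> (X s n) * X' s n
        - (\<kappa> (X s n) * X' s n * U s n + ((p s (n + 1) - p s n) - X' s n) * \<phi> (X s n))) (at s within {a..b})"
      unfolding S_def[abs_def]
      by (intro DERIV_diff DERIV_mult DERIV_chain2[OF \<Phi> w'] DERIV_chain2[OF \<Phi> X[OF s]] DERIV_chain2[OF \<phi> X[OF s]] U')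
    moreover have "\<phi> (w s n) * (p s (n + 1) - p s n) - \<phi> (X s n) * X' s n
        - (\<kappa> (X s n) * X' s n * U s n + ((p s (n + 1) - p s n) - X' s n) * \<phi> (X s n))
      = D s n * (q s (n + 1) - q s n - R1 s n) + (D s n - \<kappa> (X s n) * U s n) * X' s n"
    proof -
      have "q s (n + 1) - q s n - R1 s n = (p s (n + 1) - p s n) - X' s n"
        using X'[OF s, of n] by (simp add: q_def)
      then show ?thesis by (simp only: D_def) (simp add: algebra_simps)
    qed
    ultimately show ?thesis unfolding den'_def using DERIV_add[OF 1] by simp
  qed
  \<comment> \<open>The localized energy, a finite sum, and its time derivative.\<close>
  define e where "e N t = (\<Sum>n\<in>{- int N..int N}. tent N n * ((q t n)\<^sup>2 / 2 + S t n))" for N t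
  define e' where "e' N t = (\<Sum>n\<in>{- int N..int N}. tent N n * den' t n)" for N t
  have e': "(e N has_real_derivative e' N s) (at s within {a..b})" if "s \<in> {a..b}" for N s
    unfolding e_def[abs_def] e'_def by (intro DERIV_sum DERIV_cmult den' that)
  have E0: "0 \<le> E" using R1[OF t, of "{}"] by simp
  \<comment> \<open>Residuals and flux at infinity, in the form of a constant added to the energy in Gronwall's lemma.\<close>
  define K where "K N = ((1 + C) * E / (2 * \<mu>) + C * Z / N) / (\<Gamma> * \<mu>)" for N :: nat
  have e'_bound: "\<bar>e' N s\<bar> \<le> (\<Gamma> * \<mu>) * (e N s + K N)" if s: "s \<in> {a..b}" and N: "0 < N" for N s
  proof -
    let ?J = "{- int N..int N}"
    define \<rho> where "\<rho> = tent N"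
    have \<rho>: "0 \<le> \<rho> n" "\<rho> n \<le> 1" for n unfolding \<rho>_def by (rule tent_bounds)+
    \<comment> \<open>The energy flux between neighbouring sites.\<close>
    define b where "b n = D s (n - 1) * q s n" for n
    have "e' N s = (\<Sum>n\<in>?J. \<rho> n * (b (n + 1) - b n))
        - (\<Sum>n\<in>?J. \<rho> n * (q s n * R2 s n)) - (\<Sum>n\<in>?J. \<rho> n * (D s n * R1 s n))
        + (\<Sum>n\<in>?J. \<rho> n * ((D s n - \<kappa> (X s n) * U s n) * X' s n))"
      unfolding e'_def den'_def b_def \<rho>_def sum_subtractf[symmetric] sum.distrib[symmetric]
      by (intro sum.cong) (auto simp: algebra_simps)
    also have "(\<Sum>n\<in>?J. \<rho> n * (b (n + 1) - b n)) = (\<Sum>n\<in>?J. (\<rho> (n - 1) - \<rho> n) * b n)"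
      unfolding \<rho>_def by (rule tent_summation_by_parts[OF N])
    finally have "\<bar>e' N s\<bar> \<le> (\<Sum>n\<in>?J. \<bar>(\<rho> (n - 1) - \<rho> n) * b n\<bar>)
        + (\<Sum>n\<in>?J. \<bar>\<rho> n * (q s n * R2 s n)\<bar>) + (\<Sum>n\<in>?J. \<bar>\<rho> n * (D s n * R1 s n)\<bar>)
        + (\<Sum>n\<in>?J. \<bar>\<rho> n * ((D s n - \<kappa> (X s n) * U s n) * X' s n)\<bar>)"
      using sum_abs[of "\<lambda>n. (\<rho> (n - 1) - \<rho> n) * b n" ?J] sum_abs[of "\<lambda>n. \<rho> n * (q s n * R2 s n)" ?J]
        sum_abs[of "\<lambda>n. \<rho> n * (D s n * R1 s n)" ?J]
        sum_abs[of "\<lambda>n. \<rho> n * ((D s n - \<kappa> (X s n) * U s n) * X' s n)" ?J]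
      by linarith
    also have "(\<Sum>n\<in>?J. \<bar>(\<rho> (n - 1) - \<rho> n) * b n\<bar>) \<le> C * Z / N"
    proof -
      have "\<bar>(\<rho> (n - 1) - \<rho> n) * b n\<bar> \<le> C / (2 * N) * (U s (n - 1))\<^sup>2 + C / (2 * N) * (q s n)\<^sup>2" for n
      proof -
        have "\<bar>(\<rho> (n - 1) - \<rho> n) * b n\<bar> \<le> 1 / N * \<bar>b n\<bar>"
          unfolding abs_mult \<rho>_def by (intro mult_right_mono tent_step[OF N]) auto
        also have "\<bar>b n\<bar> \<le> C * \<bar>U s (n - 1)\<bar> * \<bar>q s n\<bar>"
          unfolding b_def abs_mult by (intro mult_right_mono D1) auto
        also have "C * \<bar>U s (n - 1)\<bar> * \<bar>q s n\<bar> \<le> C * (((U s (n - 1))\<^sup>2 + (q s n)\<^sup>2) / 2)"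
          unfolding mult.assoc using sum_squares_bound[of "\<bar>U s (n - 1)\<bar>" "\<bar>q s n\<bar>"]
          by (intro mult_left_mono C) simp
        finally show ?thesis using N by (simp add: field_simps)
      qed
      then have "(\<Sum>n\<in>?J. \<bar>(\<rho> (n - 1) - \<rho> n) * b n\<bar>)
          \<le> C / (2 * N) * (\<Sum>n\<in>?J. (U s (n - 1))\<^sup>2) + C / (2 * N) * (\<Sum>n\<in>?J. (q s n)\<^sup>2)"
        unfolding sum_distrib_left sum.distrib[symmetric] by (intro sum_mono)
      also have "(\<Sum>n\<in>?J. (U s (n - 1))\<^sup>2) = (\<Sum>n\<in>(\<lambda>n. n - 1) ` ?J. (U s n)\<^sup>2)"
        by (subst sum.reindex) (auto simp: inj_on_def)
      also have "C / (2 * N) * (\<Sum>n\<in>(\<lambda>n. n - 1) ` ?J. (U s n)\<^sup>2) + C / (2 * N) * (\<Sum>n\<in>?J. (q s n)\<^sup>2)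
          \<le> C / (2 * N) * Z + C / (2 * N) * Z"
        unfolding U_def q_def using C by (intro add_mono mult_left_mono Zw[OF s] Zp[OF s]) auto
      finally show ?thesis using N by (simp add: field_simps)
    qed
    also have "(\<Sum>n\<in>?J. \<bar>\<rho> n * (q s n * R2 s n)\<bar>) \<le> \<mu> * (\<Sum>n\<in>?J. \<rho> n * ((q s n)\<^sup>2 / 2)) + E / (2 * \<mu>)"
    proof -
      have "\<bar>\<rho> n * (q s n * R2 s n)\<bar> \<le> \<mu> * (\<rho> n * ((q s n)\<^sup>2 / 2)) + 1 / (2 * \<mu>) * (R2 s n)\<^sup>2" for n
      proof -
        have "\<bar>q s n * R2 s n\<bar> \<le> \<mu> * ((q s n)\<^sup>2 / 2) + 1 / (2 * \<mu>) * (R2 s n)\<^sup>2"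
          using sum_squares_bound[of "sqrt \<mu> * \<bar>q s n\<bar>" "\<bar>R2 s n\<bar> / sqrt \<mu>"] \<open>0 < \<mu>\<close>
          by (simp add: power_mult_distrib power_divide abs_mult field_simps)
        then have "\<rho> n * \<bar>q s n * R2 s n\<bar> \<le> \<rho> n * (\<mu> * ((q s n)\<^sup>2 / 2) + 1 / (2 * \<mu>) * (R2 s n)\<^sup>2)"
          by (intro mult_left_mono \<rho>)
        also have "\<dots> \<le> \<mu> * (\<rho> n * ((q s n)\<^sup>2 / 2)) + 1 * (1 / (2 * \<mu>) * (R2 s n)\<^sup>2)"
          unfolding distrib_left using \<rho> \<open>0 < \<mu>\<close> by (intro add_mono mult_right_mono) auto
        finally show ?thesis using \<rho>(1)[of n] by (simp add: abs_mult)
      qed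
      then have "(\<Sum>n\<in>?J. \<bar>\<rho> n * (q s n * R2 s n)\<bar>)
          \<le> \<mu> * (\<Sum>n\<in>?J. \<rho> n * ((q s n)\<^sup>2 / 2)) + 1 / (2 * \<mu>) * (\<Sum>n\<in>?J. (R2 s n)\<^sup>2)"
        unfolding sum_distrib_left sum.distrib[symmetric] by (intro sum_mono)
      also have "1 / (2 * \<mu>) * (\<Sum>n\<in>?J. (R2 s n)\<^sup>2) \<le> 1 / (2 * \<mu>) * E"
        using \<open>0 < \<mu>\<close> by (intro mult_left_mono R2[OF s]) auto
      finally show ?thesis by simp
    qed
    also have "(\<Sum>n\<in>?J. \<bar>\<rho> n * (D s n * R1 s n)\<bar>) \<le> C / c * \<mu> * (\<Sum>n\<in>?J. \<rho> n * S s n) + C * E / (2 * \<mu>)"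
    proof -
      have "\<bar>\<rho> n * (D s n * R1 s n)\<bar> \<le> C / c * \<mu> * (\<rho> n * S s n) + C / (2 * \<mu>) * (R1 s n)\<^sup>2" for n
      proof -
        have "\<bar>D s n * R1 s n\<bar> \<le> C * (\<bar>U s n\<bar> * \<bar>R1 s n\<bar>)"
          unfolding abs_mult mult.assoc[symmetric] by (intro mult_right_mono D1) auto
        also have "\<bar>U s n\<bar> * \<bar>R1 s n\<bar> \<le> \<mu> * ((U s n)\<^sup>2 / 2) + 1 / (2 * \<mu>) * (R1 s n)\<^sup>2"
          using sum_squares_bound[of "sqrt \<mu> * \<bar>U s n\<bar>" "\<bar>R1 s n\<bar> / sqrt \<mu>"] \<open>0 < \<mu>\<close>
          by (simp add: power_mult_distrib power_divide abs_mult field_simps)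
        also have "(U s n)\<^sup>2 / 2 \<le> S s n / c"
          using S1[of s n] \<kappa>(3) by (simp add: field_simps)
        finally have "\<bar>D s n * R1 s n\<bar> \<le> C * (\<mu> * (S s n / c) + 1 / (2 * \<mu>) * (R1 s n)\<^sup>2)"
          using C \<open>0 < \<mu>\<close> by (simp add: mult_left_mono)
        then have "\<rho> n * \<bar>D s n * R1 s n\<bar> \<le> \<rho> n * (C * (\<mu> * (S s n / c)) + C * (1 / (2 * \<mu>) * (R1 s n)\<^sup>2))"
          unfolding distrib_left[symmetric, of C] by (intro mult_left_mono \<rho>)
        also have "\<dots> \<le> \<rho> n * (C * (\<mu> * (S s n / c))) + 1 * (C * (1 / (2 * \<mu>) * (R1 s n)\<^sup>2))"
          unfolding distrib_left[of "\<rho> n"] using \<rho> \<open>0 < \<mu>\<close> C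
          by (intro add_mono[OF order_refl] mult_right_mono) auto
        finally show ?thesis using \<rho>(1)[of n] by (simp add: abs_mult mult_ac)
      qed
      then have "(\<Sum>n\<in>?J. \<bar>\<rho> n * (D s n * R1 s n)\<bar>)
          \<le> C / c * \<mu> * (\<Sum>n\<in>?J. \<rho> n * S s n) + C / (2 * \<mu>) * (\<Sum>n\<in>?J. (R1 s n)\<^sup>2)"
        unfolding sum_distrib_left sum.distrib[symmetric] by (intro sum_mono)
      also have "C / (2 * \<mu>) * (\<Sum>n\<in>?J. (R1 s n)\<^sup>2) \<le> C / (2 * \<mu>) * E"
        using \<open>0 < \<mu>\<close> C by (intro mult_left_mono R1[OF s]) auto
      finally show ?thesis by simp
    qed
    also have "(\<Sum>n\<in>?J. \<bar>\<rho> n * ((D s n - \<kappa> (X s n) * U s n) * X' s n)\<bar>) \<le> 2 * H / c * \<mu> * (\<Sum>n\<in>?J. \<rho> n * S s n)"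
    proof -
      have "\<bar>\<rho> n * ((D s n - \<kappa> (X s n) * U s n) * X' s n)\<bar> \<le> 2 * H / c * \<mu> * (\<rho> n * S s n)" for n
      proof -
        have "\<bar>(D s n - \<kappa> (X s n) * U s n) * X' s n\<bar> \<le> L * (U s n)\<^sup>2 * \<bar>X' s n\<bar>"
          unfolding abs_mult by (intro mult_right_mono D2) auto
        also have "\<dots> = (L * \<bar>X' s n\<bar>) * (U s n)\<^sup>2" by simp
        also have "\<dots> \<le> (H * \<mu>) * (2 * S s n / c)"
          using S1[of s n] \<kappa>(3) \<open>0 \<le> H\<close> \<open>0 < \<mu>\<close> by (intro mult_mono X'_bound[OF s]) (auto simp: field_simps)
        finally have "\<rho> n * \<bar>(D s n - \<kappa> (X s n) * U s n) * X' s n\<bar> \<le> \<rho> n * ((H * \<mu>) * (2 * S s n / c))"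
          by (intro mult_left_mono \<rho>)
        then show ?thesis using \<rho>(1)[of n] by (simp add: abs_mult mult_ac)
      qed
      then show ?thesis unfolding sum_distrib_left by (intro sum_mono)
    qed
    finally have main: "\<bar>e' N s\<bar> \<le> C * Z / N + (\<mu> * (\<Sum>n\<in>?J. \<rho> n * ((q s n)\<^sup>2 / 2)) + E / (2 * \<mu>))
        + (C / c * \<mu> * (\<Sum>n\<in>?J. \<rho> n * S s n) + C * E / (2 * \<mu>)) + 2 * H / c * \<mu> * (\<Sum>n\<in>?J. \<rho> n * S s n)"
      by simp
    define a1 where "a1 = (\<Sum>n\<in>?J. \<rho> n * ((q s n)\<^sup>2 / 2))"
    define a2 where "a2 = (\<Sum>n\<in>?J. \<rho> n * S s n)"
    have a: "0 \<le> a1" "0 \<le> a2" unfolding a1_def a2_def using \<rho> S0 by (auto intro!: sum_nonneg)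
    have "e N s = a1 + a2"
      unfolding e_def a1_def a2_def \<rho>_def by (simp add: distrib_left sum.distrib)
    then have "\<Gamma> * \<mu> * e N s = \<Gamma> * \<mu> * a1 + \<Gamma> * \<mu> * a2" by (simp add: distrib_left)
    moreover have "\<mu> * a1 + (C / c * \<mu> * a2 + 2 * H / c * \<mu> * a2) \<le> \<Gamma> * \<mu> * a1 + \<Gamma> * \<mu> * a2"
    proof (intro add_mono)
      show "\<mu> * a1 \<le> \<Gamma> * \<mu> * a1" using \<Gamma> \<open>0 < \<mu>\<close> a by (intro mult_right_mono) auto
      have "(C / c * \<mu> + 2 * H / c * \<mu>) * a2 \<le> (\<Gamma> * \<mu>) * a2"
        using \<open>0 < \<mu>\<close> a by (intro mult_right_mono) (simp_all add: \<Gamma>_def algebra_simps)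
      then show "C / c * \<mu> * a2 + 2 * H / c * \<mu> * a2 \<le> \<Gamma> * \<mu> * a2" by (simp add: distrib_right)
    qed
    moreover have "\<Gamma> * \<mu> * K N = (1 + C) * E / (2 * \<mu>) + C * Z / N"
      using \<Gamma> \<open>0 < \<mu>\<close> by (simp add: K_def)
    moreover have "(1 + C) * E / (2 * \<mu>) = E / (2 * \<mu>) + C * E / (2 * \<mu>)"
      by (simp add: distrib_right add_divide_distrib)
    ultimately show ?thesis
      using main unfolding a1_def[symmetric] a2_def[symmetric] distrib_left by linarith
  qed
  have e_bound: "e N t \<le> ((1 + C) / 2 * I + K N) * exp (\<Gamma> * \<mu> * \<bar>t\<bar>)" if N: "0 < N" for N
  proof -
    have "e N t + K N \<le> (e N 0 + K N) * exp (\<Gamma> * \<mu> * \<bar>t\<bar>)"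
      by (rule gronwall[OF e' e'_bound[OF _ N] ab t])
    also have "e N 0 \<le> (1 + C) / 2 * I"
    proof -
      have "e N 0 \<le> (\<Sum>n\<in>{- int N..int N}. 1 * ((q 0 n)\<^sup>2 / 2 + C / 2 * (U 0 n)\<^sup>2))"
        unfolding e_def using S0 S2 tent_bounds by (intro sum_mono mult_mono add_mono) auto
      also have "\<dots> = 1 / 2 * (\<Sum>n\<in>{- int N..int N}. (q 0 n)\<^sup>2) + C / 2 * (\<Sum>n\<in>{- int N..int N}. (U 0 n)\<^sup>2)"
        unfolding sum_distrib_left sum.distrib[symmetric] by (intro sum.cong) auto
      also have "\<dots> \<le> 1 / 2 * I + C / 2 * I"
        unfolding q_def U_def using C by (intro add_mono mult_left_mono Ip Iw) auto
      finally show ?thesis by (simp add: field_simps)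
    qed
    finally have "e N t + K N \<le> ((1 + C) / 2 * I + K N) * exp (\<Gamma> * \<mu> * \<bar>t\<bar>)"
      by (simp add: mult_right_mono)
    moreover have "0 \<le> K N"
    proof -
      have "0 \<le> Z" using Zw[OF t, of "{}"] by simp
      then show ?thesis unfolding K_def using C E0 \<Gamma> \<open>0 < \<mu>\<close> by auto
    qed
    ultimately show ?thesis by linarith
  qed
  \<comment> \<open>As \<open>N\<close> tends to infinity, the flux term \<open>C * Z / N\<close> disappears and the cut-off tends to one.\<close>
  have lim_rhs: "(\<lambda>N. ((1 + C) / 2 * I + K N) * exp (\<Gamma> * \<mu> * \<bar>t\<bar>))
      \<longlonglongrightarrow> ((1 + C) / 2 * I + ((1 + C) * E / (2 * \<mu>) + C * Z * 0) / (\<Gamma> * \<mu>)) * exp (\<Gamma> * \<mu> * \<bar>t\<bar>)"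
    unfolding K_def divide_inverse[of "C * Z"] using \<Gamma> \<open>0 < \<mu>\<close> by (intro tendsto_intros lim_inverse_n) auto
  have lim_lhs: "(\<lambda>N. \<Sum>n\<in>A. tent N n * ((q t n)\<^sup>2 / 2 + S t n)) \<longlonglongrightarrow> (\<Sum>n\<in>A. 1 * ((q t n)\<^sup>2 / 2 + S t n))"
    by (intro tendsto_intros tent_tendsto)
  have "(\<Sum>n\<in>A. tent N n * ((q t n)\<^sup>2 / 2 + S t n)) \<le> ((1 + C) / 2 * I + K N) * exp (\<Gamma> * \<mu> * \<bar>t\<bar>)" if N: "1 \<le> N" for N
  proof -
    have "(\<Sum>n\<in>A. tent N n * ((q t n)\<^sup>2 / 2 + S t n)) = (\<Sum>n\<in>A \<inter> {- int N..int N}. tent N n * ((q t n)\<^sup>2 / 2 + S t n))"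
      using A N by (intro sum.mono_neutral_right) (auto intro!: tent_zero)
    also have "\<dots> \<le> e N t"
      unfolding e_def using S0 tent_bounds by (intro sum_mono2) (auto intro!: mult_nonneg_nonneg add_nonneg_nonneg)
    also have "\<dots> \<le> ((1 + C) / 2 * I + K N) * exp (\<Gamma> * \<mu> * \<bar>t\<bar>)" using e_bound N by simp
    finally show ?thesis .
  qed
  then have "(\<Sum>n\<in>A. 1 * ((q t n)\<^sup>2 / 2 + S t n))
      \<le> ((1 + C) / 2 * I + ((1 + C) * E / (2 * \<mu>) + C * Z * 0) / (\<Gamma> * \<mu>)) * exp (\<Gamma> * \<mu> * \<bar>t\<bar>)"
    by (intro LIMSEQ_le[OF lim_lhs lim_rhs]) blast
  also have "\<dots> \<le> ((1 + C) / 2 * I + (1 + C) / 2 * (E / \<mu>\<^sup>2)) * exp (\<Gamma> * \<mu> * \<bar>t\<bar>)"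
  proof (intro mult_right_mono add_left_mono)
    have "((1 + C) * E / (2 * \<mu>) + C * Z * 0) / (\<Gamma> * \<mu>) = (1 + C) / 2 * (E / \<mu>\<^sup>2) / \<Gamma>"
      using \<Gamma> \<open>0 < \<mu>\<close> by (simp add: field_simps power2_eq_square)
    also have "\<dots> \<le> (1 + C) / 2 * (E / \<mu>\<^sup>2) / 1"
      using \<Gamma> E0 C \<open>0 < \<mu>\<close> by (intro divide_left_mono) auto
    finally show "((1 + C) * E / (2 * \<mu>) + C * Z * 0) / (\<Gamma> * \<mu>) \<le> (1 + C) / 2 * (E / \<mu>\<^sup>2)" by simp
  qed simp
  finally have "(\<Sum>n\<in>A. (q t n)\<^sup>2 / 2 + S t n) \<le> (1 + C) / 2 * (I + E / \<mu>\<^sup>2) * exp (\<Gamma> * \<mu> * \<bar>t\<bar>)"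
    by (simp add: distrib_left)
  moreover have "(\<Sum>n\<in>A. (q t n)\<^sup>2 / 2 + c / 2 * (U t n)\<^sup>2) \<le> (\<Sum>n\<in>A. (q t n)\<^sup>2 / 2 + S t n)"
    by (intro sum_mono add_left_mono S1)
  ultimately show ?thesis unfolding q_def U_def \<Gamma>_def by linarith
qed

section \<open>A globally Lipschitz extension of the force\<close>

definition clamp_real :: "real \<Rightarrow> real \<Rightarrow> real \<Rightarrow> real" where
  "clamp_real \<alpha> \<beta> x = max \<alpha> (min \<beta> x)"

text \<open>
  The derivative of \<open>V'\<close> inside \<open>{\<alpha>..\<beta>}\<close>, continued by constants. Its
  antiderivative agrees with \<open>V'\<close> inside the interval and is affine outside, so it keeps both the uniform
  convexity of the potential and the \<open>O(\<epsilon>\<^sup>2)\<close> bound on its third derivative.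
\<close>

definition stiffness :: "real \<Rightarrow> real \<Rightarrow> real \<Rightarrow> real \<Rightarrow> real" where
  "stiffness \<epsilon> \<alpha> \<beta> x = (1 + \<epsilon>\<^sup>2) * (1 + clamp_real \<alpha> \<beta> x) powr \<epsilon>\<^sup>2"

text \<open>
  The Lipschitz constant \<open>2 * \<epsilon>\<^sup>2 / (1 + \<alpha>)\<close> bounds \<open>V'''\<close>; its
  smallness reflects that the lattice is a harmonic chain for \<open>\<epsilon> = 0\<close>.
\<close>

lemma stiffness_bounds:
  assumes \<alpha>: "-1 < \<alpha>" "\<alpha> \<le> 0" and \<beta>: "0 \<le> \<beta>" and \<epsilon>: "0 < \<epsilon>" "\<epsilon> \<le> 1"
  shows "1 + \<alpha> \<le> stiffness \<epsilon> \<alpha> \<beta> x" "stiffness \<epsilon> \<alpha> \<beta> x \<le> 2 * (1 + \<beta>)"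
    and "\<bar>stiffness \<epsilon> \<alpha> \<beta> x - stiffness \<epsilon> \<alpha> \<beta> y\<bar> \<le> 2 * \<epsilon>\<^sup>2 / (1 + \<alpha>) * \<bar>x - y\<bar>"
proof -
  have \<epsilon>2: "0 < \<epsilon>\<^sup>2" "\<epsilon>\<^sup>2 \<le> 1" using \<epsilon> by (auto simp: power_le_one)
  have cl: "\<alpha> \<le> clamp_real \<alpha> \<beta> x" "clamp_real \<alpha> \<beta> x \<le> \<beta>" for x
    using \<alpha> \<beta> by (auto simp: clamp_real_def)
  have "1 * (1 + \<alpha>) \<le> (1 + \<epsilon>\<^sup>2) * (1 + clamp_real \<alpha> \<beta> x) powr \<epsilon>\<^sup>2"
  proof (intro mult_mono)
    have "1 + \<alpha> = (1 + \<alpha>) powr 1" using \<alpha> by simp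
    also have "\<dots> \<le> (1 + \<alpha>) powr \<epsilon>\<^sup>2" using \<alpha> \<epsilon>2 by (intro powr_mono') auto
    also have "\<dots> \<le> (1 + clamp_real \<alpha> \<beta> x) powr \<epsilon>\<^sup>2" using \<alpha> cl(1)[of x] \<epsilon>2 by (intro powr_mono2) auto
    finally show "1 + \<alpha> \<le> (1 + clamp_real \<alpha> \<beta> x) powr \<epsilon>\<^sup>2" .
  qed (use \<alpha> \<epsilon>2 in auto)
  then show "1 + \<alpha> \<le> stiffness \<epsilon> \<alpha> \<beta> x" by (simp add: stiffness_def)
  have "(1 + \<epsilon>\<^sup>2) * (1 + clamp_real \<alpha> \<beta> x) powr \<epsilon>\<^sup>2 \<le> 2 * (1 + \<beta>)"
  proof (intro mult_mono)
    have "(1 + clamp_real \<alpha> \<beta> x) powr \<epsilon>\<^sup>2 \<le> (1 + \<beta>) powr \<epsilon>\<^sup>2"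
      using \<alpha> cl[of x] \<epsilon>2 by (intro powr_mono2) auto
    also have "\<dots> \<le> (1 + \<beta>) powr 1" using \<beta> \<epsilon>2 by (intro powr_mono) auto
    finally show "(1 + clamp_real \<alpha> \<beta> x) powr \<epsilon>\<^sup>2 \<le> 1 + \<beta>" using \<beta> by simp
  qed (use \<epsilon>2 in auto)
  then show "stiffness \<epsilon> \<alpha> \<beta> x \<le> 2 * (1 + \<beta>)" by (simp add: stiffness_def)
  let ?s = "\<lambda>z. (1 + \<epsilon>\<^sup>2) * (1 + z) powr \<epsilon>\<^sup>2"
  have "norm (?s (clamp_real \<alpha> \<beta> x) - ?s (clamp_real \<alpha> \<beta> y))
      \<le> 2 * \<epsilon>\<^sup>2 / (1 + \<alpha>) * norm (clamp_real \<alpha> \<beta> x - clamp_real \<alpha> \<beta> y)"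
  proof (rule field_differentiable_bound[of "{\<alpha>..\<beta>}"])
    fix z assume z: "z \<in> {\<alpha>..\<beta>}"
    show "(?s has_field_derivative (1 + \<epsilon>\<^sup>2) * (\<epsilon>\<^sup>2 * (1 + z) powr (\<epsilon>\<^sup>2 - 1))) (at z within {\<alpha>..\<beta>})"
      using z \<alpha> by (auto intro!: derivative_eq_intros)
    have "(1 + z) powr (\<epsilon>\<^sup>2 - 1) \<le> (1 + \<alpha>) powr (\<epsilon>\<^sup>2 - 1)"
      using z \<alpha> \<epsilon>2 by (intro powr_mono2') auto
    also have "\<dots> \<le> (1 + \<alpha>) powr (- 1)" using \<alpha> \<epsilon>2 by (intro powr_mono') auto
    also have "\<dots> = 1 / (1 + \<alpha>)" using \<alpha> by (simp add: powr_minus_divide)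
    finally have "(1 + \<epsilon>\<^sup>2) * (\<epsilon>\<^sup>2 * (1 + z) powr (\<epsilon>\<^sup>2 - 1)) \<le> 2 * (\<epsilon>\<^sup>2 * (1 / (1 + \<alpha>)))"
      using \<epsilon>2 by (intro mult_mono mult_left_mono) auto
    then show "norm ((1 + \<epsilon>\<^sup>2) * (\<epsilon>\<^sup>2 * (1 + z) powr (\<epsilon>\<^sup>2 - 1))) \<le> 2 * \<epsilon>\<^sup>2 / (1 + \<alpha>)"
      using \<epsilon>2 by (simp add: abs_mult)
  qed (use cl in auto)
  also have "\<dots> \<le> 2 * \<epsilon>\<^sup>2 / (1 + \<alpha>) * \<bar>x - y\<bar>"
    using \<alpha> \<epsilon>2 by (intro mult_left_mono) (auto simp: clamp_real_def max_def min_def)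
  finally show "\<bar>stiffness \<epsilon> \<alpha> \<beta> x - stiffness \<epsilon> \<alpha> \<beta> y\<bar> \<le> 2 * \<epsilon>\<^sup>2 / (1 + \<alpha>) * \<bar>x - y\<bar>"
    by (simp add: stiffness_def)
qed

lemma force_extension:
  assumes \<alpha>: "-1 < \<alpha>" "\<alpha> \<le> 0" and \<beta>: "0 \<le> \<beta>" and \<epsilon>: "0 < \<epsilon>" "\<epsilon> \<le> 1"
  obtains \<phi> \<Phi> where "\<And>x. (\<Phi> has_real_derivative \<phi> x) (at x)"
    "\<And>x. (\<phi> has_real_derivative stiffness \<epsilon> \<alpha> \<beta> x) (at x)" "\<phi> 0 = 0"
    "\<And>x. x \<in> {\<alpha>..\<beta>} \<Longrightarrow> \<phi> x = V' \<epsilon> x"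
    "\<And>x y. \<bar>\<phi> x - \<phi> y\<bar> \<le> 2 * (1 + \<beta>) * \<bar>x - y\<bar>"
proof -
  note sb = stiffness_bounds[OF assms]
  have "(2 * \<epsilon>\<^sup>2 / (1 + \<alpha>))-lipschitz_on UNIV (stiffness \<epsilon> \<alpha> \<beta>)"
    by (rule lipschitz_onI) (use sb(3) \<alpha> in \<open>auto simp: dist_real_def\<close>)
  then have "continuous_on UNIV (stiffness \<epsilon> \<alpha> \<beta>)" by (rule lipschitz_on_continuous_on)
  from antiderivative_banach[OF this] obtain \<phi> where \<phi>0: "\<phi> 0 = 0"
    and \<phi>: "\<And>x. (\<phi> has_real_derivative stiffness \<epsilon> \<alpha> \<beta> x) (at x)"
    unfolding has_real_derivative_iff_has_vector_derivative by auto
  have "continuous_on UNIV \<phi>"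
    by (intro continuous_at_imp_continuous_on ballI DERIV_isCont[OF \<phi>])
  from antiderivative_banach[OF this] obtain \<Phi> where
    \<Phi>: "\<And>x. (\<Phi> has_real_derivative \<phi> x) (at x)"
    unfolding has_real_derivative_iff_has_vector_derivative by auto
  have agree: "\<phi> x = V' \<epsilon> x" if x: "x \<in> {\<alpha>..\<beta>}" for x
  proof -
    have "norm ((\<phi> x - V' \<epsilon> x) - (\<phi> 0 - V' \<epsilon> 0)) \<le> 0 * norm (x - 0)"
    proof (rule field_differentiable_bound[of "{\<alpha>..\<beta>}"])
      fix z assume z: "z \<in> {\<alpha>..\<beta>}"
      have "(V' \<epsilon> has_real_derivative (1 + \<epsilon>\<^sup>2) * (1 + z) powr \<epsilon>\<^sup>2) (at z within {\<alpha>..\<beta>})"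
        unfolding V'_def[abs_def] using z \<alpha> by (auto intro!: derivative_eq_intros)
      moreover have "stiffness \<epsilon> \<alpha> \<beta> z = (1 + \<epsilon>\<^sup>2) * (1 + z) powr \<epsilon>\<^sup>2"
        using z by (simp add: stiffness_def clamp_real_def)
      ultimately show "((\<lambda>x. \<phi> x - V' \<epsilon> x) has_field_derivative 0) (at z within {\<alpha>..\<beta>})"
        using DERIV_diff[OF has_field_derivative_at_within[OF \<phi>[of z], of "{\<alpha>..\<beta>}"]] by fastforce
    qed (use x \<alpha> \<beta> in auto)
    then show ?thesis using \<phi>0 by (simp add: V'_def)
  qed
  have "\<bar>\<phi> x - \<phi> y\<bar> \<le> 2 * (1 + \<beta>) * \<bar>x - y\<bar>" for x y
  proof -
    have "norm (\<phi> x - \<phi> y) \<le> 2 * (1 + \<beta>) * norm (x - y)"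
    proof (rule field_differentiable_bound[of UNIV])
      show "norm (stiffness \<epsilon> \<alpha> \<beta> z) \<le> 2 * (1 + \<beta>)" for z
        using sb(1,2)[of z] \<alpha> by simp
    qed (use \<phi> in auto)
    then show ?thesis by simp
  qed
  then show thesis using that \<Phi> \<phi> \<phi>0 agree by blast
qed

section \<open>Sobolev-valued solutions in the moving frame\<close>

lemma has_weak_deriv_diff:
  assumes "square_integrable f" "square_integrable u" "square_integrable h" "square_integrable v"
    "has_weak_deriv k f h" "has_weak_deriv k u v"
  shows "has_weak_deriv k (\<lambda>x. f x - u x) (\<lambda>x. h x - v x)"
  unfolding has_weak_deriv_def
proof (intro allI impI)
  fix \<phi> assume \<phi>: "test_function \<phi>"
  have tk: "test_function ((deriv ^^ k) \<phi>)"
    by (induction k) (use \<phi> test_function_deriv in auto)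
  note loc = locally_integrable_square_integrable[THEN locally_integrable_mult_test(1)]
  have "(LINT x|lborel. (f x - u x) * (deriv ^^ k) \<phi> x)
      = (LINT x|lborel. f x * (deriv ^^ k) \<phi> x) - (LINT x|lborel. u x * (deriv ^^ k) \<phi> x)"
    unfolding left_diff_distrib
    by (rule Bochner_Integration.integral_diff[OF loc[OF assms(1) tk] loc[OF assms(2) tk]])
  also have "\<dots> = (-1) ^ k * ((LINT x|lborel. h x * \<phi> x) - (LINT x|lborel. v x * \<phi> x))"
    using assms(5,6) \<phi> by (simp add: has_weak_deriv_def right_diff_distrib)
  also have "(LINT x|lborel. h x * \<phi> x) - (LINT x|lborel. v x * \<phi> x) = (LINT x|lborel. (h x - v x) * \<phi> x)"
    unfolding left_diff_distrib
    by (rule Bochner_Integration.integral_diff[OF loc[OF assms(3) \<phi>] loc[OF assms(4) \<phi>], symmetric])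
  finally show "(LINT x|lborel. (f x - u x) * (deriv ^^ k) \<phi> x) = (-1) ^ k * (LINT x|lborel. (h x - v x) * \<phi> x)" .
qed

lemma square_integrable_diff:
  assumes "square_integrable f" "square_integrable u"
  shows "square_integrable (\<lambda>x. f x - u x)"
proof -
  have [measurable]: "f \<in> borel_measurable borel" "u \<in> borel_measurable borel"
    and i: "integrable lborel (\<lambda>x. (f x)\<^sup>2)" "integrable lborel (\<lambda>x. (u x)\<^sup>2)"
    using assms by (auto simp: square_integrable_def)
  have "integrable lborel (\<lambda>x. (f x - u x)\<^sup>2)"
  proof (rule Bochner_Integration.integrable_bound)
    show "integrable lborel (\<lambda>x. 2 * (f x)\<^sup>2 + 2 * (u x)\<^sup>2)" using i by auto
    have "(f x - u x)\<^sup>2 \<le> 2 * (f x)\<^sup>2 + 2 * (u x)\<^sup>2" for x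
      using square_add_le[of "f x" "- u x"] by simp
    then show "AE x in lborel. norm ((f x - u x)\<^sup>2) \<le> norm (2 * (f x)\<^sup>2 + 2 * (u x)\<^sup>2)"
      by (intro AE_I2) simp
  qed measurable
  then show ?thesis by (simp add: square_integrable_def)
qed

lemma sobolev_space_diff:
  assumes "f \<in> sobolev_space s" "u \<in> sobolev_space s"
  shows "(\<lambda>x. f x - u x) \<in> sobolev_space s"
proof -
  have si: "square_integrable f" "square_integrable u" using assms by (auto simp: sobolev_space_def)
  have "\<exists>h. square_integrable h \<and> has_weak_deriv k (\<lambda>x. f x - u x) h" if "k \<le> s" for k
  proof -
    note wf = weak_deriv_spec[OF assms(1) that] and wu = weak_deriv_spec[OF assms(2) that]
    show ?thesis
      using has_weak_deriv_diff[OF si conjunct1[OF wf] conjunct1[OF wu] conjunct2[OF wf] conjunct2[OF wu]]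
        square_integrable_diff[OF conjunct1[OF wf] conjunct1[OF wu]] by blast
  qed
  then show ?thesis using square_integrable_diff[OF si] by (simp add: sobolev_space_def)
qed

text \<open>
  Lets the Sobolev norm of a difference of two waves control the difference of their derivatives.
\<close>

lemma iterated_deriv_diff:
  assumes f: "f \<in> sobolev_space s" "continuous_on UNIV f" and u: "u \<in> sobolev_space s" "continuous_on UNIV u"
  shows "k < s \<Longrightarrow> (deriv ^^ k) (\<lambda>x. f x - u x) = (\<lambda>x. (deriv ^^ k) f x - (deriv ^^ k) u x)"
proof (induction k)
  case (Suc k)
  then have k: "k < s" by simp
  have "(deriv ^^ Suc k) (\<lambda>x. f x - u x) = deriv (\<lambda>x. (deriv ^^ k) f x - (deriv ^^ k) u x)"
    using Suc.IH[OF k] by simp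
  also have "\<dots> = (\<lambda>x. (deriv ^^ Suc k) f x - (deriv ^^ Suc k) u x)"
    using sobolev_classical_derivatives(3)[OF f k Suc.prems] sobolev_classical_derivatives(3)[OF u k Suc.prems]
    by (intro ext DERIV_imp_deriv DERIV_diff)
  finally show ?case .
qed simp

lemma profile_of_sobolev:
  assumes "f \<in> sobolev_space s" "continuous_on UNIV f" "6 \<le> s" "\<And>x. r \<le> f x"
  shows "profile ((sobolev_norm s f)\<^sup>2) r (\<lambda>k. (deriv ^^ k) f)"
  unfolding profile_def
  using assms sobolev_classical_derivatives[OF assms(1,2)] sobolev_deriv_L2[OF assms(1,2)] by auto

lemma profile_mono: "profile B r d \<Longrightarrow> B \<le> B' \<Longrightarrow> r' \<le> r \<Longrightarrow> profile B' r' d"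
  unfolding profile_def by (meson order_trans)

definition iter_deriv :: "(real \<Rightarrow> real \<Rightarrow> real) \<Rightarrow> real \<Rightarrow> nat \<Rightarrow> real \<Rightarrow> real" where
  "iter_deriv W \<tau> k = (deriv ^^ k) (\<lambda>x. W x \<tau>)"

lemma iter_deriv_0: "iter_deriv W \<tau> 0 x = W x \<tau>"
  by (simp add: iter_deriv_def)

lemma continuous_into_sobolevD:
  assumes "continuous_into_sobolev s I W" "\<tau> \<in> I"
  shows "(\<lambda>x. W x \<tau>) \<in> sobolev_space s" "continuous_on UNIV (\<lambda>x. W x \<tau>)"
    "((\<lambda>\<sigma>. sobolev_norm s (\<lambda>x. W x \<sigma> - W x \<tau>)) \<longlongrightarrow> 0) (at \<tau> within I)"
  using assms by (auto simp: continuous_into_sobolev_def)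

text \<open>
  The \<open>H\<^sup>s\<close> norm along a continuous curve is locally bounded, hence bounded on a compact interval by
  a finite cover.
\<close>

lemma uniform_profile:
  assumes W: "continuous_into_sobolev s I W" and I: "compact I" and s: "6 \<le> s"
    and r: "\<And>\<tau> x. \<tau> \<in> I \<Longrightarrow> r \<le> W x \<tau>"
  obtains B where "\<And>\<tau>. \<tau> \<in> I \<Longrightarrow> profile B r (iter_deriv W \<tau>)"
proof -
  \<comment> \<open>Valid wherever the Sobolev distance from \<open>W(\<cdot>, \<tau>)\<close> is below one, by \<open>(a + b)\<^sup>2 \<le> 2 a\<^sup>2 + 2 b\<^sup>2\<close>.\<close>
  define M where "M \<tau> = 2 * (sobolev_norm s (\<lambda>x. W x \<tau>))\<^sup>2 + 2" for \<tau>
  have prof: "profile ((sobolev_norm s (\<lambda>x. W x \<tau>))\<^sup>2) r (iter_deriv W \<tau>)" if "\<tau> \<in> I" for \<tau>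
    unfolding iter_deriv_def[abs_def]
    by (rule profile_of_sobolev[OF continuous_into_sobolevD(1,2)[OF W that] s r[OF that]])
  have "\<exists>\<delta>>0. \<forall>\<sigma>\<in>I. \<bar>\<sigma> - \<tau>\<bar> < \<delta> \<longrightarrow> profile (M \<tau>) r (iter_deriv W \<sigma>)" if \<tau>: "\<tau> \<in> I" for \<tau>
  proof -
    have "\<forall>\<^sub>F \<sigma> in at \<tau> within I. dist (sobolev_norm s (\<lambda>x. W x \<sigma> - W x \<tau>)) 0 < 1"
      by (rule tendstoD[OF continuous_into_sobolevD(3)[OF W \<tau>]]) simp
    then obtain \<delta> where \<delta>: "\<delta> > 0" "\<And>\<sigma>. \<sigma> \<in> I \<Longrightarrow> \<sigma> \<noteq> \<tau> \<Longrightarrow> \<bar>\<sigma> - \<tau>\<bar> < \<delta> \<Longrightarrow> \<bar>sobolev_norm s (\<lambda>x. W x \<sigma> - W x \<tau>)\<bar> < 1"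
      unfolding eventually_at dist_real_def by auto
    have "profile (M \<tau>) r (iter_deriv W \<sigma>)" if \<sigma>: "\<sigma> \<in> I" "\<bar>\<sigma> - \<tau>\<bar> < \<delta>" for \<sigma>
    proof (cases "\<sigma> = \<tau>")
      case True
      have "(sobolev_norm s (\<lambda>x. W x \<tau>))\<^sup>2 \<le> M \<tau>" unfolding M_def by simp
      then show ?thesis using profile_mono[OF prof[OF \<tau>] _ order_refl] True by blast
    next
      case False
      note f\<sigma> = continuous_into_sobolevD(1,2)[OF W \<sigma>(1)] and f\<tau> = continuous_into_sobolevD(1,2)[OF W \<tau>]
      have diff: "(\<lambda>x. W x \<sigma> - W x \<tau>) \<in> sobolev_space s" "continuous_on UNIV (\<lambda>x. W x \<sigma> - W x \<tau>)"
        by (rule sobolev_space_diff[OF f\<sigma>(1) f\<tau>(1)]) (intro continuous_intros f\<sigma>(2) f\<tau>(2))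
      have n1: "(sobolev_norm s (\<lambda>x. W x \<sigma> - W x \<tau>))\<^sup>2 \<le> 1"
        using \<delta>(2)[OF \<sigma>(1) False \<sigma>(2)] by (simp add: abs_square_le_1)
      have "(LINT x|lborel. (iter_deriv W \<sigma> k x)\<^sup>2) \<le> M \<tau>" if k: "k \<le> 5" for k
      proof -
        have ks: "k < s" using k s by simp
        have i: "integrable lborel (\<lambda>x. ((deriv ^^ k) (\<lambda>x. W x \<sigma> - W x \<tau>) x)\<^sup>2)"
          "integrable lborel (\<lambda>x. (iter_deriv W \<tau> k x)\<^sup>2)" "integrable lborel (\<lambda>x. (iter_deriv W \<sigma> k x)\<^sup>2)"
          unfolding iter_deriv_def by (rule sobolev_deriv_L2(1)[OF _ _ ks], fact+)+
        have "(LINT x|lborel. (iter_deriv W \<sigma> k x)\<^sup>2)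
            \<le> (LINT x|lborel. 2 * (iter_deriv W \<tau> k x)\<^sup>2 + 2 * ((deriv ^^ k) (\<lambda>x. W x \<sigma> - W x \<tau>) x)\<^sup>2)"
        proof (intro integral_mono i Bochner_Integration.integrable_add integrable_mult_right)
          fix x
          have "iter_deriv W \<sigma> k x = iter_deriv W \<tau> k x + (deriv ^^ k) (\<lambda>x. W x \<sigma> - W x \<tau>) x"
            unfolding iterated_deriv_diff[OF f\<sigma> f\<tau> ks] iter_deriv_def by simp
          then show "(iter_deriv W \<sigma> k x)\<^sup>2 \<le> 2 * (iter_deriv W \<tau> k x)\<^sup>2 + 2 * ((deriv ^^ k) (\<lambda>x. W x \<sigma> - W x \<tau>) x)\<^sup>2"
            using square_add_le by simp
        qed
        also have "\<dots> = 2 * (LINT x|lborel. (iter_deriv W \<tau> k x)\<^sup>2) + 2 * (LINT x|lborel. ((deriv ^^ k) (\<lambda>x. W x \<sigma> - W x \<tau>) x)\<^sup>2)"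
          using i by simp
        also have "\<dots> \<le> 2 * (sobolev_norm s (\<lambda>x. W x \<tau>))\<^sup>2 + 2 * 1"
          using profileD(3)[OF prof[OF \<tau>] k] sobolev_deriv_L2(2)[OF diff ks] n1 by linarith
        finally show ?thesis by (simp add: M_def)
      qed
      then show ?thesis using prof[OF \<sigma>(1)] by (simp add: profile_def)
    qed
    then show ?thesis using \<delta>(1) by blast
  qed
  then have "\<forall>\<tau>. \<exists>\<delta>. \<tau> \<in> I \<longrightarrow> \<delta> > 0 \<and> (\<forall>\<sigma>\<in>I. \<bar>\<sigma> - \<tau>\<bar> < \<delta> \<longrightarrow> profile (M \<tau>) r (iter_deriv W \<sigma>))" by blast
  from choice[OF this] obtain \<delta> where
    \<delta>: "\<And>\<tau>. \<tau> \<in> I \<Longrightarrow> \<delta> \<tau> > 0 \<and> (\<forall>\<sigma>\<in>I. \<bar>\<sigma> - \<tau>\<bar> < \<delta> \<tau> \<longrightarrow> profile (M \<tau>) r (iter_deriv W \<sigma>))" by blast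
  have "I \<subseteq> (\<Union>\<tau>\<in>I. ball \<tau> (\<delta> \<tau>))" using \<delta> by force
  then obtain T where T: "T \<subseteq> I" "finite T" "I \<subseteq> (\<Union>\<tau>\<in>T. ball \<tau> (\<delta> \<tau>))"
    by (rule compactE_image[OF I, rotated]) auto
  show thesis
  proof (rule that[of "\<Sum>\<tau>\<in>T. M \<tau>"])
    fix \<sigma> assume \<sigma>: "\<sigma> \<in> I"
    then obtain \<tau> where \<tau>: "\<tau> \<in> T" "\<bar>\<sigma> - \<tau>\<bar> < \<delta> \<tau>"
      using T(3) by (auto simp: dist_real_def abs_minus_commute)
    have "M \<tau> \<le> (\<Sum>\<tau>\<in>T. M \<tau>)" using T(2) \<tau>(1) by (intro member_le_sum) (auto simp: M_def)
    moreover have "profile (M \<tau>) r (iter_deriv W \<sigma>)" using \<delta>[of \<tau>] \<tau> T(1) \<sigma> by blast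
    ultimately show "profile (\<Sum>\<tau>\<in>T. M \<tau>) r (iter_deriv W \<sigma>)" using profile_mono by blast
  qed
qed

text \<open>
  The supremum norm of the first derivative of \<open>W(\<cdot>, \<sigma>) - W(\<cdot>, \<tau>)\<close> is controlled by
  its Sobolev norm. The lower bound \<open>- 2 * sqrt (12 * B)\<close> only serves to view this difference as a profile.
\<close>

lemma first_deriv_modulus:
  assumes W: "continuous_into_sobolev s I W" and s: "6 \<le> s" and "\<sigma> \<in> I" "\<tau> \<in> I"
    and p: "profile B r (iter_deriv W \<sigma>)" "profile B r (iter_deriv W \<tau>)"
  shows "\<bar>iter_deriv W \<sigma> 1 x - iter_deriv W \<tau> 1 x\<bar> \<le> sqrt 12 * \<bar>sobolev_norm s (\<lambda>x. W x \<sigma> - W x \<tau>)\<bar>"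
proof -
  note f\<sigma> = continuous_into_sobolevD(1,2)[OF W \<open>\<sigma> \<in> I\<close>] and f\<tau> = continuous_into_sobolevD(1,2)[OF W \<open>\<tau> \<in> I\<close>]
  have "- 2 * sqrt (12 * B) \<le> W x \<sigma> - W x \<tau>" for x
    using profile_range(1)[OF p(1), of 0 x] profile_range(1)[OF p(2), of 0 x] by (simp add: iter_deriv_0)
  from profile_of_sobolev[OF sobolev_space_diff[OF f\<sigma>(1) f\<tau>(1)] continuous_on_diff[OF f\<sigma>(2) f\<tau>(2)] s this]
  have "\<bar>(deriv ^^ 1) (\<lambda>x. W x \<sigma> - W x \<tau>) x\<bar> \<le> sqrt (12 * (sobolev_norm s (\<lambda>x. W x \<sigma> - W x \<tau>))\<^sup>2)"
    by (rule profile_range(1)) simp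
  moreover have "1 < s" using s by simp
  ultimately show ?thesis
    using iterated_deriv_diff[OF f\<sigma> f\<tau> \<open>1 < s\<close>] by (simp add: iter_deriv_def real_sqrt_mult)
qed

lemma log_KdV_tau_rate:
  assumes "log_KdV_solution I W" "\<tau> \<in> I" and p: "profile B r (iter_deriv W \<tau>)" and r: "-1 < r"
  shows "((\<lambda>\<sigma>. W x \<sigma>) has_real_derivative tau_rate (iter_deriv W \<tau>) x) (at \<tau> within I)"
proof -
  obtain D where D: "((\<lambda>\<sigma>. W x \<sigma>) has_real_derivative D) (at \<tau> within I)"
    "2 * D + 1 / 12 * (deriv ^^ 3) (\<lambda>x. W x \<tau>) x + deriv (\<lambda>x. g (W x \<tau>)) x = 0"
    using assms(1,2) unfolding log_KdV_solution_def by blast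
  have "deriv (\<lambda>x. g (W x \<tau>)) x = (1 + ln (1 + W x \<tau>)) * iter_deriv W \<tau> 1 x"
  proof (rule DERIV_imp_deriv, rule DERIV_chain2[OF g_deriv])
    show "-1 < W x \<tau>" using profileD(5)[OF p, of x] r by (simp add: iter_deriv_0)
    show "((\<lambda>x. W x \<tau>) has_real_derivative iter_deriv W \<tau> 1 x) (at x)"
      using profileD(4)[OF p, of 0 x] by (simp add: iter_deriv_def)
  qed
  then have "D = tau_rate (iter_deriv W \<tau>) x"
    using D(2) by (simp add: tau_rate_def iter_deriv_def)
  then show ?thesis using D(1) by simp
qed

text \<open>
  The chain rule along the curve \<open>u \<mapsto> (\<epsilon> (x - u) + c, \<epsilon>\<^sup>3 u)\<close>.
  Differentiability of \<open>W\<close> in both variables separately is not enough; the additional information is that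
  \<open>W\<^sub>\<xi>\<close> depends continuously on \<open>\<tau>\<close>, uniformly in \<open>\<xi>\<close>.
\<close>

lemma moving_frame_derivative:
  assumes W: "continuous_into_sobolev s I W" and sol: "log_KdV_solution I W" and s: "6 \<le> s" and r: "-1 < r"
    and p: "\<And>\<tau>. \<tau> \<in> I \<Longrightarrow> profile B r (iter_deriv W \<tau>)"
    and J: "\<And>t. t \<in> J \<Longrightarrow> \<epsilon> ^ 3 * t \<in> I" and \<epsilon>: "0 < \<epsilon>" and t: "t \<in> J"
  shows "((\<lambda>u. W (\<epsilon> * (x - u) + c) (\<epsilon> ^ 3 * u)) has_real_derivative
      time_rate (iter_deriv W (\<epsilon> ^ 3 * t)) \<epsilon> (\<epsilon> * (x - t) + c)) (at t within J)"
proof -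
  define \<tau> where "\<tau> = \<epsilon> ^ 3 * t"
  define \<xi> where "\<xi> u = \<epsilon> * (x - u) + c" for u
  have \<tau>: "\<tau> \<in> I" unfolding \<tau>_def by (rule J[OF t])
  have scale: "((\<lambda>u. \<epsilon> ^ 3 * u) has_real_derivative \<epsilon> ^ 3) (at t within J)"
    by (auto intro!: derivative_eq_intros)
  have "((\<lambda>\<sigma>. W (\<xi> t) \<sigma>) has_real_derivative tau_rate (iter_deriv W \<tau>) (\<xi> t)) (at (\<epsilon> ^ 3 * t) within (\<lambda>u. \<epsilon> ^ 3 * u) ` J)"
    unfolding \<tau>_def[symmetric]
    by (rule DERIV_subset[OF log_KdV_tau_rate[OF sol \<tau> p[OF \<tau>] r]]) (use J in auto)
  from DERIV_image_chain[OF this scale]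
  have 1: "((\<lambda>u. W (\<xi> t) (\<epsilon> ^ 3 * u)) has_real_derivative tau_rate (iter_deriv W \<tau>) (\<xi> t) * \<epsilon> ^ 3) (at t within J)"
    by (simp add: o_def)
  let ?\<omega> = "\<lambda>\<sigma>. sobolev_norm s (\<lambda>x. W x \<sigma> - W x \<tau>)" and ?S = "sqrt (12 * B)"
  have 2: "((\<lambda>u. W (\<xi> u) (\<epsilon> ^ 3 * u) - W (\<xi> t) (\<epsilon> ^ 3 * u)) has_real_derivative - \<epsilon> * iter_deriv W \<tau> 1 (\<xi> t)) (at t within J)"
    unfolding has_field_derivative_iff
  proof (rule LIM_zero_cancel, rule Lim_null_comparison)
    show "\<forall>\<^sub>F u in at t within J. norm ((W (\<xi> u) (\<epsilon> ^ 3 * u) - W (\<xi> t) (\<epsilon> ^ 3 * u)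
          - (W (\<xi> t) (\<epsilon> ^ 3 * t) - W (\<xi> t) (\<epsilon> ^ 3 * t))) / (u - t) - - \<epsilon> * iter_deriv W \<tau> 1 (\<xi> t))
        \<le> \<epsilon> * (sqrt 12 * \<bar>?\<omega> (\<epsilon> ^ 3 * u)\<bar> + ?S * \<bar>\<xi> u - \<xi> t\<bar>)"
      unfolding eventually_at_filter
    proof (intro always_eventually allI impI)
      fix u assume "u \<noteq> t" "u \<in> J"
      then have \<sigma>: "\<epsilon> ^ 3 * u \<in> I" by (intro J)
      have step: "\<xi> u - \<xi> t = - \<epsilon> * (u - t)" by (simp add: \<xi>_def algebra_simps)
      have "\<xi> u \<noteq> \<xi> t" using step \<open>u \<noteq> t\<close> \<epsilon> by auto
      have dW: "((\<lambda>x. W x (\<epsilon> ^ 3 * u)) has_real_derivative iter_deriv W (\<epsilon> ^ 3 * u) 1 z) (at z)" for z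
        using profileD(4)[OF p[OF \<sigma>], of 0 z] by (simp add: iter_deriv_def)
      have "\<exists>z. \<bar>z - \<xi> t\<bar> \<le> \<bar>\<xi> u - \<xi> t\<bar> \<and> W (\<xi> u) (\<epsilon> ^ 3 * u) - W (\<xi> t) (\<epsilon> ^ 3 * u) = (\<xi> u - \<xi> t) * iter_deriv W (\<epsilon> ^ 3 * u) 1 z"
      proof (cases "\<xi> t < \<xi> u")
        case True
        from MVT2[OF this dW] obtain z where "\<xi> t < z" "z < \<xi> u"
          "W (\<xi> u) (\<epsilon> ^ 3 * u) - W (\<xi> t) (\<epsilon> ^ 3 * u) = (\<xi> u - \<xi> t) * iter_deriv W (\<epsilon> ^ 3 * u) 1 z" by auto
        then show ?thesis by (intro exI[of _ z]) auto
      next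
        case False
        then have "\<xi> u < \<xi> t" using \<open>\<xi> u \<noteq> \<xi> t\<close> by simp
        from MVT2[OF this dW] obtain z where "\<xi> u < z" "z < \<xi> t"
          "W (\<xi> t) (\<epsilon> ^ 3 * u) - W (\<xi> u) (\<epsilon> ^ 3 * u) = (\<xi> t - \<xi> u) * iter_deriv W (\<epsilon> ^ 3 * u) 1 z" by auto
        then show ?thesis by (intro exI[of _ z]) (auto simp: algebra_simps)
      qed
      then obtain z where z: "\<bar>z - \<xi> t\<bar> \<le> \<bar>\<xi> u - \<xi> t\<bar>"
        "W (\<xi> u) (\<epsilon> ^ 3 * u) - W (\<xi> t) (\<epsilon> ^ 3 * u) = (\<xi> u - \<xi> t) * iter_deriv W (\<epsilon> ^ 3 * u) 1 z" by blast
      have "(W (\<xi> u) (\<epsilon> ^ 3 * u) - W (\<xi> t) (\<epsilon> ^ 3 * u)) / (u - t) = - \<epsilon> * iter_deriv W (\<epsilon> ^ 3 * u) 1 z"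
        unfolding z(2) step using \<open>u \<noteq> t\<close> by simp
      then have "norm ((W (\<xi> u) (\<epsilon> ^ 3 * u) - W (\<xi> t) (\<epsilon> ^ 3 * u)
          - (W (\<xi> t) (\<epsilon> ^ 3 * t) - W (\<xi> t) (\<epsilon> ^ 3 * t))) / (u - t) - - \<epsilon> * iter_deriv W \<tau> 1 (\<xi> t))
        = \<bar>\<epsilon> * (iter_deriv W \<tau> 1 (\<xi> t) - iter_deriv W (\<epsilon> ^ 3 * u) 1 z)\<bar>"
        by (simp add: algebra_simps)
      also have "\<dots> = \<epsilon> * \<bar>iter_deriv W \<tau> 1 (\<xi> t) - iter_deriv W (\<epsilon> ^ 3 * u) 1 z\<bar>"
        using \<epsilon> by (simp add: abs_mult)
      also have "\<bar>iter_deriv W \<tau> 1 (\<xi> t) - iter_deriv W (\<epsilon> ^ 3 * u) 1 z\<bar>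
          \<le> \<bar>iter_deriv W (\<epsilon> ^ 3 * u) 1 z - iter_deriv W \<tau> 1 z\<bar> + \<bar>iter_deriv W \<tau> 1 z - iter_deriv W \<tau> 1 (\<xi> t)\<bar>"
        by linarith
      also have "\<bar>iter_deriv W (\<epsilon> ^ 3 * u) 1 z - iter_deriv W \<tau> 1 z\<bar> \<le> sqrt 12 * \<bar>?\<omega> (\<epsilon> ^ 3 * u)\<bar>"
        by (rule first_deriv_modulus[OF W s \<sigma> \<tau> p[OF \<sigma>] p[OF \<tau>]])
      also have "\<bar>iter_deriv W \<tau> 1 z - iter_deriv W \<tau> 1 (\<xi> t)\<bar> \<le> ?S * \<bar>\<xi> u - \<xi> t\<bar>"
      proof -
        have "norm (iter_deriv W \<tau> 1 z - iter_deriv W \<tau> 1 (\<xi> t)) \<le> ?S * norm (z - \<xi> t)"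
        proof (rule field_differentiable_bound[of UNIV])
          show "(iter_deriv W \<tau> 1 has_field_derivative iter_deriv W \<tau> 2 y) (at y within UNIV)" for y
            using profileD(4)[OF p[OF \<tau>], of 1 y] by (simp add: numeral_2_eq_2)
          show "norm (iter_deriv W \<tau> 2 y) \<le> ?S" for y
            using profile_range(1)[OF p[OF \<tau>], of 2 y] by simp
        qed auto
        also have "\<dots> \<le> ?S * \<bar>\<xi> u - \<xi> t\<bar>"
          using z(1) profile_range(2)[OF p[OF \<tau>], of 0] by (intro mult_left_mono) auto
        finally show ?thesis by simp
      qed
      finally show "norm ((W (\<xi> u) (\<epsilon> ^ 3 * u) - W (\<xi> t) (\<epsilon> ^ 3 * u)
          - (W (\<xi> t) (\<epsilon> ^ 3 * t) - W (\<xi> t) (\<epsilon> ^ 3 * t))) / (u - t) - - \<epsilon> * iter_deriv W \<tau> 1 (\<xi> t))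
        \<le> \<epsilon> * (sqrt 12 * \<bar>?\<omega> (\<epsilon> ^ 3 * u)\<bar> + ?S * \<bar>\<xi> u - \<xi> t\<bar>)"
        using \<epsilon> by (simp add: mult_left_mono)
    qed
    have "((\<lambda>u. \<epsilon> ^ 3 * u) \<longlongrightarrow> \<tau>) (at t within J)" unfolding \<tau>_def by (intro tendsto_intros)
    moreover have "\<forall>\<^sub>F u in at t within J. \<epsilon> ^ 3 * u \<in> I - {\<tau>}"
      using J \<epsilon> by (auto simp: eventually_at_filter \<tau>_def)
    ultimately have "filterlim (\<lambda>u. \<epsilon> ^ 3 * u) (at \<tau> within I) (at t within J)"
      by (auto simp: filterlim_at elim: eventually_mono)
    from filterlim_compose[OF continuous_into_sobolevD(3)[OF W \<tau>] this]
    have "((\<lambda>u. ?\<omega> (\<epsilon> ^ 3 * u)) \<longlongrightarrow> 0) (at t within J)" .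
    then have "((\<lambda>u. \<epsilon> * (sqrt 12 * \<bar>?\<omega> (\<epsilon> ^ 3 * u)\<bar> + ?S * \<bar>\<xi> u - \<xi> t\<bar>)) \<longlongrightarrow> \<epsilon> * (sqrt 12 * \<bar>0\<bar> + ?S * \<bar>\<xi> t - \<xi> t\<bar>)) (at t within J)"
      unfolding \<xi>_def by (intro tendsto_intros)
    then show "((\<lambda>u. \<epsilon> * (sqrt 12 * \<bar>?\<omega> (\<epsilon> ^ 3 * u)\<bar> + ?S * \<bar>\<xi> u - \<xi> t\<bar>)) \<longlongrightarrow> 0) (at t within J)" by simp
  qed
  from DERIV_add[OF 1 2]
  show ?thesis unfolding time_rate_def \<xi>_def \<tau>_def by (simp add: algebra_simps)
qed

section \<open>Justification of the log-KdV approximation\<close>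

text \<open>
  The wave and its momentum seen by the lattice at time \<open>t\<close>. The momentum is evaluated half a cell behind
  the wave.
\<close>

definition ansatz_w :: "(real \<Rightarrow> real \<Rightarrow> real) \<Rightarrow> real \<Rightarrow> real \<Rightarrow> int \<Rightarrow> real" where
  "ansatz_w W \<epsilon> t n = W (\<epsilon> * (of_int n - t)) (\<epsilon> ^ 3 * t)"

definition ansatz_p :: "(real \<Rightarrow> real \<Rightarrow> real) \<Rightarrow> real \<Rightarrow> real \<Rightarrow> int \<Rightarrow> real" where
  "ansatz_p W \<epsilon> t n = - Q \<epsilon> (W (\<epsilon> * (of_int n - t) - \<epsilon> / 2) (\<epsilon> ^ 3 * t))"

text \<open>
  The ansatz solves the lattice equations up to the two residuals.
\<close>

lemma ansatz_equations:
  assumes W: "continuous_into_sobolev s I W" and sol: "log_KdV_solution I W" and s: "6 \<le> s" and r: "-1 < r"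
    and p: "\<And>\<tau>. \<tau> \<in> I \<Longrightarrow> profile B r (iter_deriv W \<tau>)"
    and J: "\<And>t. t \<in> J \<Longrightarrow> \<epsilon> ^ 3 * t \<in> I" and \<epsilon>: "0 < \<epsilon>" and t: "t \<in> J"
  defines "d \<equiv> iter_deriv W (\<epsilon> ^ 3 * t)" and "\<xi> \<equiv> \<lambda>n::int. \<epsilon> * (of_int n - t)"
  shows "((\<lambda>u. ansatz_w W \<epsilon> u n) has_real_derivative time_rate d \<epsilon> (\<xi> n)) (at t within J)"
    and "time_rate d \<epsilon> (\<xi> n) = ansatz_p W \<epsilon> t (n + 1) - ansatz_p W \<epsilon> t n + residual1 d \<epsilon> (\<xi> n)"
    and "((\<lambda>u. ansatz_p W \<epsilon> u n) has_real_derivative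
      V' \<epsilon> (ansatz_w W \<epsilon> t n) - V' \<epsilon> (ansatz_w W \<epsilon> t (n - 1)) + residual2 d \<epsilon> (\<xi> n - \<epsilon> / 2)) (at t within J)"
proof -
  note mf = moving_frame_derivative[OF W sol s r p J \<epsilon> t]
  show "((\<lambda>u. ansatz_w W \<epsilon> u n) has_real_derivative time_rate d \<epsilon> (\<xi> n)) (at t within J)"
    using mf[of "of_int n" 0] by (simp add: ansatz_w_def[abs_def] d_def \<xi>_def)
  have shift: "\<xi> n + \<epsilon> / 2 = \<epsilon> * (of_int (n + 1) - t) - \<epsilon> / 2" "\<xi> n - \<epsilon> / 2 - \<epsilon> / 2 = \<epsilon> * (of_int (n - 1) - t)"
    by (simp_all add: \<xi>_def algebra_simps)
  show "time_rate d \<epsilon> (\<xi> n) = ansatz_p W \<epsilon> t (n + 1) - ansatz_p W \<epsilon> t n + residual1 d \<epsilon> (\<xi> n)"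
    unfolding residual1_def ansatz_p_def d_def iter_deriv_0 shift(1) by (simp add: \<xi>_def)
  let ?y = "\<xi> n - \<epsilon> / 2"
  have pos: "-1 < W ?y (\<epsilon> ^ 3 * t)"
    using profileD(5)[OF p[OF J[OF t]], of ?y] r by (simp add: iter_deriv_0)
  have 1: "((\<lambda>u. W (\<epsilon> * (of_int n - u) - \<epsilon> / 2) (\<epsilon> ^ 3 * u)) has_real_derivative time_rate d \<epsilon> ?y) (at t within J)"
    using mf[of "of_int n" "- (\<epsilon> / 2)"] by (simp add: d_def \<xi>_def)
  have "(g has_real_derivative 1 + ln (1 + W ?y (\<epsilon> ^ 3 * t))) (at (W (\<epsilon> * (of_int n - t) - \<epsilon> / 2) (\<epsilon> ^ 3 * t)))"
    using g_deriv[OF pos] by (simp add: \<xi>_def)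
  from DERIV_minus[OF DERIV_add[OF 1 DERIV_cmult[OF DERIV_chain2[OF this 1], of "\<epsilon>\<^sup>2 / 2"]]]
  have "((\<lambda>u. ansatz_p W \<epsilon> u n) has_real_derivative
      - (time_rate d \<epsilon> ?y + \<epsilon>\<^sup>2 / 2 * ((1 + ln (1 + W ?y (\<epsilon> ^ 3 * t))) * time_rate d \<epsilon> ?y))) (at t within J)"
    by (simp add: ansatz_p_def[abs_def] Q_def)
  moreover have "- (time_rate d \<epsilon> ?y + \<epsilon>\<^sup>2 / 2 * ((1 + ln (1 + W ?y (\<epsilon> ^ 3 * t))) * time_rate d \<epsilon> ?y))
      = V' \<epsilon> (ansatz_w W \<epsilon> t n) - V' \<epsilon> (ansatz_w W \<epsilon> t (n - 1)) + residual2 d \<epsilon> ?y"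
    unfolding residual2_def ansatz_w_def d_def iter_deriv_0 shift(2) by (simp add: \<xi>_def algebra_simps)
  ultimately show "((\<lambda>u. ansatz_p W \<epsilon> u n) has_real_derivative
      V' \<epsilon> (ansatz_w W \<epsilon> t n) - V' \<epsilon> (ansatz_w W \<epsilon> t (n - 1)) + residual2 d \<epsilon> ?y) (at t within J)"
    by (simp only:)
qed

definition residual_const :: "real \<Rightarrow> real \<Rightarrow> real" where
  "residual_const B r = 2 + (g_profile_bound B r)\<^sup>2 + residual2_const B r"

lemma residual2_const_nonneg: "0 \<le> residual2_const B r"
  by (simp add: residual2_const_def)

text \<open>
  Sums the pointwise bounds over the lattice. The exponents show the cost of sampling: \<open>\<epsilon>\<^sup>9\<close>
  for the squared residuals has already absorbed the factor \<open>1 / \<epsilon>\<close>.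
\<close>

lemma ansatz_sums:
  assumes p: "profile B r (iter_deriv W (\<epsilon> ^ 3 * t))" and r: "-1 < r" "r \<le> 0" and \<epsilon>: "0 < \<epsilon>" "\<epsilon> \<le> 1"
    and A: "finite A"
  defines "d \<equiv> iter_deriv W (\<epsilon> ^ 3 * t)" and "\<xi> \<equiv> \<lambda>n::int. \<epsilon> * (of_int n - t)"
  shows "(\<Sum>n\<in>A. (ansatz_w W \<epsilon> t n)\<^sup>2) \<le> 2 / \<epsilon> * (6 * B)"
    and "(\<Sum>n\<in>A. (ansatz_p W \<epsilon> t n)\<^sup>2) \<le> (2 + 2 * (log_bound B r)\<^sup>2) * (2 / \<epsilon>) * (6 * B)"
    and "(\<Sum>n\<in>A. (residual1 d \<epsilon> (\<xi> n))\<^sup>2) \<le> residual_const B r * \<epsilon> ^ 9 * (6 * B)"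
    and "(\<Sum>n\<in>A. (residual2 d \<epsilon> (\<xi> n - \<epsilon> / 2))\<^sup>2) \<le> residual_const B r * \<epsilon> ^ 9 * (6 * B)"
    and "(\<Sum>n\<in>A. (P W \<epsilon> (\<xi> n) (\<epsilon> ^ 3 * t) - ansatz_p W \<epsilon> t n)\<^sup>2) \<le> (16 + 8 * (log_bound B r)\<^sup>2) * \<epsilon> ^ 3 * (6 * B)"
proof -
  have pd: "profile B r d" using p by (simp add: d_def)
  have \<xi>: "\<xi> n = \<epsilon> * of_int n + - (\<epsilon> * t)" "\<xi> n - \<epsilon> / 2 = \<epsilon> * of_int n + (- (\<epsilon> * t) - \<epsilon> / 2)" for n
    by (simp_all add: \<xi>_def algebra_simps)
  note l2 = l2_from_mass[OF pd \<epsilon>(1) _ _ A]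
  have "(ansatz_w W \<epsilon> t n)\<^sup>2 \<le> 2 / \<epsilon> * mass d \<epsilon> (\<epsilon> * of_int n + - (\<epsilon> * t))" for n
    using profile_sample[OF pd _ \<epsilon>, of 0 "\<xi> n"]
    unfolding ansatz_w_def d_def iter_deriv_0 \<xi>(1)[symmetric] by (simp add: \<xi>_def)
  then show "(\<Sum>n\<in>A. (ansatz_w W \<epsilon> t n)\<^sup>2) \<le> 2 / \<epsilon> * (6 * B)" using \<epsilon> by (intro l2[where c = "- (\<epsilon> * t)"]) auto
  have "(ansatz_p W \<epsilon> t n)\<^sup>2 \<le> (2 + 2 * (log_bound B r)\<^sup>2) * (2 / \<epsilon>) * mass d \<epsilon> (\<epsilon> * of_int n + (- (\<epsilon> * t) - \<epsilon> / 2))" for n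
    using Q_profile_bound[OF pd r \<epsilon>, of "\<xi> n - \<epsilon> / 2"]
    unfolding ansatz_p_def d_def iter_deriv_0 \<xi>(2)[symmetric] by (simp add: \<xi>_def)
  then show "(\<Sum>n\<in>A. (ansatz_p W \<epsilon> t n)\<^sup>2) \<le> (2 + 2 * (log_bound B r)\<^sup>2) * (2 / \<epsilon>) * (6 * B)"
    using \<epsilon> by (intro l2[where c = "- (\<epsilon> * t) - \<epsilon> / 2"]) auto
  have B: "0 \<le> B" by (rule profile_range(2)[OF pd, of 0]) simp
  have "(\<Sum>n\<in>A. (residual1 d \<epsilon> (\<xi> n))\<^sup>2) \<le> (2 + (g_profile_bound B r)\<^sup>2) * \<epsilon> ^ 9 * (6 * B)"
    using residual1_bound[OF pd r(1) \<epsilon>] \<epsilon> unfolding \<xi>(1) by (intro l2[where c = "- (\<epsilon> * t)"]) auto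
  also have "\<dots> \<le> residual_const B r * \<epsilon> ^ 9 * (6 * B)"
    using \<epsilon> B residual2_const_nonneg[of B r] by (intro mult_right_mono) (auto simp: residual_const_def)
  finally show "(\<Sum>n\<in>A. (residual1 d \<epsilon> (\<xi> n))\<^sup>2) \<le> residual_const B r * \<epsilon> ^ 9 * (6 * B)" .
  have "(\<Sum>n\<in>A. (residual2 d \<epsilon> (\<xi> n - \<epsilon> / 2))\<^sup>2) \<le> residual2_const B r * \<epsilon> ^ 9 * (6 * B)"
    using residual2_bound[OF pd r(1) \<epsilon>] \<epsilon> residual2_const_nonneg[of B r] unfolding \<xi>(2) by (intro l2[where c = "- (\<epsilon> * t) - \<epsilon> / 2"]) auto
  also have "\<dots> \<le> residual_const B r * \<epsilon> ^ 9 * (6 * B)"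
    using \<epsilon> B by (intro mult_right_mono) (auto simp: residual_const_def)
  finally show "(\<Sum>n\<in>A. (residual2 d \<epsilon> (\<xi> n - \<epsilon> / 2))\<^sup>2) \<le> residual_const B r * \<epsilon> ^ 9 * (6 * B)" .
  have "(P W \<epsilon> (\<xi> n) (\<epsilon> ^ 3 * t) - ansatz_p W \<epsilon> t n)\<^sup>2
      \<le> (16 + 8 * (log_bound B r)\<^sup>2) * \<epsilon> ^ 3 * mass d \<epsilon> (\<epsilon> * of_int n + - (\<epsilon> * t))" for n
  proof -
    have "-1 < W (\<xi> n) (\<epsilon> ^ 3 * t)"
      using profileD(5)[OF p, of "\<xi> n"] r by (simp add: iter_deriv_0)
    moreover have "((\<lambda>x. W x (\<epsilon> ^ 3 * t)) has_real_derivative d 1 (\<xi> n)) (at (\<xi> n))"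
      using profileD(4)[OF p, of 0 "\<xi> n"] by (simp add: iter_deriv_def d_def)
    ultimately have "deriv (\<lambda>x. g (W x (\<epsilon> ^ 3 * t))) (\<xi> n) = (1 + ln (1 + W (\<xi> n) (\<epsilon> ^ 3 * t))) * d 1 (\<xi> n)"
      by (intro DERIV_imp_deriv DERIV_chain2[OF g_deriv])
    then have "P W \<epsilon> (\<xi> n) (\<epsilon> ^ 3 * t) = P_profile d \<epsilon> (\<xi> n)"
      unfolding P_def P_profile_def d_def iter_deriv_0 by (simp add: iter_deriv_def)
    moreover have "ansatz_p W \<epsilon> t n = - Q \<epsilon> (d 0 (\<xi> n - \<epsilon> / 2))"
      unfolding ansatz_p_def d_def iter_deriv_0 by (simp add: \<xi>_def)
    ultimately show ?thesis
      using P_profile_bound[OF pd r(1) \<epsilon>, of "\<xi> n"] unfolding \<xi>(1)[symmetric] by simp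
  qed
  then show "(\<Sum>n\<in>A. (P W \<epsilon> (\<xi> n) (\<epsilon> ^ 3 * t) - ansatz_p W \<epsilon> t n)\<^sup>2) \<le> (16 + 8 * (log_bound B r)\<^sup>2) * \<epsilon> ^ 3 * (6 * B)"
    using \<epsilon> by (intro l2[where c = "- (\<epsilon> * t)"]) auto
qed

lemma l2_of_bounded_sums:
  assumes "\<And>F. finite F \<Longrightarrow> (\<Sum>n\<in>F. (a n)\<^sup>2) \<le> K"
  shows "a \<in> l2" "l2_norm a \<le> sqrt K"
proof -
  have "0 \<le> K" using assms[of "{}"] by simp
  then show "a \<in> l2" "l2_norm a \<le> sqrt K" using l2_bound[of a "sqrt K"] assms by auto
qed

lemma sum_square_add_le:
  fixes u v :: "int \<Rightarrow> real"
  assumes "(\<Sum>n\<in>A. (u n)\<^sup>2) \<le> a" "(\<Sum>n\<in>A. (v n)\<^sup>2) \<le> b"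
  shows "(\<Sum>n\<in>A. (u n + v n)\<^sup>2) \<le> 2 * a + 2 * b"
proof -
  have "(\<Sum>n\<in>A. (u n + v n)\<^sup>2) \<le> 2 * (\<Sum>n\<in>A. (u n)\<^sup>2) + 2 * (\<Sum>n\<in>A. (v n)\<^sup>2)"
    unfolding sum_distrib_left sum.distrib[symmetric] by (intro sum_mono square_add_le)
  then show ?thesis using assms by linarith
qed

lemma l2_norm_le_powr:
  assumes "\<And>F. finite F \<Longrightarrow> (\<Sum>n\<in>F. (a n)\<^sup>2) \<le> K * \<epsilon> ^ 3" "0 < \<epsilon>"
  shows "l2_norm a \<le> sqrt K * \<epsilon> powr (3 / 2)"
proof -
  have "sqrt (K * \<epsilon> ^ 3) = sqrt K * \<epsilon> powr (3 / 2)"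
    using assms(2) by (simp add: real_sqrt_mult powr_half_sqrt[symmetric] powr_powr flip: powr_numeral)
  then show ?thesis using l2_of_bounded_sums(2)[OF assms(1)] by simp
qed

text \<open>
  The constants are chosen in this order: a range \<open>{\<alpha>..\<beta>}\<close> that contains the range of \<open>W\<close> with a
  margin \<open>\<delta>\<close> on both sides; the bounds \<open>c\<close>, \<open>C\<close> on the stiffness there; \<open>M\<close>, so that the energy is at
  most \<open>M * \<epsilon>\<^sup>3\<close> up to time \<open>O(\<epsilon>\<^sup>-\<^sup>3)\<close>; and finally \<open>\<epsilon>\<^sub>0\<close>, so that an energy of this size forces
  \<open>\<bar>w\<^sub>n - X\<^sub>n\<bar> \<le> \<delta>\<close>. The solution of the extended lattice then stays in \<open>{\<alpha>..\<beta>}\<close>, where its force is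
  \<open>V'\<close>.
\<close>

theorem theorem3:
  fixes W :: "real \<Rightarrow> real \<Rightarrow> real" and s :: nat and \<tau>\<^sub>0 \<tau>\<^sub>1 r\<^sub>W :: real
  assumes "6 \<le> s" and "0 \<le> \<tau>\<^sub>0" and "0 \<le> \<tau>\<^sub>1"
    and "continuous_into_sobolev s {-\<tau>\<^sub>0..\<tau>\<^sub>1} W"
    and "log_KdV_solution {-\<tau>\<^sub>0..\<tau>\<^sub>1} W"
    and "r\<^sub>W > -1" and "\<forall>\<tau>\<in>{-\<tau>\<^sub>0..\<tau>\<^sub>1}. \<forall>\<xi>. W \<xi> \<tau> \<ge> r\<^sub>W"
  shows "\<exists>\<epsilon>\<^sub>0>0. \<exists>C\<^sub>0>0. \<forall>\<epsilon>\<in>{0<..<\<epsilon>\<^sub>0}. \<forall>w_ini\<in>l2. \<forall>p_ini\<in>l2.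
      l2_norm (\<lambda>n. w_ini n - W (\<epsilon> * of_int n) 0) +
      l2_norm (\<lambda>n. p_ini n - P W \<epsilon> (\<epsilon> * of_int n) 0) \<le> \<epsilon> powr (3 / 2) \<longrightarrow>
      (\<exists>w p.
         solves_lattice_ivp \<epsilon> {-\<tau>\<^sub>0 / \<epsilon>^3..\<tau>\<^sub>1 / \<epsilon>^3} w_ini p_ini w p \<and>
         unique_l2_solution \<epsilon> {-\<tau>\<^sub>0 / \<epsilon>^3..\<tau>\<^sub>1 / \<epsilon>^3} w_ini p_ini w p \<and>
         C1_into_l2 {-\<tau>\<^sub>0 / \<epsilon>^3..\<tau>\<^sub>1 / \<epsilon>^3} w \<and>
         C1_into_l2 {-\<tau>\<^sub>0 / \<epsilon>^3..\<tau>\<^sub>1 / \<epsilon>^3} p \<and>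
         (\<forall>t\<in>{-\<tau>\<^sub>0 / \<epsilon>^3..\<tau>\<^sub>1 / \<epsilon>^3}.
            l2_norm (\<lambda>n. w t n - W (\<epsilon> * (of_int n - t)) (\<epsilon>^3 * t)) +
            l2_norm (\<lambda>n. p t n - P W \<epsilon> (\<epsilon> * (of_int n - t)) (\<epsilon>^3 * t))
              \<le> C\<^sub>0 * \<epsilon> powr (3 / 2)))"
proof -
  note W = assms(4) and sol = assms(5)
  let ?I = "{-\<tau>\<^sub>0..\<tau>\<^sub>1}"
  \<comment> \<open>The extension of the force must keep its zero at \<open>0\<close>, so \<open>0\<close> has to lie in the range.\<close>
  define r where "r = min r\<^sub>W 0"
  have r: "-1 < r" "r \<le> 0" using assms(6) by (auto simp: r_def)
  obtain B where prof: "\<And>\<tau>. \<tau> \<in> ?I \<Longrightarrow> profile B r (iter_deriv W \<tau>)"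
    by (rule uniform_profile[OF W compact_Icc assms(1), of r]) (use assms(7) in \<open>auto simp: r_def min_le_iff_disj\<close>)
  have zero_in: "0 \<in> ?I" using assms(2,3) by simp
  have B: "0 \<le> B" by (rule profile_range(2)[OF prof[OF zero_in], of 0]) simp
  define \<Lambda> where "\<Lambda> = log_bound B r"
  have \<Lambda>: "0 \<le> \<Lambda>" unfolding \<Lambda>_def by (rule profile_log_bound(2)[OF prof[OF zero_in] r(1)])
  define \<alpha> where "\<alpha> = (r - 1) / 2"
  define \<beta> where "\<beta> = sqrt (12 * B) + 1"
  have \<alpha>: "-1 < \<alpha>" "\<alpha> \<le> 0" "\<alpha> < r" and \<beta>: "0 \<le> \<beta>" using r B by (auto simp: \<alpha>_def \<beta>_def)
  define c where "c = 1 + \<alpha>"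
  define C where "C = 2 * (1 + \<beta>)"
  have c: "0 < c" and C: "0 \<le> C" using \<alpha> \<beta> by (auto simp: c_def C_def)
  define H where "H = 2 / c * ((2 + \<Lambda>) * sqrt (12 * B))"
  have H: "0 \<le> H" using c \<Lambda> B by (simp add: H_def)
  define Kp where "Kp = (16 + 8 * \<Lambda>\<^sup>2) * (6 * B)"
  have Kp: "0 \<le> Kp" using B by (simp add: Kp_def)
  define M where "M = (1 + C) / 2 * (2 + 2 * Kp + residual_const B r * (6 * B))
    * exp ((1 + C / c + 2 * H / c) * (\<tau>\<^sub>0 + \<tau>\<^sub>1))"
  have "0 \<le> residual_const B r" using residual2_const_nonneg[of B r] by (simp add: residual_const_def)
  then have M: "0 \<le> M" unfolding M_def using C Kp B by (intro mult_nonneg_nonneg add_nonneg_nonneg) auto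
  define \<delta> where "\<delta> = min 1 (r - \<alpha>)"
  have \<delta>: "0 < \<delta>" using \<alpha> by (simp add: \<delta>_def)
  define \<epsilon>\<^sub>0 where "\<epsilon>\<^sub>0 = min 1 (\<delta>\<^sup>2 / (2 * M / c + 1))"
  define C\<^sub>0 where "C\<^sub>0 = sqrt (2 * M / c) + sqrt (4 * M + 2 * Kp) + 1"
  have den: "0 < 2 * M / c + 1" using M c by (intro add_nonneg_pos) auto
  have \<epsilon>\<^sub>0: "0 < \<epsilon>\<^sub>0" using \<delta> den by (simp add: \<epsilon>\<^sub>0_def)
  have C\<^sub>0: "0 < C\<^sub>0" using M Kp c by (simp add: C\<^sub>0_def add_nonneg_pos)
  show ?thesis
  proof (rule exI[of _ \<epsilon>\<^sub>0], rule conjI[OF \<epsilon>\<^sub>0], rule exI[of _ C\<^sub>0], rule conjI[OF C\<^sub>0], intro ballI impI)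
    fix \<epsilon> w_ini p_ini
    assume \<epsilon>_in: "\<epsilon> \<in> {0<..<\<epsilon>\<^sub>0}" and ini: "w_ini \<in> l2" "p_ini \<in> l2"
      and close: "l2_norm (\<lambda>n. w_ini n - W (\<epsilon> * of_int n) 0) +
        l2_norm (\<lambda>n. p_ini n - P W \<epsilon> (\<epsilon> * of_int n) 0) \<le> \<epsilon> powr (3 / 2)"
    have \<epsilon>: "0 < \<epsilon>" "\<epsilon> \<le> 1" using \<epsilon>_in by (auto simp: \<epsilon>\<^sub>0_def)
    let ?J = "{-\<tau>\<^sub>0 / \<epsilon>^3..\<tau>\<^sub>1 / \<epsilon>^3}"
    have \<epsilon>3: "0 < \<epsilon> ^ 3" using \<epsilon> by simp
    have J: "\<epsilon> ^ 3 * t \<in> ?I" if "t \<in> ?J" for t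
      using that \<epsilon>3 by (auto simp: field_simps)
    have J0: "-\<tau>\<^sub>0 / \<epsilon>^3 \<le> 0" "0 \<le> \<tau>\<^sub>1 / \<epsilon>^3" using assms(2,3) \<epsilon>3 by (auto simp: divide_nonpos_pos)
    then have zero_J: "0 \<in> ?J" by simp
    obtain \<phi> \<Phi> where \<Phi>: "\<And>x. (\<Phi> has_real_derivative \<phi> x) (at x)"
      and \<phi>: "\<And>x. (\<phi> has_real_derivative stiffness \<epsilon> \<alpha> \<beta> x) (at x)" and \<phi>0: "\<phi> 0 = 0"
      and agree: "\<And>x. x \<in> {\<alpha>..\<beta>} \<Longrightarrow> \<phi> x = V' \<epsilon> x"
      and lip: "\<And>x y. \<bar>\<phi> x - \<phi> y\<bar> \<le> 2 * (1 + \<beta>) * \<bar>x - y\<bar>"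
      using force_extension[OF \<alpha>(1,2) \<beta> \<epsilon>] by metis
    have C': "0 \<le> 2 * (1 + \<beta>)" using \<beta> by simp
    obtain w p where w0: "w 0 = w_ini" and p0: "p 0 = p_ini"
      and C1: "\<And>I. C1_into_l2 I w" "\<And>I. C1_into_l2 I p"
      and w': "\<And>t n. ((\<lambda>r. w r n) has_real_derivative p t (n + 1) - p t n) (at t)"
      and p': "\<And>t n. ((\<lambda>r. p r n) has_real_derivative \<phi> (w t n) - \<phi> (w t (n - 1))) (at t)"
      using lattice_global_solution[OF lip \<phi>0 C' ini] by metis
    let ?X = "ansatz_w W \<epsilon>" and ?Y = "ansatz_p W \<epsilon>"
    define d where "d t = iter_deriv W (\<epsilon> ^ 3 * t)" for t
    define X' where "X' t n = time_rate (d t) \<epsilon> (\<epsilon> * (of_int n - t))" for t and n :: int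
    define R1 where "R1 t n = residual1 (d t) \<epsilon> (\<epsilon> * (of_int n - t))" for t and n :: int
    define R2 where "R2 t n = residual2 (d t) \<epsilon> (\<epsilon> * (of_int n - t) - \<epsilon> / 2)" for t and n :: int
    have eqs: "((\<lambda>u. ?X u n) has_real_derivative X' t n) (at t within ?J)"
      "X' t n = ?Y t (n + 1) - ?Y t n + R1 t n"
      "((\<lambda>u. ?Y u n) has_real_derivative V' \<epsilon> (?X t n) - V' \<epsilon> (?X t (n - 1)) + R2 t n) (at t within ?J)"
      if "t \<in> ?J" for t n
      unfolding X'_def R1_def R2_def d_def
      by (rule ansatz_equations[where J = ?J, OF W sol assms(1) r(1) _ _ \<epsilon>(1) that]; erule prof J)+
    note sums = ansatz_sums[OF prof[OF J] r \<epsilon>, folded d_def, folded R1_def R2_def, folded \<Lambda>_def]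
    have X_range: "?X t n \<in> {\<alpha>..\<beta>}" "r \<le> ?X t n" "?X t n \<le> \<beta> - 1" if "t \<in> ?J" for t n
      using profile_in_range[OF prof[OF J[OF that]], of "\<epsilon> * (of_int n - t)"] \<alpha>
      by (auto simp: ansatz_w_def iter_deriv_0 \<beta>_def)
    have Y': "((\<lambda>u. ?Y u n) has_real_derivative \<phi> (?X t n) - \<phi> (?X t (n - 1)) + R2 t n) (at t within ?J)" if "t \<in> ?J" for t n
      using eqs(3)[OF that] agree[OF X_range(1)[OF that]] by simp
    have l2w: "w t \<in> l2" and l2p: "p t \<in> l2" for t using C1[of "{t}"] by (auto simp: C1_into_l2_def)
    obtain Mw Mp where Mw: "\<And>t. t \<in> ?J \<Longrightarrow> l2_norm (w t) \<le> Mw" and Mp: "\<And>t. t \<in> ?J \<Longrightarrow> l2_norm (p t) \<le> Mp"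
      using C1_into_l2_bounded[OF C1(1)] C1_into_l2_bounded[OF C1(2)] by metis
    \<comment> \<open>A bound on the error that may depend on \<open>\<epsilon>\<close> in any way.\<close>
    define Z where "Z = 2 * (Mw\<^sup>2 + Mp\<^sup>2) + 2 * (2 / \<epsilon> * (6 * B) + (2 + 2 * \<Lambda>\<^sup>2) * (2 / \<epsilon>) * (6 * B))"
    have Zw: "(\<Sum>n\<in>A. (w t n - ?X t n)\<^sup>2) \<le> Z" and Zp: "(\<Sum>n\<in>A. (p t n - ?Y t n)\<^sup>2) \<le> Z"
      if t: "t \<in> ?J" and A: "finite A" for t A
    proof -
      have nn: "0 \<le> 2 / \<epsilon> * (6 * B)" "0 \<le> (2 + 2 * \<Lambda>\<^sup>2) * (2 / \<epsilon>) * (6 * B)" using \<epsilon> B by auto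
      have "(\<Sum>n\<in>A. (w t n)\<^sup>2) \<le> Mw\<^sup>2"
        using sum_le_l2_norm[OF l2w A, of t] power_mono[OF Mw[OF t] l2_norm_nonneg, of 2] by linarith
      moreover have "(\<Sum>n\<in>A. (- ?X t n)\<^sup>2) \<le> 2 / \<epsilon> * (6 * B)" using sums(1)[OF t A] by simp
      ultimately have 1: "(\<Sum>n\<in>A. (w t n + - ?X t n)\<^sup>2) \<le> 2 * Mw\<^sup>2 + 2 * (2 / \<epsilon> * (6 * B))"
        by (rule sum_square_add_le)
      have "(\<Sum>n\<in>A. (p t n)\<^sup>2) \<le> Mp\<^sup>2"
        using sum_le_l2_norm[OF l2p A, of t] power_mono[OF Mp[OF t] l2_norm_nonneg, of 2] by linarith
      moreover have "(\<Sum>n\<in>A. (- ?Y t n)\<^sup>2) \<le> (2 + 2 * \<Lambda>\<^sup>2) * (2 / \<epsilon>) * (6 * B)" using sums(2)[OF t A] by simp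
      ultimately have 2: "(\<Sum>n\<in>A. (p t n + - ?Y t n)\<^sup>2) \<le> 2 * Mp\<^sup>2 + 2 * ((2 + 2 * \<Lambda>\<^sup>2) * (2 / \<epsilon>) * (6 * B))"
        by (rule sum_square_add_le)
      show "(\<Sum>n\<in>A. (w t n - ?X t n)\<^sup>2) \<le> Z" "(\<Sum>n\<in>A. (p t n - ?Y t n)\<^sup>2) \<le> Z"
        using 1 2 nn zero_le_power2[of Mw] zero_le_power2[of Mp]
        unfolding Z_def add_uminus_conv_diff distrib_left by linarith+
    qed
    have powr: "(\<epsilon> powr (3 / 2))\<^sup>2 = \<epsilon> ^ 3"
      using \<epsilon> by (simp add: power2_eq_square flip: powr_add)
    have X0: "?X 0 n = W (\<epsilon> * of_int n) 0" for n by (simp add: ansatz_w_def)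
    have l2X0: "?X 0 \<in> l2" and l2Y0: "?Y 0 \<in> l2" and l2PY: "(\<lambda>n. P W \<epsilon> (\<epsilon> * of_int n) 0 - ?Y 0 n) \<in> l2"
      using l2_of_bounded_sums(1)[OF sums(1)[OF zero_J]] l2_of_bounded_sums(1)[OF sums(2)[OF zero_J]]
        l2_of_bounded_sums(1)[OF sums(5)[OF zero_J]] by simp_all
    have l2P0: "(\<lambda>n. P W \<epsilon> (\<epsilon> * of_int n) 0) \<in> l2"
      using l2_add_scale[OF l2PY l2Y0, of 1] by simp
    have Iw: "(\<Sum>n\<in>A. (w 0 n - ?X 0 n)\<^sup>2) \<le> (2 + 2 * Kp) * \<epsilon> ^ 3"
      and Ip: "(\<Sum>n\<in>A. (p 0 n - ?Y 0 n)\<^sup>2) \<le> (2 + 2 * Kp) * \<epsilon> ^ 3" if A: "finite A" for A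
    proof -
      have "(\<lambda>n. w_ini n - W (\<epsilon> * of_int n) 0) \<in> l2"
        using l2_add_scale[OF ini(1) l2X0, of "-1"] by (simp add: X0)
      from sum_le_l2_norm[OF this A]
      have "(\<Sum>n\<in>A. (w_ini n - W (\<epsilon> * of_int n) 0)\<^sup>2) \<le> (l2_norm (\<lambda>n. w_ini n - W (\<epsilon> * of_int n) 0))\<^sup>2" .
      also have "\<dots> \<le> (\<epsilon> powr (3 / 2))\<^sup>2"
        using close l2_norm_nonneg[of "\<lambda>n. p_ini n - P W \<epsilon> (\<epsilon> * of_int n) 0"] by (intro power_mono l2_norm_nonneg) linarith
      also have "\<dots> \<le> (2 + 2 * Kp) * \<epsilon> ^ 3" unfolding powr using \<epsilon>3 Kp by simp
      finally show "(\<Sum>n\<in>A. (w 0 n - ?X 0 n)\<^sup>2) \<le> (2 + 2 * Kp) * \<epsilon> ^ 3" by (simp add: w0 X0)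
      have "(\<lambda>n. p_ini n - P W \<epsilon> (\<epsilon> * of_int n) 0) \<in> l2"
        using l2_add_scale[OF ini(2) l2P0, of "-1"] by simp
      from sum_le_l2_norm[OF this A]
      have "(\<Sum>n\<in>A. (p_ini n - P W \<epsilon> (\<epsilon> * of_int n) 0)\<^sup>2) \<le> (l2_norm (\<lambda>n. p_ini n - P W \<epsilon> (\<epsilon> * of_int n) 0))\<^sup>2" .
      also have "\<dots> \<le> (\<epsilon> powr (3 / 2))\<^sup>2"
        using close l2_norm_nonneg[of "\<lambda>n. w_ini n - W (\<epsilon> * of_int n) 0"] by (intro power_mono l2_norm_nonneg) linarith
      finally have "(\<Sum>n\<in>A. (p_ini n - P W \<epsilon> (\<epsilon> * of_int n) 0)\<^sup>2) \<le> \<epsilon> ^ 3" unfolding powr .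
      moreover have "(\<Sum>n\<in>A. (P W \<epsilon> (\<epsilon> * of_int n) 0 - ?Y 0 n)\<^sup>2) \<le> Kp * \<epsilon> ^ 3"
        using sums(5)[OF zero_J A] by (simp add: Kp_def mult_ac)
      ultimately have "(\<Sum>n\<in>A. (p_ini n - P W \<epsilon> (\<epsilon> * of_int n) 0 + (P W \<epsilon> (\<epsilon> * of_int n) 0 - ?Y 0 n))\<^sup>2)
          \<le> 2 * \<epsilon> ^ 3 + 2 * (Kp * \<epsilon> ^ 3)"
        by (rule sum_square_add_le)
      then show "(\<Sum>n\<in>A. (p 0 n - ?Y 0 n)\<^sup>2) \<le> (2 + 2 * Kp) * \<epsilon> ^ 3"
        by (simp add: p0 algebra_simps)
    qed
    have energy: "(\<Sum>n\<in>A. (p t n - ?Y t n)\<^sup>2 / 2 + c / 2 * (w t n - ?X t n)\<^sup>2) \<le> M * \<epsilon> ^ 3"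
      if t: "t \<in> ?J" and A: "finite A" for t A
    proof -
      let ?E = "residual_const B r * \<epsilon> ^ 9 * (6 * B)"
      have "(\<Sum>n\<in>A. (p t n - ?Y t n)\<^sup>2 / 2 + c / 2 * (w t n - ?X t n)\<^sup>2)
          \<le> (1 + C) / 2 * ((2 + 2 * Kp) * \<epsilon> ^ 3 + ?E / (\<epsilon> ^ 3)\<^sup>2) * exp ((1 + C / c + 2 * H / c) * \<epsilon> ^ 3 * \<bar>t\<bar>)"
      proof (rule lattice_energy_estimate[OF \<Phi> \<phi> _ _ c _ _ w' p' eqs(1) eqs(2) Y' _ H \<epsilon>3 sums(3) sums(4) Zw Zp Iw Ip J0 t A])
        note sb = stiffness_bounds[OF \<alpha>(1,2) \<beta> \<epsilon>]
        show "c \<le> stiffness \<epsilon> \<alpha> \<beta> x" "stiffness \<epsilon> \<alpha> \<beta> x \<le> C" for x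
          using sb(1,2) by (simp_all add: c_def C_def)
        show "\<bar>stiffness \<epsilon> \<alpha> \<beta> x - stiffness \<epsilon> \<alpha> \<beta> y\<bar> \<le> 2 * \<epsilon>\<^sup>2 / c * \<bar>x - y\<bar>" for x y
          using sb(3) by (simp add: c_def)
        show "0 \<le> 2 * \<epsilon>\<^sup>2 / c" using c by simp
        show "2 * \<epsilon>\<^sup>2 / c * \<bar>X' t n\<bar> \<le> H * \<epsilon> ^ 3" if "t \<in> ?J" for t n
        proof -
          have "\<bar>X' t n\<bar> \<le> (2 + \<Lambda>) * sqrt (12 * B) * \<epsilon>"
            unfolding X'_def d_def \<Lambda>_def by (rule time_rate_bound[OF prof[OF J[OF that]] r(1) \<epsilon>])
          then have "2 * \<epsilon>\<^sup>2 / c * \<bar>X' t n\<bar> \<le> 2 * \<epsilon>\<^sup>2 / c * ((2 + \<Lambda>) * sqrt (12 * B) * \<epsilon>)"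
            using c by (intro mult_left_mono) auto
          also have "\<dots> = H * \<epsilon> ^ 3" by (simp add: H_def power2_eq_square power3_eq_cube)
          finally show ?thesis .
        qed
      qed
      also have "?E / (\<epsilon> ^ 3)\<^sup>2 = residual_const B r * (6 * B) * \<epsilon> ^ 3"
        using \<epsilon>(1) by (simp add: field_simps flip: power_mult power_add)
      also have "(1 + C) / 2 * ((2 + 2 * Kp) * \<epsilon> ^ 3 + residual_const B r * (6 * B) * \<epsilon> ^ 3) * exp ((1 + C / c + 2 * H / c) * \<epsilon> ^ 3 * \<bar>t\<bar>)
          \<le> (1 + C) / 2 * ((2 + 2 * Kp) * \<epsilon> ^ 3 + residual_const B r * (6 * B) * \<epsilon> ^ 3) * exp ((1 + C / c + 2 * H / c) * (\<tau>\<^sub>0 + \<tau>\<^sub>1))"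
      proof (intro mult_left_mono)
        have "\<epsilon> ^ 3 * \<bar>t\<bar> = \<bar>\<epsilon> ^ 3 * t\<bar>" using \<epsilon>3 by (simp add: abs_mult)
        also have "\<dots> \<le> \<tau>\<^sub>0 + \<tau>\<^sub>1" using J[OF t] assms(2,3) by auto
        finally have "(1 + C / c + 2 * H / c) * (\<epsilon> ^ 3 * \<bar>t\<bar>) \<le> (1 + C / c + 2 * H / c) * (\<tau>\<^sub>0 + \<tau>\<^sub>1)"
          using c C H by (intro mult_left_mono) auto
        then show "exp ((1 + C / c + 2 * H / c) * \<epsilon> ^ 3 * \<bar>t\<bar>) \<le> exp ((1 + C / c + 2 * H / c) * (\<tau>\<^sub>0 + \<tau>\<^sub>1))"
          by (simp add: mult.assoc)
      qed (use C Kp B \<epsilon>3 \<open>0 \<le> residual_const B r\<close> in auto)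
      also have "\<dots> = M * \<epsilon> ^ 3" by (simp add: M_def algebra_simps)
      finally show ?thesis .
    qed
    have w_err: "(\<Sum>n\<in>A. (w t n - ?X t n)\<^sup>2) \<le> 2 * M / c * \<epsilon> ^ 3"
      and p_err: "(\<Sum>n\<in>A. (p t n - ?Y t n)\<^sup>2) \<le> 2 * M * \<epsilon> ^ 3" if t: "t \<in> ?J" and A: "finite A" for t A
    proof -
      have "c / 2 * (\<Sum>n\<in>A. (w t n - ?X t n)\<^sup>2) + 1 / 2 * (\<Sum>n\<in>A. (p t n - ?Y t n)\<^sup>2)
          = (\<Sum>n\<in>A. (p t n - ?Y t n)\<^sup>2 / 2 + c / 2 * (w t n - ?X t n)\<^sup>2)"
        unfolding sum_distrib_left sum.distrib[symmetric] by (intro sum.cong) auto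
      also have "\<dots> \<le> M * \<epsilon> ^ 3" by (rule energy[OF t A])
      finally have *: "c / 2 * (\<Sum>n\<in>A. (w t n - ?X t n)\<^sup>2) + 1 / 2 * (\<Sum>n\<in>A. (p t n - ?Y t n)\<^sup>2) \<le> M * \<epsilon> ^ 3" .
      have nn: "0 \<le> c / 2 * (\<Sum>n\<in>A. (w t n - ?X t n)\<^sup>2)" "0 \<le> (\<Sum>n\<in>A. (p t n - ?Y t n)\<^sup>2)"
        using c by (auto intro!: mult_nonneg_nonneg sum_nonneg)
      have "c / 2 * (\<Sum>n\<in>A. (w t n - ?X t n)\<^sup>2) \<le> M * \<epsilon> ^ 3" using * nn by linarith
      then show "(\<Sum>n\<in>A. (w t n - ?X t n)\<^sup>2) \<le> 2 * M / c * \<epsilon> ^ 3" using c by (simp add: field_simps)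
      show "(\<Sum>n\<in>A. (p t n - ?Y t n)\<^sup>2) \<le> 2 * M * \<epsilon> ^ 3" using * nn by linarith
    qed
    have small: "2 * M / c * \<epsilon> ^ 3 \<le> \<delta>\<^sup>2"
    proof -
      have "\<epsilon> ^ 3 \<le> \<epsilon> ^ 1" using \<epsilon> by (intro power_decreasing) auto
      then have "2 * M / c * \<epsilon> ^ 3 \<le> (2 * M / c + 1) * \<epsilon>" using M c \<epsilon> by (intro mult_mono) auto
      also have "\<dots> \<le> (2 * M / c + 1) * (\<delta>\<^sup>2 / (2 * M / c + 1))"
        using \<epsilon>_in den by (intro mult_left_mono) (auto simp: \<epsilon>\<^sub>0_def)
      also have "\<dots> = \<delta>\<^sup>2" using den by simp
      finally show ?thesis .
    qed
    have w_range: "w t n \<in> {\<alpha>..\<beta>}" if t: "t \<in> ?J" for t n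
    proof -
      have "(w t n - ?X t n)\<^sup>2 \<le> \<delta>\<^sup>2" using w_err[OF t, of "{n}"] small by simp
      then have "\<bar>w t n - ?X t n\<bar> \<le> \<delta>" using \<delta> by (intro power2_le_imp_le[of "\<bar>w t n - ?X t n\<bar>"]) auto
      then show ?thesis using X_range(2,3)[OF t, of n] unfolding \<delta>_def atLeastAtMost_iff by linarith
    qed
    have ivp: "solves_lattice_ivp \<epsilon> ?J w_ini p_ini w p"
      unfolding solves_lattice_ivp_def
    proof (intro conjI ballI allI w0 p0)
      fix t n assume t: "t \<in> ?J"
      show "- 1 < w t n" using w_range[OF t, of n] \<alpha> by auto
      show "((\<lambda>r. w r n) has_real_derivative p t (n + 1) - p t n) (at t within ?J)"
        by (rule has_field_derivative_at_within[OF w'])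
      show "((\<lambda>r. p r n) has_real_derivative V' \<epsilon> (w t n) - V' \<epsilon> (w t (n - 1))) (at t within ?J)"
        using has_field_derivative_at_within[OF p'[of n t], of ?J] agree[OF w_range[OF t]] by simp
    qed
    have bound: "l2_norm (\<lambda>n. w t n - W (\<epsilon> * (of_int n - t)) (\<epsilon>^3 * t)) +
            l2_norm (\<lambda>n. p t n - P W \<epsilon> (\<epsilon> * (of_int n - t)) (\<epsilon>^3 * t)) \<le> C\<^sub>0 * \<epsilon> powr (3 / 2)" if t: "t \<in> ?J" for t
    proof -
      have "l2_norm (\<lambda>n. w t n - W (\<epsilon> * (of_int n - t)) (\<epsilon>^3 * t)) \<le> sqrt (2 * M / c) * \<epsilon> powr (3 / 2)"
        using w_err[OF t] unfolding ansatz_w_def by (intro l2_norm_le_powr \<epsilon>(1))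
      moreover have "l2_norm (\<lambda>n. p t n - P W \<epsilon> (\<epsilon> * (of_int n - t)) (\<epsilon>^3 * t)) \<le> sqrt (4 * M + 2 * Kp) * \<epsilon> powr (3 / 2)"
      proof (rule l2_norm_le_powr[OF _ \<epsilon>(1)])
        fix A :: "int set" assume A: "finite A"
        have "(\<Sum>n\<in>A. (?Y t n - P W \<epsilon> (\<epsilon> * (of_int n - t)) (\<epsilon>^3 * t))\<^sup>2) \<le> Kp * \<epsilon> ^ 3"
          using sums(5)[OF t A] by (simp add: power2_commute[of "?Y t n" for n] Kp_def mult_ac)
        from sum_square_add_le[OF p_err[OF t A] this]
        show "(\<Sum>n\<in>A. (p t n - P W \<epsilon> (\<epsilon> * (of_int n - t)) (\<epsilon>^3 * t))\<^sup>2) \<le> (4 * M + 2 * Kp) * \<epsilon> ^ 3"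
          by (simp add: algebra_simps)
      qed
      moreover have "0 \<le> \<epsilon> powr (3 / 2)" by simp
      ultimately show ?thesis unfolding C\<^sub>0_def distrib_right by linarith
    qed
    show "\<exists>w p.
         solves_lattice_ivp \<epsilon> ?J w_ini p_ini w p \<and>
         unique_l2_solution \<epsilon> ?J w_ini p_ini w p \<and>
         C1_into_l2 ?J w \<and> C1_into_l2 ?J p \<and>
         (\<forall>t\<in>?J. l2_norm (\<lambda>n. w t n - W (\<epsilon> * (of_int n - t)) (\<epsilon>^3 * t)) +
            l2_norm (\<lambda>n. p t n - P W \<epsilon> (\<epsilon> * (of_int n - t)) (\<epsilon>^3 * t)) \<le> C\<^sub>0 * \<epsilon> powr (3 / 2))"
      using ivp unique_l2_solutionI[OF ivp C1] C1 bound by blast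
  qed
qed

end
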